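(* Let $R$ be a commutative ring with $1$, $A$ a commutative $R$-algebra, and $H$ and $Q$ finitely generated projective $A$-modules. Then Lie-Rinehart triple structures on $(A,H,Q)$ and (multi) Maurer-Cartan algebra structures on $\mathrm{Alt}_A(Q,\mathrm{Alt}_A(H,A))$ are equivalent notions: assigning to a Lie-Rinehart triple structure the three operators $d_0,d_1,d_2$ described in the context defines a bijection from the set of Lie-Rinehart triple structures on $(A,H,Q)$ onto the set of (multi) Maurer-Cartan algebra structures $(d_0,d_1,d_2)$ on $\mathrm{Alt}_A(Q,\mathrm{Alt}_A(H,A))$.
   Context: A Lie-Rinehart algebra $(A,L)$ is an $R$-Lie algebra $L$ with an $A$-module structure and a morphism of $R$-Lie algebras $L\to\mathrm{Der}_R(A)$, $x\mapsto(a\mapsto x(a))$, with $(ax)(b)=a(x(b))$ and $[x,ay]=x(a)y+a[x,y]$. **Triples.** An almost pre-Lie-Rinehart triple $(A,H,Q)$ consists of $A$-modules $H,Q$ with alternating $R$-bilinear brackets $[\cdot,\cdot]_H\colon H\times H\to H$, $[\cdot,\cdot]_Q\colon Q\times Q\to Q$; $R$-bilinear maps $H\times A\to A$, $(x,a)\mapsto x(a)$, $Q\times A\to A$, $(\xi,a)\mapsto \xi(a)$, $H\times Q\to Q$, $(x,\xi)\mapsto x\cdot\xi$, $Q\times H\to H$, $(\xi,x)\mapsto \xi\cdot x$; and an alternating $A$-bilinear map $\delta\colon Q\times Q\to H$, such that: every $x\in H$ and every $\xi\in Q$ acts on $A$ by $R$-derivations; $(ax)(b)=a(x(b))$, $[x,ay]_H=x(a)y+a[x,y]_H$,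 $(a\xi)(b)=a(\xi(b))$, $[\xi,a\eta]_Q=\xi(a)\eta+a[\xi,\eta]_Q$; $x\cdot(a\xi)=x(a)\xi+a(x\cdot\xi)$, $(ax)\cdot\xi=a(x\cdot\xi)$, $\xi\cdot(ax)=\xi(a)x+a(\xi\cdot x)$, $(a\xi)\cdot x=a(\xi\cdot x)$ ($a,b\in A$, $x,y\in H$, $\xi,\eta\in Q$). It is a Lie-Rinehart triple if $L=H\oplus Q$ with the bracket $[(x,\xi),(y,\eta)]=[x,y]_H+[\xi,\eta]_Q+\delta(\xi,\eta)+x\cdot\eta-\eta\cdot x+\xi\cdot y-y\cdot\xi$ and the action $(x,\xi)(a)=x(a)+\xi(a)$ is such that $(A,L)$ is a Lie-Rinehart algebra. **Maurer-Cartan algebras.** $\mathrm{Alt}^p_A(Q,\mathrm{Alt}^q_A(H,A))$ denotes alternating $A$-multilinear $p$-forms on $Q$ with values in the alternating $A$-multilinear $q$-forms on $H$; an element $f$ of it has total degree $|f|=-(p+q)$. The bigraded algebra structure is that of $\mathrm{Alt}_A(Q\oplus H,A)$ under the identification $f(\xi_1,\dots,\xi_p)(x_1,\dots,x_q)=F(\xi_1,\dots,\xi_p,x_1,\dots,x_q)$, with Eilenberg-Koszul product $FG=(-1)^{|F||G|}F\wedge G$ ($\wedge$ the usual shuffle product); derivations satisfy $d(fg)=(df)g+(-1)^{|f|}f\,dg$. A (multi) Maurer-Cartan algebra structure on it is a triple of $R$-derivations $d_j\colon \mathrm{Alt}^p_A(Q,\mathrm{Alt}^q_A(H,A))\to\mathrm{Alt}^{p+j}_A(Q,\mathrm{Alt}^{q-j+1}_A(H,A))$,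 $j=0,1,2$, with $(d_0+d_1+d_2)^2=0$. **Operators of a triple.** For $f\in\mathrm{Alt}^p_A(Q,\mathrm{Alt}^q_A(H,A))$: $$(-1)^{p+q+1}((d_0f)(\xi_1,\dots,\xi_p))(x_1,\dots,x_{q+1})=\sum_{j=1}^{q+1}(-1)^{p+j-1}x_j\big(f(\xi_1,\dots,\xi_p)(\dots\widehat{x_j}\dots)\big)$$ $$+\sum_{1\le j<k\le q+1}(-1)^{p+j+k}f(\xi_1,\dots,\xi_p)([x_j,x_k]_H,\dots\widehat{x_j}\dots\widehat{x_k}\dots)+\sum_{j=1}^p\sum_{k=1}^{q+1}(-1)^{j+k+p+1}f(x_k\cdot\xi_j,\xi_1,\dots\widehat{\xi_j}\dots,\xi_p)(\dots\widehat{x_k}\dots);$$ $$(-1)^{p+q+1}((d_1f)(\xi_1,\dots,\xi_{p+1}))(x_1,\dots,x_q)=\sum_{j=1}^{p+1}(-1)^{j-1}\xi_j\big(f(\dots\widehat{\xi_j}\dots)(x_1,\dots,x_q)\big)$$ $$+\sum_{1\le j<k\le p+1}(-1)^{j+k}f([\xi_j,\xi_k]_Q,\dots\widehat{\xi_j}\dots\widehat{\xi_k}\dots)(x_1,\dots,x_q)+\sum_{j=1}^{p+1}\sum_{k=1}^q(-1)^{j+k+1}f(\dots\widehat{\xi_j}\dots)(\xi_j\cdot x_k,x_1,\dots\widehat{x_k}\dots,x_q);$$ $$(-1)^{p+q+1}((d_2f)(\xi_1,\dots,\xi_{p+2}))(x_1,\dots,x_{q-1})=\sum_{1\le j<k\le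 p+2}(-1)^{j+k+p}f(\dots\widehat{\xi_j}\dots\widehat{\xi_k}\dots)(\delta(\xi_j,\xi_k),x_1,\dots,x_{q-1}).$$ *)

theory Defs
  imports Main "HOL-Library.FuncSet" "HOL-Library.Function_Algebras" "HOL-Library.Product_Plus"
begin

section \<open>Modules and algebras\<close>

text \<open>
  The sort \<open>{comm_ring, comm_monoid_mult}\<close> is that of commutative rings with 1. Unlike
  \<open>comm_ring_1\<close>, on which the library locale \<open>module\<close> is based, it does not exclude the
  zero ring; apart from this, the following locale is the same as \<open>module\<close>.
\<close>

locale module_over =
  fixes scale :: "'k::{comm_ring, comm_monoid_mult} \<Rightarrow> 'm::ab_group_add \<Rightarrow> 'm"
  assumes scale_right_distrib: "scale a (x + y) = scale a x + scale a y"
    and scale_left_distrib: "scale (a + b) x = scale a x + scale b x"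
    and scale_scale: "scale a (scale b x) = scale (a * b) x"
    and scale_one: "scale 1 x = x"

locale algebra_over = module_over sR
  for sR :: "'r::{comm_ring, comm_monoid_mult} \<Rightarrow> 'a::{comm_ring, comm_monoid_mult} \<Rightarrow> 'a" +
  assumes scale_mult: "sR r (a * b) = sR r a * b"

text \<open>
  The free module of rank \<open>n\<close>. A finitely generated projective module is a direct
  summand of such a module, i.e. the inclusion \<open>\<iota>\<close> has a linear left inverse \<open>\<pi>\<close>.
\<close>

definition free_module :: "nat \<Rightarrow> (nat \<Rightarrow> 'a::zero) set" where
  "free_module n = {v. \<forall>k\<ge>n. v k = 0}"

locale fg_projective_module = module_over s
  for s :: "'a::{comm_ring, comm_monoid_mult} \<Rightarrow> 'm::ab_group_add \<Rightarrow> 'm" +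
  assumes direct_summand_of_free:
    "\<exists>n (\<iota> :: 'm \<Rightarrow> nat \<Rightarrow> 'a) (\<pi> :: (nat \<Rightarrow> 'a) \<Rightarrow> 'm).
       (\<forall>x. \<iota> x \<in> free_module n) \<and>
       (\<forall>x y. \<iota> (x + y) = \<iota> x + \<iota> y) \<and>
       (\<forall>a x. \<iota> (s a x) = (\<lambda>k. a * \<iota> x k)) \<and>
       (\<forall>u\<in>free_module n. \<forall>v\<in>free_module n. \<pi> (u + v) = \<pi> u + \<pi> v) \<and>
       (\<forall>a. \<forall>u\<in>free_module n. \<pi> (\<lambda>k. a * u k) = s a (\<pi> u)) \<and>
       (\<forall>x. \<pi> (\<iota> x) = x)"

text \<open>The \<open>R\<close>-module structure of an \<open>A\<close>-module, by restriction along \<open>R \<rightarrow> A\<close>.\<close>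

definition restrict_scalars ::
  "('r \<Rightarrow> 'a::one \<Rightarrow> 'a) \<Rightarrow> ('a \<Rightarrow> 'm \<Rightarrow> 'm) \<Rightarrow> 'r \<Rightarrow> 'm \<Rightarrow> 'm" where
  "restrict_scalars sR s r x = s (sR r 1) x"

definition bilinear_over ::
  "('k \<Rightarrow> 'x::ab_group_add \<Rightarrow> 'x) \<Rightarrow> ('k \<Rightarrow> 'y::ab_group_add \<Rightarrow> 'y) \<Rightarrow>
   ('k \<Rightarrow> 'z::ab_group_add \<Rightarrow> 'z) \<Rightarrow> ('x \<Rightarrow> 'y \<Rightarrow> 'z) \<Rightarrow> bool" where
  "bilinear_over s1 s2 s3 b \<longleftrightarrow>
     (\<forall>x x' y. b (x + x') y = b x y + b x' y) \<and>
     (\<forall>x y y'. b x (y + y') = b x y + b x y') \<and>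
     (\<forall>c x y. b (s1 c x) y = s3 c (b x y)) \<and>
     (\<forall>c x y. b x (s2 c y) = s3 c (b x y))"

definition is_derivation ::
  "('r \<Rightarrow> 'a::{comm_ring, comm_monoid_mult} \<Rightarrow> 'a) \<Rightarrow> ('a \<Rightarrow> 'a) \<Rightarrow> bool" where
  "is_derivation sR D \<longleftrightarrow>
     (\<forall>a b. D (a + b) = D a + D b) \<and>
     (\<forall>r a. D (sR r a) = sR r (D a)) \<and>
     (\<forall>a b. D (a * b) = D a * b + a * D b)"


section \<open>Lie-Rinehart algebras and triples\<close>

locale lie_rinehart_algebra = algebra_over sR + module_over s
  for sR :: "'r::{comm_ring, comm_monoid_mult} \<Rightarrow> 'a::{comm_ring, comm_monoid_mult} \<Rightarrow> 'a"
    and s :: "'a \<Rightarrow> 'l::ab_group_add \<Rightarrow> 'l" +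
  fixes br :: "'l \<Rightarrow> 'l \<Rightarrow> 'l"
    and act :: "'l \<Rightarrow> 'a \<Rightarrow> 'a"
  assumes bracket_bilinear:
      "bilinear_over (restrict_scalars sR s) (restrict_scalars sR s) (restrict_scalars sR s) br"
    and bracket_self: "br x x = 0"
    and jacobi: "br x (br y z) + br y (br z x) + br z (br x y) = 0"
    and action_bilinear: "bilinear_over (restrict_scalars sR s) sR sR act"
    and action_derivation: "is_derivation sR (act x)"
    and action_bracket: "act (br x y) a = act x (act y a) - act y (act x a)"
    and action_scale: "act (s a x) b = a * act x b"
    and bracket_scale: "br x (s a y) = s (act x a) y + s a (br x y)"

record ('a, 'h, 'q) triple =
  brH :: "'h \<Rightarrow> 'h \<Rightarrow> 'h"
  brQ :: "'q \<Rightarrow> 'q \<Rightarrow> 'q"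
  actH :: "'h \<Rightarrow> 'a \<Rightarrow> 'a"
  actQ :: "'q \<Rightarrow> 'a \<Rightarrow> 'a"
  dotHQ :: "'h \<Rightarrow> 'q \<Rightarrow> 'q"
  dotQH :: "'q \<Rightarrow> 'h \<Rightarrow> 'h"
  delta :: "'q \<Rightarrow> 'q \<Rightarrow> 'h"

locale almost_pre_lie_rinehart_triple =
  algebra_over sR + H: module_over sH + Q: module_over sQ
  for sR :: "'r::{comm_ring, comm_monoid_mult} \<Rightarrow> 'a::{comm_ring, comm_monoid_mult} \<Rightarrow> 'a"
    and sH :: "'a \<Rightarrow> 'h::ab_group_add \<Rightarrow> 'h"
    and sQ :: "'a \<Rightarrow> 'q::ab_group_add \<Rightarrow> 'q" +
  fixes T :: "('a, 'h, 'q) triple"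
  assumes brH_bilinear:
      "bilinear_over (restrict_scalars sR sH) (restrict_scalars sR sH) (restrict_scalars sR sH) (brH T)"
    and brH_self: "brH T x x = 0"
    and brQ_bilinear:
      "bilinear_over (restrict_scalars sR sQ) (restrict_scalars sR sQ) (restrict_scalars sR sQ) (brQ T)"
    and brQ_self: "brQ T \<xi> \<xi> = 0"
    and actH_bilinear: "bilinear_over (restrict_scalars sR sH) sR sR (actH T)"
    and actQ_bilinear: "bilinear_over (restrict_scalars sR sQ) sR sR (actQ T)"
    and dotHQ_bilinear:
      "bilinear_over (restrict_scalars sR sH) (restrict_scalars sR sQ) (restrict_scalars sR sQ) (dotHQ T)"
    and dotQH_bilinear:
      "bilinear_over (restrict_scalars sR sQ) (restrict_scalars sR sH) (restrict_scalars sR sH) (dotQH T)"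
    and delta_bilinear: "bilinear_over sQ sQ sH (delta T)"
    and delta_self: "delta T \<xi> \<xi> = 0"
    and actH_derivation: "is_derivation sR (actH T x)"
    and actQ_derivation: "is_derivation sR (actQ T \<xi>)"
    and actH_scale: "actH T (sH a x) b = a * actH T x b"
    and brH_scale: "brH T x (sH a y) = sH (actH T x a) y + sH a (brH T x y)"
    and actQ_scale: "actQ T (sQ a \<xi>) b = a * actQ T \<xi> b"
    and brQ_scale: "brQ T \<xi> (sQ a \<eta>) = sQ (actQ T \<xi> a) \<eta> + sQ a (brQ T \<xi> \<eta>)"
    and dotHQ_scale_right: "dotHQ T x (sQ a \<xi>) = sQ (actH T x a) \<xi> + sQ a (dotHQ T x \<xi>)"
    and dotHQ_scale_left: "dotHQ T (sH a x) \<xi> = sQ a (dotHQ T x \<xi>)"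
    and dotQH_scale_right: "dotQH T \<xi> (sH a x) = sH (actQ T \<xi> a) x + sH a (dotQH T \<xi> x)"
    and dotQH_scale_left: "dotQH T (sQ a \<xi>) x = sH a (dotQH T \<xi> x)"

definition scale_prod :: "('a \<Rightarrow> 'm \<Rightarrow> 'm) \<Rightarrow> ('a \<Rightarrow> 'n \<Rightarrow> 'n) \<Rightarrow> 'a \<Rightarrow> 'm \<times> 'n \<Rightarrow> 'm \<times> 'n" where
  "scale_prod s t a = (\<lambda>(x, y). (s a x, t a y))"

definition total_bracket ::
  "('a, 'h::ab_group_add, 'q::ab_group_add) triple \<Rightarrow> 'h \<times> 'q \<Rightarrow> 'h \<times> 'q \<Rightarrow> 'h \<times> 'q" where
  "total_bracket T = (\<lambda>(x, \<xi>) (y, \<eta>).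
     (brH T x y + delta T \<xi> \<eta> - dotQH T \<eta> x + dotQH T \<xi> y,
      brQ T \<xi> \<eta> + dotHQ T x \<eta> - dotHQ T y \<xi>))"

definition total_action :: "('a::plus, 'h, 'q) triple \<Rightarrow> 'h \<times> 'q \<Rightarrow> 'a \<Rightarrow> 'a" where
  "total_action T = (\<lambda>(x, \<xi>) a. actH T x a + actQ T \<xi> a)"

locale lie_rinehart_triple = almost_pre_lie_rinehart_triple sR sH sQ T
  for sR :: "'r::{comm_ring, comm_monoid_mult} \<Rightarrow> 'a::{comm_ring, comm_monoid_mult} \<Rightarrow> 'a"
    and sH :: "'a \<Rightarrow> 'h::ab_group_add \<Rightarrow> 'h"
    and sQ :: "'a \<Rightarrow> 'q::ab_group_add \<Rightarrow> 'q"
    and T +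
  assumes total_lie_rinehart:
    "lie_rinehart_algebra sR (scale_prod sH sQ) (total_bracket T) (total_action T)"

definition lie_rinehart_triples ::
  "('r::{comm_ring, comm_monoid_mult} \<Rightarrow> 'a::{comm_ring, comm_monoid_mult} \<Rightarrow> 'a) \<Rightarrow>
   ('a \<Rightarrow> 'h::ab_group_add \<Rightarrow> 'h) \<Rightarrow> ('a \<Rightarrow> 'q::ab_group_add \<Rightarrow> 'q) \<Rightarrow>
   ('a, 'h, 'q) triple set" where
  "lie_rinehart_triples sR sH sQ = {T. lie_rinehart_triple sR sH sQ T}"


section \<open>Alternating forms\<close>

text \<open>
  Arguments of forms are lists. A function on lists of all lengths is the family of its
  components, the component of degree \<open>n\<close> being its restriction to lists of length \<open>n\<close>.
  In \<open>alternating_multilinear s t f\<close>, \<open>s\<close> and \<open>t\<close> are the scalar multiplications of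
  the arguments and of the values.
\<close>

definition alternating_multilinear ::
  "('a \<Rightarrow> 'm::ab_group_add \<Rightarrow> 'm) \<Rightarrow> ('a \<Rightarrow> 'n::ab_group_add \<Rightarrow> 'n) \<Rightarrow> ('m list \<Rightarrow> 'n) \<Rightarrow> bool" where
  "alternating_multilinear s t f \<longleftrightarrow>
     (\<forall>zs i x y. i < length zs \<longrightarrow> f (zs[i := x + y]) = f (zs[i := x]) + f (zs[i := y])) \<and>
     (\<forall>zs i a x. i < length zs \<longrightarrow> f (zs[i := s a x]) = t a (f (zs[i := x]))) \<and>
     (\<forall>zs i j. i < j \<and> j < length zs \<and> zs ! i = zs ! j \<longrightarrow> f zs = 0)"

text \<open>\<open>Alt\<^sub>A(M, A)\<close>, the direct sum of its homogeneous components.\<close>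

definition Alt ::
  "('a::{comm_ring, comm_monoid_mult} \<Rightarrow> 'm::ab_group_add \<Rightarrow> 'm) \<Rightarrow> ('m list \<Rightarrow> 'a) set" where
  "Alt s = {F. alternating_multilinear s (*) F \<and> finite {length zs |zs. F zs \<noteq> 0}}"

text \<open>\<open>Alt\<^sub>A(Q, Alt\<^sub>A(H, A))\<close>, the direct sum of its bihomogeneous components.\<close>

type_synonym ('a, 'h, 'q) form = "'q list \<Rightarrow> 'h list \<Rightarrow> 'a"

definition Alt2 ::
  "('a::{comm_ring, comm_monoid_mult} \<Rightarrow> 'h::ab_group_add \<Rightarrow> 'h) \<Rightarrow>
   ('a \<Rightarrow> 'q::ab_group_add \<Rightarrow> 'q) \<Rightarrow> ('a, 'h, 'q) form set" where
  "Alt2 sH sQ = {f. (\<forall>\<xi>s. f \<xi>s \<in> Alt sH) \<and>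
     alternating_multilinear sQ (\<lambda>a g xs. a * g xs) f \<and>
     finite {(length \<xi>s, length xs) |\<xi>s xs. f \<xi>s xs \<noteq> 0}}"

text \<open>Integer degrees, so that the components of negative degree are zero.\<close>

definition Alt2_comp ::
  "('a::{comm_ring, comm_monoid_mult} \<Rightarrow> 'h::ab_group_add \<Rightarrow> 'h) \<Rightarrow>
   ('a \<Rightarrow> 'q::ab_group_add \<Rightarrow> 'q) \<Rightarrow> int \<Rightarrow> int \<Rightarrow> ('a, 'h, 'q) form set" where
  "Alt2_comp sH sQ p q = {f \<in> Alt2 sH sQ. \<forall>\<xi>s xs. f \<xi>s xs \<noteq> 0 \<longrightarrow>
     int (length \<xi>s) = p \<and> int (length xs) = q}"

text \<open>
  The Eilenberg-Koszul product. A shuffle of \<open>zs\<close> is given by the set \<open>S\<close> of the positions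
  of the arguments of \<open>F\<close>; its sign is determined by the number of pairs whose order
  changes when the positions in \<open>S\<close> are moved to the front. The first sign factor
  is \<open>(-1) ^ (deg F * deg G)\<close> on the summand concerned.
\<close>

definition shuffle_inversions :: "nat \<Rightarrow> nat set \<Rightarrow> nat" where
  "shuffle_inversions n S = card {(i, j). i \<in> {..<n} - S \<and> j \<in> S \<and> i < j}"

definition ek_prod ::
  "('m list \<Rightarrow> 'a::{comm_ring, comm_monoid_mult}) \<Rightarrow> ('m list \<Rightarrow> 'a) \<Rightarrow> 'm list \<Rightarrow> 'a" where
  "ek_prod F G zs = (\<Sum>S\<in>Pow {..<length zs}.
     (-1) ^ (card S * card ({..<length zs} - S)) *
     ((-1) ^ shuffle_inversions (length zs) S * (F (nths zs S) * G (nths zs (- S)))))"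

text \<open>
  \<open>uncombine\<close> is the identification of \<open>Alt\<^sub>A(Q \<oplus> H, A)\<close> with
  \<open>Alt\<^sub>A(Q, Alt\<^sub>A(H, A))\<close>, along which the product is transported.
\<close>

definition uncombine ::
  "(('q::zero \<times> 'h::zero) list \<Rightarrow> 'a) \<Rightarrow> ('a, 'h, 'q) form" where
  "uncombine F = (\<lambda>\<xi>s xs. F (map (\<lambda>\<xi>. (\<xi>, 0)) \<xi>s @ map (\<lambda>x. (0, x)) xs))"

definition combine ::
  "('a::{comm_ring, comm_monoid_mult} \<Rightarrow> 'h::ab_group_add \<Rightarrow> 'h) \<Rightarrow>
   ('a \<Rightarrow> 'q::ab_group_add \<Rightarrow> 'q) \<Rightarrow> ('a, 'h, 'q) form \<Rightarrow> ('q \<times> 'h) list \<Rightarrow> 'a" where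
  "combine sH sQ = the_inv_into (Alt (scale_prod sQ sH)) uncombine"

definition Alt2_mult ::
  "('a::{comm_ring, comm_monoid_mult} \<Rightarrow> 'h::ab_group_add \<Rightarrow> 'h) \<Rightarrow>
   ('a \<Rightarrow> 'q::ab_group_add \<Rightarrow> 'q) \<Rightarrow>
   ('a, 'h, 'q) form \<Rightarrow> ('a, 'h, 'q) form \<Rightarrow> ('a, 'h, 'q) form" where
  "Alt2_mult sH sQ f g = uncombine (ek_prod (combine sH sQ f) (combine sH sQ g))"


section \<open>Maurer-Cartan algebra structures\<close>

text \<open>
  Operators are functions on \<open>Alt2 sH sQ\<close> only, hence the extensional function space.
\<close>

definition Alt2_derivation ::
  "('r \<Rightarrow> 'a::{comm_ring, comm_monoid_mult} \<Rightarrow> 'a) \<Rightarrow>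
   ('a \<Rightarrow> 'h::ab_group_add \<Rightarrow> 'h) \<Rightarrow> ('a \<Rightarrow> 'q::ab_group_add \<Rightarrow> 'q) \<Rightarrow>
   (('a, 'h, 'q) form \<Rightarrow> ('a, 'h, 'q) form) \<Rightarrow> bool" where
  "Alt2_derivation sR sH sQ d \<longleftrightarrow>
     d \<in> Alt2 sH sQ \<rightarrow>\<^sub>E Alt2 sH sQ \<and>
     (\<forall>f\<in>Alt2 sH sQ. \<forall>g\<in>Alt2 sH sQ. d (f + g) = d f + d g) \<and>
     (\<forall>r. \<forall>f\<in>Alt2 sH sQ. d (\<lambda>\<xi>s xs. sR r (f \<xi>s xs)) = (\<lambda>\<xi>s xs. sR r (d f \<xi>s xs))) \<and>
     (\<forall>(p::nat) (q::nat). \<forall>f\<in>Alt2_comp sH sQ (int p) (int q). \<forall>g\<in>Alt2 sH sQ.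
        d (Alt2_mult sH sQ f g) =
          Alt2_mult sH sQ (d f) g + (\<lambda>\<xi>s xs. (-1) ^ (p + q) * Alt2_mult sH sQ f (d g) \<xi>s xs))"

definition has_bidegree ::
  "('a::{comm_ring, comm_monoid_mult} \<Rightarrow> 'h::ab_group_add \<Rightarrow> 'h) \<Rightarrow>
   ('a \<Rightarrow> 'q::ab_group_add \<Rightarrow> 'q) \<Rightarrow> int \<Rightarrow>
   (('a, 'h, 'q) form \<Rightarrow> ('a, 'h, 'q) form) \<Rightarrow> bool" where
  "has_bidegree sH sQ j d \<longleftrightarrow>
     (\<forall>p q. d ` Alt2_comp sH sQ p q \<subseteq> Alt2_comp sH sQ (p + j) (q - j + 1))"

definition maurer_cartan_structures ::
  "('r \<Rightarrow> 'a::{comm_ring, comm_monoid_mult} \<Rightarrow> 'a) \<Rightarrow>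
   ('a \<Rightarrow> 'h::ab_group_add \<Rightarrow> 'h) \<Rightarrow> ('a \<Rightarrow> 'q::ab_group_add \<Rightarrow> 'q) \<Rightarrow>
   ((('a, 'h, 'q) form \<Rightarrow> ('a, 'h, 'q) form) \<times> (('a, 'h, 'q) form \<Rightarrow> ('a, 'h, 'q) form) \<times>
    (('a, 'h, 'q) form \<Rightarrow> ('a, 'h, 'q) form)) set" where
  "maurer_cartan_structures sR sH sQ = {(d0, d1, d2).
     Alt2_derivation sR sH sQ d0 \<and> has_bidegree sH sQ 0 d0 \<and>
     Alt2_derivation sR sH sQ d1 \<and> has_bidegree sH sQ 1 d1 \<and>
     Alt2_derivation sR sH sQ d2 \<and> has_bidegree sH sQ 2 d2 \<and>
     (let D = \<lambda>f. d0 f + d1 f + d2 f in \<forall>f\<in>Alt2 sH sQ. D (D f) = 0)}"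


section \<open>The operators of a triple\<close>

text \<open>
  Indices start at 0, so each of \<open>j\<close> and \<open>k\<close> is one less than in the usual formulas, where
  they start at 1; the parities of the exponents are adjusted accordingly. For a form
  of bidegree \<open>(p, q)\<close>, in each operator \<open>length \<xi>s + length xs = p + q + 1\<close>.
\<close>

definition op0 ::
  "('a::{comm_ring, comm_monoid_mult}, 'h, 'q) triple \<Rightarrow> ('a, 'h, 'q) form \<Rightarrow> ('a, 'h, 'q) form" where
  "op0 T f = (\<lambda>\<xi>s xs. (-1) ^ (length \<xi>s + length xs) *
     ((\<Sum>j<length xs. (-1) ^ (length \<xi>s + j) * actH T (xs ! j) (f \<xi>s (nths xs (- {j})))) +
      (\<Sum>k<length xs. \<Sum>j<k. (-1) ^ (length \<xi>s + j + k) *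
         f \<xi>s (brH T (xs ! j) (xs ! k) # nths xs (- {j, k}))) +
      (\<Sum>j<length \<xi>s. \<Sum>k<length xs. (-1) ^ (j + k + length \<xi>s + 1) *
         f (dotHQ T (xs ! k) (\<xi>s ! j) # nths \<xi>s (- {j})) (nths xs (- {k})))))"

definition op1 ::
  "('a::{comm_ring, comm_monoid_mult}, 'h, 'q) triple \<Rightarrow> ('a, 'h, 'q) form \<Rightarrow> ('a, 'h, 'q) form" where
  "op1 T f = (\<lambda>\<xi>s xs. (-1) ^ (length \<xi>s + length xs) *
     ((\<Sum>j<length \<xi>s. (-1) ^ j * actQ T (\<xi>s ! j) (f (nths \<xi>s (- {j})) xs)) +
      (\<Sum>k<length \<xi>s. \<Sum>j<k. (-1) ^ (j + k) *
         f (brQ T (\<xi>s ! j) (\<xi>s ! k) # nths \<xi>s (- {j, k})) xs) +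
      (\<Sum>j<length \<xi>s. \<Sum>k<length xs. (-1) ^ (j + k + 1) *
         f (nths \<xi>s (- {j})) (dotQH T (\<xi>s ! j) (xs ! k) # nths xs (- {k})))))"

text \<open>Here \<open>length \<xi>s = p + 2\<close>, which has the parity of \<open>p\<close>.\<close>

definition op2 ::
  "('a::{comm_ring, comm_monoid_mult}, 'h, 'q) triple \<Rightarrow> ('a, 'h, 'q) form \<Rightarrow> ('a, 'h, 'q) form" where
  "op2 T f = (\<lambda>\<xi>s xs. (-1) ^ (length \<xi>s + length xs) *
     (\<Sum>k<length \<xi>s. \<Sum>j<k. (-1) ^ (j + k + length \<xi>s) *
        f (nths \<xi>s (- {j, k})) (delta T (\<xi>s ! j) (\<xi>s ! k) # xs)))"

definition triple_operators ::
  "('a::{comm_ring, comm_monoid_mult} \<Rightarrow> 'h::ab_group_add \<Rightarrow> 'h) \<Rightarrow>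
   ('a \<Rightarrow> 'q::ab_group_add \<Rightarrow> 'q) \<Rightarrow> ('a, 'h, 'q) triple \<Rightarrow>
   (('a, 'h, 'q) form \<Rightarrow> ('a, 'h, 'q) form) \<times> (('a, 'h, 'q) form \<Rightarrow> ('a, 'h, 'q) form) \<times>
   (('a, 'h, 'q) form \<Rightarrow> ('a, 'h, 'q) form)" where
  "triple_operators sH sQ T =
     (restrict (op0 T) (Alt2 sH sQ), restrict (op1 T) (Alt2 sH sQ), restrict (op2 T) (Alt2 sH sQ))"

end

theory Submission
  imports Defs
begin

text \<open>
  Put \<open>L = Q \<oplus> H\<close>. A triple is the same as an alternating bracket and an action on \<open>L\<close> that
  satisfy all axioms of a Lie-Rinehart algebra other than the Jacobi identity and the compatibility
  of the action with brackets, and for which \<open>[H, H]\<close> has no component in \<open>Q\<close>; the sum of its three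
  operators is the Chevalley-Eilenberg operator of \<open>L\<close>, up to sign. Cartan's formula, which computes
  the contraction of a differential form, turns each identity for this operator into an induction on
  the list of arguments.

  Conversely, dual bases show that the forms on \<open>L\<close> are generated by those of degree at most 1, so
  that a derivation is determined by its values on these; they also allow one to read off a bracket
  and an action from a derivation of degree 1. The bidegrees of \<open>d\<^sub>0, d\<^sub>1, d\<^sub>2\<close> exclude the \<open>Q\<close>-component
  of \<open>[H, H]\<close>, and the square of the operator vanishes in degrees 0 and 1 precisely if the
  two missing axioms hold.
\<close>


section \<open>Signs\<close>

text \<open>A form is determined by its value on the empty list and by its contractions. An identity
  between forms of all degrees therefore follows by induction on the arguments, with the forms left
  arbitrary, once both sides obey the same rule for contraction. Degrees are never named in these
  inductions: the sign \<open>(-1)^n\<close> is carried by the automorphism \<open>twist\<close>,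
  and the Eilenberg-Koszul sign makes contraction a derivation of the product with all signs on the
  right-hand factor.

  Since 2 may fail to be invertible, alternation means vanishing on repeated arguments and has to be
  proved in this form. The Lie derivative is not \<open>A\<close>-linear in the vector along which
  it is taken; the Leibniz rule of the bracket is what makes the differential of a form
  \<open>A\<close>-multilinear nevertheless.

  The sum of the three operators determines each of them, because on a bihomogeneous form they raise
  the number of arguments from \<open>Q\<close> by 0, 1 and 2. The argument can thus be carried out
  for a single operator on forms over \<open>L\<close>, and the splitting is restored at the
  end.\<close>

definition sg :: "nat \<Rightarrow> 'a::ab_group_add \<Rightarrow> 'a" where
  "sg n x = (if even n then x else - x)"

text \<open>The rules on powers of \<open>- 1\<close> in the library exclude the zero ring.\<close>

lemma neg_one_power_mult [simp]:
  fixes x :: "'a::{comm_ring, comm_monoid_mult}"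
  shows "(-1) ^ n * x = sg n x"
  by (induction n arbitrary: x) (auto simp: sg_def mult.assoc)

lemma sg_simps [simp]:
  fixes x y :: "'a::ab_group_add"
  shows "sg 0 x = x" "sg n (0::'a) = 0" "sg (Suc n) x = - sg n x"
    "sg n (x + y) = sg n x + sg n y" "sg n (x - y) = sg n x - sg n y" "sg n (- x) = - sg n x"
    "sg n (sg n x) = x"
  by (auto simp: sg_def)

lemma sg_sg: "sg m (sg n x) = sg (m + n) x"
  by (auto simp: sg_def)

lemma sg_mult_right:
  fixes x y :: "'a::comm_ring"
  shows "x * sg n y = sg n (x * y)"
  by (auto simp: sg_def)

lemma sg_sum: "sg n (sum f A) = (\<Sum>i\<in>A. sg n (f i))"
  by (auto simp: sg_def sum_negf)

lemma additive_zero: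
  fixes f :: "'b::ab_group_add \<Rightarrow> 'c::ab_group_add"
  assumes "\<And>x y. f (x + y) = f x + f y"
  shows "f 0 = 0"
  using assms[of 0 0] by simp

lemma additive_minus:
  fixes f :: "'b::ab_group_add \<Rightarrow> 'c::ab_group_add"
  assumes "\<And>x y. f (x + y) = f x + f y"
  shows "f (- x) = - f x"
  using assms[of x "-x"] additive_zero[of f, OF assms] by (simp add: eq_neg_iff_add_eq_0 add.commute)

lemma additive_diff:
  fixes f :: "'b::ab_group_add \<Rightarrow> 'c::ab_group_add"
  assumes "\<And>x y. f (x + y) = f x + f y"
  shows "f (x - y) = f x - f y"
  using assms[of x "-y"] additive_minus[of f, OF assms] by simp

lemma additive_sg:
  fixes f :: "'b::ab_group_add \<Rightarrow> 'c::ab_group_add"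
  assumes "\<And>x y. f (x + y) = f x + f y"
  shows "f (sg n x) = sg n (f x)"
  using additive_minus[of f, OF assms] by (simp add: sg_def)

lemma additive_sum:
  fixes f :: "'b::ab_group_add \<Rightarrow> 'c::ab_group_add"
  assumes "\<And>x y. f (x + y) = f x + f y"
  shows "f (sum g A) = (\<Sum>i\<in>A. f (g i))"
  by (induction A rule: infinite_finite_induct) (simp_all add: assms additive_zero[of f, OF assms])


section \<open>Contraction and alternating forms\<close>

text \<open>The interior product with \<open>z\<close>.\<close>

definition contract :: "'m \<Rightarrow> ('m list \<Rightarrow> 'n) \<Rightarrow> 'm list \<Rightarrow> 'n" where
  "contract z F = (\<lambda>zs. F (z # zs))"

text \<open>The sign automorphism of the grading. Values lie in any abelian group because it is also
  applied to forms on \<open>Q\<close> whose values are forms on \<open>H\<close>.\<close>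

definition twist :: "('m list \<Rightarrow> 'n::ab_group_add) \<Rightarrow> 'm list \<Rightarrow> 'n" where
  "twist F = (\<lambda>zs. sg (length zs) (F zs))"

lemma contract_apply: "contract z F zs = F (z # zs)"
  by (simp add: contract_def)

lemma twist_apply: "twist F zs = sg (length zs) (F zs)"
  by (simp add: twist_def)

lemma contract_list_simps [simp]:
  "contract z F [] = F [z]" "contract z F (w # ws) = F (z # w # ws)"
  by (simp_all add: contract_def)

lemma twist_Nil [simp]: "twist F [] = F []"
  by (simp add: twist_def)

lemma contract_simps [simp]:
  fixes F G :: "'m list \<Rightarrow> 'n::ab_group_add"
  shows "contract z (F + G) = contract z F + contract z G"
    "contract z (F - G) = contract z F - contract z G"
    "contract z (- F) = - contract z F"
    "contract z 0 = (0 :: 'm list \<Rightarrow> 'n)"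
    "contract z (twist F) = - twist (contract z F)"
  by (auto simp: fun_eq_iff contract_apply twist_apply)

lemma twist_simps [simp]:
  fixes F G :: "'m list \<Rightarrow> 'n::ab_group_add"
  shows "twist (F + G) = twist F + twist G"
    "twist (F - G) = twist F - twist G"
    "twist (- F) = - twist F"
    "twist 0 = (0 :: 'm list \<Rightarrow> 'n)"
    "twist (twist F) = F"
  by (auto simp: fun_eq_iff twist_apply)

lemma alternating_multilinearD:
  assumes "alternating_multilinear s t F"
  shows alternating_contract: "alternating_multilinear s t (contract z F)"
    and alternating_Cons_add: "F ((x + y) # zs) = F (x # zs) + F (y # zs)"
    and alternating_Cons_scale: "F (s a x # zs) = t a (F (x # zs))"
    and alternating_Cons_Cons: "F (x # x # zs) = 0"
proof -
  note F = assms[unfolded alternating_multilinear_def]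
  have 1: "F (zs[i := x + y]) = F (zs[i := x]) + F (zs[i := y])" if "i < length zs" for zs i x y
    using F that by blast
  have 2: "F (zs[i := s a x]) = t a (F (zs[i := x]))" if "i < length zs" for zs i a x
    using F that by blast
  have 3: "F zs = 0" if "i < j" "j < length zs" "zs ! i = zs ! j" for zs i j
    using F that by blast
  show "alternating_multilinear s t (contract z F)"
    unfolding alternating_multilinear_def contract_apply
  proof (intro conjI allI impI)
    fix zs i x y a j
    show "F (z # zs[i := x + y]) = F (z # zs[i := x]) + F (z # zs[i := y])" if "i < length zs"
      using 1[of "Suc i" "z # zs" x y] that by simp
    show "F (z # zs[i := s a x]) = t a (F (z # zs[i := x]))" if "i < length zs"
      using 2[of "Suc i" "z # zs" a x] that by simp
    show "F (z # zs) = 0" if "i < j \<and> j < length zs \<and> zs ! i = zs ! j"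
      using 3[of "Suc i" "Suc j" "z # zs"] that by simp
  qed
  show "F ((x + y) # zs) = F (x # zs) + F (y # zs)" using 1[of 0 "x # zs"] by simp
  show "F (s a x # zs) = t a (F (x # zs))" using 2[of 0 "x # zs"] by simp
  show "F (x # x # zs) = 0" using 3[of 0 1 "x # x # zs"] by simp
qed

text \<open>In a family closed under contraction it suffices to look at the head of the list: a
  condition at position \<open>i\<close> is a condition at the head of an \<open>i\<close>-fold
  contraction. This is how operators given by a recursion are shown to preserve alternating forms;
  \<open>X\<close> has to contain whatever the contractions produce.\<close>

lemma alternating_multilinear_coinduct:
  fixes s :: "'a \<Rightarrow> 'm::ab_group_add \<Rightarrow> 'm" and t :: "'a \<Rightarrow> 'n::ab_group_add \<Rightarrow> 'n"
  assumes "F \<in> X"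
    and contract: "\<And>F z. F \<in> X \<Longrightarrow> contract z F \<in> X"
    and add: "\<And>F x y zs. F \<in> X \<Longrightarrow> F ((x + y) # zs) = F (x # zs) + F (y # zs)"
    and scale: "\<And>F a x zs. F \<in> X \<Longrightarrow> F (s a x # zs) = t a (F (x # zs))"
    and alt: "\<And>F x zs. F \<in> X \<Longrightarrow> F (x # x # zs) = 0"
  shows "alternating_multilinear s t F"
proof -
  \<comment> \<open>Polarisation: the vanishing value at \<open>x + y\<close>, \<open>x + y\<close>
    is expanded.\<close>
  have swap: "F (y # x # zs) = - F (x # y # zs)" if F: "F \<in> X" for F x y zs
  proof -
    have "F ((x + y) # (x + y) # zs) = F (x # y # zs) + F (y # x # zs)"
      using add[OF F, of x y "(x + y) # zs"] add[OF contract[OF F], of x x y zs]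
        add[OF contract[OF F], of y x y zs] alt[OF F, of x] alt[OF F, of y]
      by (simp add: contract_apply)
    then show ?thesis using alt[OF F, of "x + y" zs] by (simp add: eq_neg_iff_add_eq_0 add.commute)
  qed
  \<comment> \<open>The head is exchanged with its neighbour, which is then contracted away, until
    the two equal entries are adjacent.\<close>
  have rep: "F (x # us @ x # vs) = 0" if "F \<in> X" for F x us vs
    using that
  proof (induction us arbitrary: F)
    case Nil then show ?case using alt by simp
  next
    case (Cons u us)
    then show ?case using swap[OF Cons.prems, of x u] Cons.IH[OF contract[OF Cons.prems, of u]]
      by (simp add: contract_apply)
  qed
  have A: "i < length zs \<longrightarrow> F (zs[i := x + y]) = F (zs[i := x]) + F (zs[i := y])"
    if "F \<in> X" for F zs i x y
    using that
  proof (induction zs arbitrary: F i)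
    case (Cons z zs)
    then show ?case using add[OF Cons.prems] Cons.IH[OF contract[OF Cons.prems, of z]]
      by (auto simp: contract_apply split: nat.split)
  qed simp
  have B: "i < length zs \<longrightarrow> F (zs[i := s a x]) = t a (F (zs[i := x]))"
    if "F \<in> X" for F zs i a x
    using that
  proof (induction zs arbitrary: F i)
    case (Cons z zs)
    then show ?case using scale[OF Cons.prems] Cons.IH[OF contract[OF Cons.prems, of z]]
      by (auto simp: contract_apply split: nat.split)
  qed simp
  have C: "i < j \<and> j < length zs \<and> zs ! i = zs ! j \<longrightarrow> F zs = 0"
    if "F \<in> X" for F zs i j
    using that
  proof (induction zs arbitrary: F i j)
    case (Cons z zs)
    show ?case
    proof (intro impI, elim conjE)
      assume ij: "i < j" "j < length (z # zs)" "(z # zs) ! i = (z # zs) ! j"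
      then obtain j' where j: "j = Suc j'" by (cases j) auto
      show "F (z # zs) = 0"
      proof (cases i)
        case 0
        then have "zs = take j' zs @ z # drop (Suc j') zs" using ij j by (simp add: id_take_nth_drop)
        then show ?thesis using rep[OF Cons.prems, of z "take j' zs" "drop (Suc j') zs"] by simp
      next
        case (Suc i')
        then show ?thesis using Cons.IH[OF contract[OF Cons.prems, of z], of i' j'] ij j by (simp add: contract_apply)
      qed
    qed
  qed simp
  show ?thesis
    unfolding alternating_multilinear_def using A B C assms(1) by blast
qed

lemma alternating_swap:
  assumes "alternating_multilinear s t F"
  shows "F (y # x # zs) = - F (x # y # zs)"
proof -
  have "F ((x + y) # (x + y) # zs) = F (x # y # zs) + F (y # x # zs)"
    using alternating_Cons_add[OF assms, of x y "(x + y) # zs"] alternating_Cons_Cons[OF assms, of x]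
      alternating_Cons_add[OF alternating_contract[OF assms], of x x y zs]
      alternating_Cons_add[OF alternating_contract[OF assms], of y x y zs]
      alternating_Cons_Cons[OF assms, of y]
    by (simp add: contract_apply)
  then show ?thesis
    using alternating_Cons_Cons[OF assms, of "x + y" zs] by (simp add: eq_neg_iff_add_eq_0 add.commute)
qed

lemma alternating_twist:
  assumes "alternating_multilinear s t F" "\<And>a x. t a (- x) = - t a x"
  shows "alternating_multilinear s t (twist F)"
  using assms unfolding alternating_multilinear_def by (auto simp: sg_def twist_apply)

lemma alternating_add:
  assumes "alternating_multilinear s t F" "alternating_multilinear s t G"
    "\<And>a x y. t a (x + y) = t a x + t a y"
  shows "alternating_multilinear s t (F + G)"
  using assms(1,2) unfolding alternating_multilinear_def by (simp add: assms(3) algebra_simps)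

lemma alternating_uminus:
  assumes "alternating_multilinear s t F" "\<And>a x. t a (- x) = - t a x"
  shows "alternating_multilinear s t (- F)"
  using assms unfolding alternating_multilinear_def by simp

lemma alternating_zero:
  fixes t :: "'a \<Rightarrow> 'n::ab_group_add \<Rightarrow> 'n" and s :: "'a \<Rightarrow> 'm::ab_group_add \<Rightarrow> 'm"
  assumes "\<And>a. t a 0 = 0"
  shows "alternating_multilinear s t 0"
  using assms unfolding alternating_multilinear_def by simp

text \<open>With \<open>us\<close> the arguments from \<open>Q\<close>, this is the source of the
  signs that compare the two spaces of forms.\<close>

lemma alternating_move:
  assumes "alternating_multilinear s t F"
  shows "F (us @ x # vs) = sg (length us) (F (x # us @ vs))"
  using assms
proof (induction us arbitrary: F)
  case (Cons u us)
  then show ?case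
    using Cons.IH[OF alternating_contract[OF Cons.prems, of u]] alternating_swap[OF Cons.prems, of u x]
    by (simp add: contract_apply)
qed simp

text \<open>Finiteness of the set of degrees, as a bound. Contraction, pullback and products change
  such a bound in an obvious way, and it is the induction measure in
  \<open>Alt_derivation_unique\<close>.\<close>

definition vanishes_from :: "nat \<Rightarrow> ('m list \<Rightarrow> 'n::zero) \<Rightarrow> bool" where
  "vanishes_from N F \<longleftrightarrow> (\<forall>zs. N \<le> length zs \<longrightarrow> F zs = 0)"

lemma finite_degrees_iff: "finite {length zs |zs. F zs \<noteq> 0} \<longleftrightarrow> (\<exists>N. vanishes_from N F)"
proof
  assume "finite {length zs |zs. F zs \<noteq> 0}"
  then obtain N where "\<forall>n\<in>{length zs |zs. F zs \<noteq> 0}. n < N"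
    using finite_nat_set_iff_bounded by auto
  then have "vanishes_from N F" by (fastforce simp: vanishes_from_def)
  then show "\<exists>N. vanishes_from N F" ..
next
  assume "\<exists>N. vanishes_from N F"
  then obtain N where "vanishes_from N F" ..
  then have "{length zs |zs. F zs \<noteq> 0} \<subseteq> {..<N}" by (fastforce simp: vanishes_from_def not_le[symmetric])
  then show "finite {length zs |zs. F zs \<noteq> 0}" using finite_subset by blast
qed

lemma Alt_iff: "F \<in> Alt s \<longleftrightarrow> alternating_multilinear s (*) F \<and> (\<exists>N. vanishes_from N F)"
  by (simp add: Alt_def finite_degrees_iff)

lemma Alt_add: "F \<in> Alt s \<Longrightarrow> G \<in> Alt s \<Longrightarrow> F + G \<in> Alt s"
  unfolding Alt_iff
proof (elim conjE exE, intro conjI)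
  fix M N assume "vanishes_from M F" "vanishes_from N G"
  then have "vanishes_from (max M N) (F + G)" by (auto simp: vanishes_from_def)
  then show "\<exists>N. vanishes_from N (F + G)" ..
qed (auto simp: distrib_left intro!: alternating_add)

lemma Alt_uminus: "F \<in> Alt s \<Longrightarrow> - F \<in> Alt s"
  by (auto simp: Alt_iff vanishes_from_def intro!: alternating_uminus)

lemma Alt_zero [simp]: "0 \<in> Alt s"
  by (auto simp: Alt_iff vanishes_from_def intro!: alternating_zero)

lemma Alt_sum: "(\<And>i. i \<in> I \<Longrightarrow> F i \<in> Alt s) \<Longrightarrow> sum F I \<in> Alt s"
  by (induction I rule: infinite_finite_induct) (auto intro: Alt_add)

lemma Alt_twist: "F \<in> Alt s \<Longrightarrow> twist F \<in> Alt s"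
proof -
  assume "F \<in> Alt s"
  moreover have "vanishes_from N (twist F)" if "vanishes_from N F" for N
    using that by (auto simp: vanishes_from_def twist_apply)
  ultimately show ?thesis by (auto simp: Alt_iff intro!: alternating_twist)
qed

lemma Alt_contract: "F \<in> Alt s \<Longrightarrow> contract z F \<in> Alt s"
proof -
  assume "F \<in> Alt s"
  moreover have "vanishes_from N (contract z F)" if "vanishes_from N F" for N
    using that by (auto simp: vanishes_from_def contract_apply)
  ultimately show ?thesis by (auto simp: Alt_iff intro: alternating_contract)
qed


section \<open>The Eilenberg-Koszul product\<close>

text \<open>The rule for the contraction of a product, used as a recursion. For the usual wedge
  product the sign \<open>(-1)^|F|\<close> stands at the second term; the factor
  \<open>(-1)^(|F||G|)\<close> removes it there and puts \<open>(-1)^|G|\<close> at the first term,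
  which is the sign in \<open>twist G\<close>.\<close>

primrec koszul :: "('m list \<Rightarrow> 'a::{comm_ring, comm_monoid_mult}) \<Rightarrow> ('m list \<Rightarrow> 'a) \<Rightarrow> 'm list \<Rightarrow> 'a" where
  "koszul F G [] = F [] * G []"
| "koszul F G (z # zs) = koszul (contract z F) (twist G) zs + koszul F (contract z G) zs"

lemma sum_Pow_lessThan_Suc:
  fixes h :: "nat set \<Rightarrow> 'a::comm_monoid_add"
  shows "(\<Sum>S\<in>Pow {..<Suc n}. h S) = (\<Sum>S\<in>Pow {..<n}. h (insert 0 (Suc ` S)) + h (Suc ` S))"
proof -
  have Suc: "S = S'" if "Suc ` S = Suc ` S'" for S S'
    using that by (rule inj_image_eq_iff[OF inj_Suc, THEN iffD1])
  have "S = S'" if "insert 0 (Suc ` S) = insert 0 (Suc ` S')" for S S'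
    using that by (subst (asm) insert_ident) (auto intro: Suc)
  with Suc have inj: "inj_on ((`) Suc) (Pow {..<n})" "inj_on (\<lambda>S. insert 0 (Suc ` S)) (Pow {..<n})"
    by (blast intro: inj_onI)+
  have eq: "Pow {..<Suc n} = (\<lambda>S. insert 0 (Suc ` S)) ` Pow {..<n} \<union> (`) Suc ` Pow {..<n}"
    unfolding lessThan_Suc_eq_insert_0 Pow_insert Un_commute[of "Pow _"]
    by (simp flip: image_Pow_surj[OF refl] add: image_image)
  have "(\<Sum>S\<in>Pow {..<Suc n}. h S) =
      sum h ((\<lambda>S. insert 0 (Suc ` S)) ` Pow {..<n}) + sum h ((`) Suc ` Pow {..<n})"
    unfolding eq by (rule sum.union_disjoint) auto
  then show ?thesis by (simp add: sum.reindex inj sum.distrib)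
qed

text \<open>Position 0 precedes all others: outside the chosen set it forms one inversion with each
  element of that set, inside it forms none.\<close>

lemma shuffle_inversions_Suc:
  assumes "S \<subseteq> {..<n}"
  shows "shuffle_inversions (Suc n) (insert 0 (Suc ` S)) = shuffle_inversions n S"
    and "shuffle_inversions (Suc n) (Suc ` S) = shuffle_inversions n S + card S"
proof -
  let ?P = "{(i, j). i \<in> {..<n} - S \<and> j \<in> S \<and> i < j}"
  have fin: "finite ?P" "finite S"
    using assms by (auto intro: finite_subset[of _ "{..<n} \<times> {..<n}"] finite_subset)
  have inj: "inj_on (map_prod Suc Suc) A" for A by (auto simp: inj_on_def)
  have "{(i, j). i \<in> {..<Suc n} - insert 0 (Suc ` S) \<and> j \<in> insert 0 (Suc ` S) \<and> i < j} = map_prod Suc Suc ` ?P"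
    by (auto simp: image_iff less_Suc_eq_0_disj)
  then show "shuffle_inversions (Suc n) (insert 0 (Suc ` S)) = shuffle_inversions n S"
    unfolding shuffle_inversions_def by (simp add: card_image inj)
  have "{(i, j). i \<in> {..<Suc n} - Suc ` S \<and> j \<in> Suc ` S \<and> i < j} =
      map_prod Suc Suc ` ?P \<union> Pair 0 ` Suc ` S"
    by (auto simp: image_iff less_Suc_eq_0_disj)
  moreover have "card (map_prod Suc Suc ` ?P \<union> Pair 0 ` Suc ` S) = card ?P + card S"
    using fin by (subst card_Un_disjoint) (auto simp: card_image inj inj_on_def)
  ultimately show "shuffle_inversions (Suc n) (Suc ` S) = shuffle_inversions n S + card S"
    unfolding shuffle_inversions_def by simp
qed

text \<open>Induction on the arguments: the sets of positions that contain 0 give the first term of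
  the recursion, the others the second.\<close>

lemma ek_prod_eq_koszul: "ek_prod F G = koszul F G"
proof
  show "ek_prod F G zs = koszul F G zs" for zs
  proof (induction zs arbitrary: F G)
    case Nil
    then show ?case by (simp add: ek_prod_def shuffle_inversions_def)
  next
    case (Cons z zs)
    let ?n = "length zs"
    \<comment> \<open>The first argument goes to \<open>F\<close>. As \<open>card S\<close> grows by
      1, the degree factor changes by the parity of the number of arguments of \<open>G\<close>,
      which is the sign in \<open>twist G\<close>.\<close>
    have "(-1) ^ (card S' * card ({..<Suc ?n} - S')) *
         ((-1) ^ shuffle_inversions (Suc ?n) S' * (F (nths (z # zs) S') * G (nths (z # zs) (- S')))) =
        (-1) ^ (card S * card ({..<?n} - S)) *
         ((-1) ^ shuffle_inversions ?n S * (contract z F (nths zs S) * twist G (nths zs (- S))))"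
      if S: "S \<subseteq> {..<?n}" and S': "S' = insert 0 (Suc ` S)" for S S'
    proof -
      have fin: "finite S" using S finite_subset by blast
      have "{..<Suc ?n} - S' = Suc ` ({..<?n} - S)"
        unfolding S' lessThan_Suc_eq_insert_0 by auto
      then have c: "card ({..<Suc ?n} - S') = card ({..<?n} - S)" by (simp add: card_image)
      have c': "card S' = Suc (card S)" using fin by (simp add: S' card_image)
      have "{..<?n} - S = {i. i < ?n \<and> i \<in> - S}" by auto
      then have l: "length (nths zs (- S)) = card ({..<?n} - S)" by (simp add: length_nths)
      have n: "{j. Suc j \<in> S'} = S" "{j. Suc j \<notin> S'} = - S" "0 \<in> S'" by (auto simp: S')
      show ?thesis
        using shuffle_inversions_Suc(1)[OF S]
        by (simp add: n c c' l nths_Cons S'[symmetric] sg_sg sg_mult_right contract_apply twist_apply)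
          (auto simp: sg_def)
    qed
    \<comment> \<open>The first argument goes to \<open>G\<close>. The degree factor changes by the
      parity of \<open>card S\<close>, and so does the number of inversions; the two changes
      cancel.\<close>
    moreover have "(-1) ^ (card S' * card ({..<Suc ?n} - S')) *
         ((-1) ^ shuffle_inversions (Suc ?n) S' * (F (nths (z # zs) S') * G (nths (z # zs) (- S')))) =
        (-1) ^ (card S * card ({..<?n} - S)) *
         ((-1) ^ shuffle_inversions ?n S * (F (nths zs S) * contract z G (nths zs (- S))))"
      if S: "S \<subseteq> {..<?n}" and S': "S' = Suc ` S" for S S'
    proof -
      have fin: "finite S" using S finite_subset by blast
      have "{..<Suc ?n} - S' = insert 0 (Suc ` ({..<?n} - S))"
        unfolding S' lessThan_Suc_eq_insert_0 by auto
      then have c: "card ({..<Suc ?n} - S') = Suc (card ({..<?n} - S))" by (simp add: card_image)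
      have c': "card S' = card S" using fin by (simp add: S' card_image)
      have n: "{j. Suc j \<in> S'} = S" "{j. Suc j \<notin> S'} = - S" "0 \<notin> S'" by (auto simp: S')
      show ?thesis
        using shuffle_inversions_Suc(2)[OF S]
        by (simp add: n c c' nths_Cons S'[symmetric] sg_sg contract_apply) (auto simp: sg_def)
    qed
    ultimately show ?case
      unfolding koszul.simps Cons[symmetric]
      unfolding ek_prod_def list.size sum.distrib[symmetric] add_Suc_right add_0_right sum_Pow_lessThan_Suc
      by (intro sum.cong refl arg_cong2[where f = "(+)"]) blast+
  qed
qed

lemma contract_koszul: "contract z (koszul F G) = koszul (contract z F) (twist G) + koszul F (contract z G)"
  by (simp add: fun_eq_iff contract_apply)

lemma koszul_add_left: "koszul (F + F') G = koszul F G + koszul F' G"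
proof
  show "koszul (F + F') G zs = (koszul F G + koszul F' G) zs" for zs
    by (induction zs arbitrary: F F' G) (simp_all add: algebra_simps)
qed

lemma koszul_add_right: "koszul F (G + G') = koszul F G + koszul F G'"
proof
  show "koszul F (G + G') zs = (koszul F G + koszul F G') zs" for zs
    by (induction zs arbitrary: F G G') (simp_all add: algebra_simps)
qed

lemmas koszul_additive_simps [simp] =
  koszul_add_left koszul_add_right
  additive_zero[of "\<lambda>F. koszul F _", OF koszul_add_left]
  additive_zero[of "koszul _", OF koszul_add_right]
  additive_minus[of "\<lambda>F. koszul F _", OF koszul_add_left]
  additive_minus[of "koszul _", OF koszul_add_right]
  additive_diff[of "\<lambda>F. koszul F _", OF koszul_add_left]
  additive_diff[of "koszul _", OF koszul_add_right]

lemma twist_koszul: "twist (koszul F G) = koszul (twist F) (twist G)"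
proof
  show "twist (koszul F G) zs = koszul (twist F) (twist G) zs" for zs
  proof (induction zs arbitrary: F G)
    case (Cons z zs)
    have "twist (koszul F G) (z # zs) =
        - (twist (koszul (contract z F) (twist G)) zs + twist (koszul F (contract z G)) zs)"
      by (simp add: twist_apply)
    also have "\<dots> = koszul (twist F) (twist G) (z # zs)" unfolding Cons by simp
    finally show ?case .
  qed simp
qed

definition constant_form :: "'a::zero \<Rightarrow> 'm list \<Rightarrow> 'a" where
  "constant_form a = (\<lambda>zs. if zs = [] then a else 0)"

lemma constant_form_simps [simp]:
  "constant_form a [] = a" "constant_form a (z # zs) = 0"
  by (auto simp: constant_form_def)

lemma contract_constant_form [simp]: "contract z (constant_form a) = 0"
  by (simp add: fun_eq_iff contract_apply)

lemma twist_constant_form [simp]: "twist (constant_form a) = constant_form a"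
  by (auto simp: fun_eq_iff constant_form_def twist_apply)

text \<open>Scaling is multiplication by a form of degree 0, so that the product rules below contain
  Leibniz rules for scalars.\<close>

lemma koszul_constant_form [simp]: "koszul (constant_form a) G zs = a * G zs"
  by (induction zs arbitrary: G) (simp_all add: contract_apply)

lemma koszul_eq_zero:
  assumes "\<And>us vs. length us + length vs = length zs \<Longrightarrow> F us = 0 \<or> G vs = 0"
  shows "koszul F G zs = 0"
  using assms
proof (induction zs arbitrary: F G)
  case Nil
  then show ?case using Nil[of "[]" "[]"] by auto
next
  case (Cons z zs)
  have "contract z F us = 0 \<or> twist G vs = 0" if "length us + length vs = length zs" for us vs
    using Cons.prems[of "z # us" vs] that by (auto simp: contract_apply twist_apply)
  moreover have "F us = 0 \<or> contract z G vs = 0" if "length us + length vs = length zs" for us vs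
    using Cons.prems[of us "z # vs"] that by (auto simp: contract_apply)
  ultimately show ?case using Cons.IH by fastforce
qed

text \<open>Contractions of products are sums of products, hence the closure under sums.\<close>

inductive_set koszul_span :: "('a::{comm_ring, comm_monoid_mult} \<Rightarrow> 'm::ab_group_add \<Rightarrow> 'm) \<Rightarrow> ('m list \<Rightarrow> 'a) set"
  for s where
  product: "alternating_multilinear s (*) F \<Longrightarrow> alternating_multilinear s (*) G \<Longrightarrow> koszul F G \<in> koszul_span s"
| sum: "F \<in> koszul_span s \<Longrightarrow> G \<in> koszul_span s \<Longrightarrow> F + G \<in> koszul_span s"

lemma koszul_scale:
  fixes F G :: "'m list \<Rightarrow> 'a::{comm_ring, comm_monoid_mult}"
  shows "koszul (\<lambda>zs. a * F zs) G zs = a * koszul F G zs" "koszul F (\<lambda>zs. a * G zs) zs = a * koszul F G zs"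
proof -
  have c: "contract z (\<lambda>zs. a * F zs) = (\<lambda>zs. a * contract z F zs)"
    "twist (\<lambda>zs. a * F zs) = (\<lambda>zs. a * twist F zs)" for z and F :: "'m list \<Rightarrow> 'a"
    by (simp_all add: fun_eq_iff sg_mult_right contract_apply twist_apply)
  show "koszul (\<lambda>zs. a * F zs) G zs = a * koszul F G zs"
    by (induction zs arbitrary: F G) (simp_all only: koszul.simps c mult.assoc mult.left_commute distrib_left)
  show "koszul F (\<lambda>zs. a * G zs) zs = a * koszul F G zs"
    by (induction zs arbitrary: F G) (simp_all only: koszul.simps c mult.assoc mult.left_commute distrib_left)
qed

lemma contract_add_scale:
  fixes t :: "'a \<Rightarrow> 'n::ab_group_add \<Rightarrow> 'n"
  assumes "alternating_multilinear s t F"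
  shows "contract (x + y) F = contract x F + contract y F"
    and "contract (s a x) F = (\<lambda>zs. t a (contract x F zs))"
    and "contract x (contract x F) = 0"
    and "contract y (contract x F) = - contract x (contract y F)"
  using alternating_Cons_add[OF assms, of x y] alternating_Cons_scale[OF assms, of a x]
    alternating_Cons_Cons[OF assms, of x] alternating_swap[OF assms, of y x]
  by (simp_all add: fun_eq_iff contract_apply)

lemma alternating_koszul:
  assumes "alternating_multilinear s (*) F" "alternating_multilinear s (*) G"
  shows "alternating_multilinear s (*) (koszul F G)"
proof (rule alternating_multilinear_coinduct[where X = "koszul_span s"])
  show "koszul F G \<in> koszul_span s" using assms by (rule koszul_span.product)
next
  fix F z assume "F \<in> koszul_span s"
  then show "contract z F \<in> koszul_span s"
  proof induction
    case (product F G)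
    then show ?case unfolding contract_koszul
      by (intro koszul_span.intros) (auto intro: alternating_contract alternating_twist)
  next
    case (sum F G)
    show ?case unfolding contract_simps by (rule koszul_span.sum[OF sum.IH])
  qed
next
  fix F x y zs assume "F \<in> koszul_span s"
  then show "F ((x + y) # zs) = F (x # zs) + F (y # zs)"
  proof induction
    case (product F G)
    then show ?case by (simp add: contract_add_scale(1)[OF product(1)] contract_add_scale(1)[OF product(2)])
  qed (simp add: algebra_simps)
next
  fix F a x zs assume "F \<in> koszul_span s"
  then show "F (s a x # zs) = a * F (x # zs)"
  proof induction
    case (product F G)
    then show ?case by (simp add: contract_add_scale(2)[OF product(1)] contract_add_scale(2)[OF product(2)] koszul_scale algebra_simps)
  qed (simp add: algebra_simps)
next
  fix F x zs assume "F \<in> koszul_span s"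
  then show "F (x # x # zs) = 0"
  proof induction
    \<comment> \<open>Contracting twice leaves the two mixed terms in \<open>contract x F\<close>
      and \<open>contract x G\<close>. They cancel because \<open>contract x\<close> anticommutes
      with \<open>twist\<close>.\<close>
    case (product F G)
    then show ?case by (simp add: contract_add_scale(3)[OF product(1)] contract_add_scale(3)[OF product(2)])
  qed simp
qed

lemma Alt_koszul:
  fixes F G :: "'m::ab_group_add list \<Rightarrow> 'a::{comm_ring, comm_monoid_mult}"
  assumes "F \<in> Alt s" "G \<in> Alt s"
  shows "koszul F G \<in> Alt s"
proof -
  obtain M N where MN: "vanishes_from M F" "vanishes_from N G" using assms by (auto simp: Alt_iff)
  have "vanishes_from (M + N) (koszul F G)"
    unfolding vanishes_from_def
  proof (intro allI impI koszul_eq_zero)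
    fix zs us vs :: "'m list"
    assume "M + N \<le> length zs" "length us + length vs = length zs"
    then have "M \<le> length us \<or> N \<le> length vs" by linarith
    then show "F us = 0 \<or> G vs = 0" using MN by (auto simp: vanishes_from_def)
  qed
  then show ?thesis using assms by (auto simp: Alt_iff intro: alternating_koszul)
qed


section \<open>The Chevalley-Eilenberg operator\<close>

text \<open>The recursion is the commutation rule with contraction: contraction by \<open>w\<close>
  after the Lie derivative is the Lie derivative of the contraction minus contraction by
  \<open>br z w\<close>.\<close>

primrec lie_derivative ::
  "('l \<Rightarrow> 'l \<Rightarrow> 'l) \<Rightarrow> ('l \<Rightarrow> 'a::ab_group_add \<Rightarrow> 'a) \<Rightarrow> 'l \<Rightarrow> ('l list \<Rightarrow> 'a) \<Rightarrow> 'l list \<Rightarrow> 'a" where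
  "lie_derivative br act z F [] = act z (F [])"
| "lie_derivative br act z F (w # ws) = lie_derivative br act z (contract w F) ws - F (br z w # ws)"

text \<open>
  Cartan's formula for the contraction of the differential, used as a recursion. The sign
  is that of the differential multiplied by \<open>(-1) ^ n\<close> on the forms with \<open>n\<close> arguments.
\<close>

primrec ce_differential ::
  "('l \<Rightarrow> 'l \<Rightarrow> 'l) \<Rightarrow> ('l \<Rightarrow> 'a::ab_group_add \<Rightarrow> 'a) \<Rightarrow> ('l list \<Rightarrow> 'a) \<Rightarrow> 'l list \<Rightarrow> 'a" where
  "ce_differential br act F [] = 0"
| "ce_differential br act F (z # zs) =
     ce_differential br act (contract z F) zs - sg (length zs) (lie_derivative br act z F zs)"

definition linear_form :: "('m \<Rightarrow> 'a::zero) \<Rightarrow> 'm list \<Rightarrow> 'a" where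
  "linear_form \<phi> = (\<lambda>zs. case zs of [z] \<Rightarrow> \<phi> z | _ \<Rightarrow> 0)"

lemma linear_form_simps [simp]:
  "linear_form \<phi> [] = 0" "linear_form \<phi> [z] = \<phi> z" "linear_form \<phi> (z # w # zs) = 0"
  by (simp_all add: linear_form_def)

lemma contract_linear_form [simp]: "contract z (linear_form \<phi>) = constant_form (\<phi> z)"
  by (auto simp: fun_eq_iff linear_form_def constant_form_def contract_apply split: list.split)

definition module_hom_to_ring :: "('a \<Rightarrow> 'm::ab_group_add \<Rightarrow> 'm) \<Rightarrow> ('m \<Rightarrow> 'a::comm_ring) \<Rightarrow> bool" where
  "module_hom_to_ring s \<phi> \<longleftrightarrow> (\<forall>x y. \<phi> (x + y) = \<phi> x + \<phi> y) \<and> (\<forall>a x. \<phi> (s a x) = a * \<phi> x)"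

lemma alternating_constant_form: "alternating_multilinear s (*) (constant_form (a::'a::comm_ring))"
  by (auto simp: alternating_multilinear_def constant_form_def)

lemma Alt_constant_form [simp]: "constant_form a \<in> Alt s"
proof -
  have "vanishes_from 1 (constant_form a)" by (auto simp: vanishes_from_def constant_form_def)
  then show ?thesis using alternating_constant_form by (auto simp: Alt_iff)
qed

lemma alternating_linear_form:
  assumes "module_hom_to_ring s \<phi>"
  shows "alternating_multilinear s (*) (linear_form \<phi>)"
proof (rule alternating_multilinear_coinduct[where X = "{linear_form \<phi>} \<union> range constant_form \<union> {0}"])
  note h = assms[unfolded module_hom_to_ring_def, rule_format]
  fix F z x y zs a
  assume "F \<in> {linear_form \<phi>} \<union> range constant_form \<union> {0}"
  then show "contract z F \<in> {linear_form \<phi>} \<union> range constant_form \<union> {0}"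
    "F ((x + y) # zs) = F (x # zs) + F (y # zs)" "F (s a x # zs) = a * F (x # zs)" "F (x # x # zs) = 0"
    using h by (cases zs; auto)+
qed simp

lemma Alt_linear_form:
  assumes "module_hom_to_ring s \<phi>"
  shows "linear_form \<phi> \<in> Alt s"
proof -
  have "vanishes_from 2 (linear_form \<phi>)" by (auto simp: vanishes_from_def linear_form_def split: list.split)
  then show ?thesis using alternating_linear_form[OF assms] by (auto simp: Alt_iff)
qed

lemma (in module_over) scale_minus_right [simp]: "scale a (- x) = - scale a x"
  by (rule additive_minus) (rule scale_right_distrib)

lemma (in algebra_over) sR_additive:
  "sR r (a + b) = sR r a + sR r b" "sR r 0 = 0" "sR r (- a) = - sR r a" "sR r (a - b) = sR r a - sR r b"
  "sR r (sg n a) = sg n (sR r a)"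
  using scale_right_distrib additive_zero[of "sR r"] additive_minus[of "sR r"] additive_diff[of "sR r"]
    additive_sg[of "sR r"]
  by auto

lemma (in algebra_over) Alt_scaleR:
  assumes "F \<in> Alt s"
  shows "(\<lambda>zs. sR r (F zs)) \<in> Alt s"
proof -
  have "(\<lambda>zs. sR r (F zs)) = koszul (constant_form (sR r 1)) F"
    by (rule ext) (simp flip: scale_mult)
  then show ?thesis using Alt_koszul[OF Alt_constant_form assms] by (simp only:)
qed

text \<open>Under these axioms \<open>ced\<close> is a derivation that preserves alternating forms;
  its square is treated below under two more hypotheses. The compatibility of \<open>br\<close> with
  scalars from \<open>R\<close> is derived in \<open>br_scaleR\<close>.\<close>

locale almost_lie_rinehart = algebra_over sR + module_over s
  for sR :: "'r::{comm_ring, comm_monoid_mult} \<Rightarrow> 'a::{comm_ring, comm_monoid_mult} \<Rightarrow> 'a"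
    and s :: "'a \<Rightarrow> 'l::ab_group_add \<Rightarrow> 'l" +
  fixes br :: "'l \<Rightarrow> 'l \<Rightarrow> 'l"
    and act :: "'l \<Rightarrow> 'a \<Rightarrow> 'a"
  assumes br_add_left: "br (x + y) z = br x z + br y z"
    and br_add_right: "br x (y + z) = br x y + br x z"
    and br_self: "br x x = 0"
    and act_add_left: "act (x + y) a = act x a + act y a"
    and act_derivation: "is_derivation sR (act x)"
    and act_scale: "act (s a x) b = a * act x b"
    and br_scale: "br x (s a y) = s (act x a) y + s a (br x y)"
begin

abbreviation "lie \<equiv> lie_derivative br act"
abbreviation "ced \<equiv> ce_differential br act"

lemma act_add: "act x (a + b) = act x a + act x b"
  and act_scaleR: "act x (sR r a) = sR r (act x a)"
  and act_mult: "act x (a * b) = act x a * b + a * act x b"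
  using act_derivation[of x] by (auto simp: is_derivation_def)

lemmas act_simps [simp] = act_add additive_zero[of "act _", OF act_add]
  additive_minus[of "act _", OF act_add] additive_diff[of "act _", OF act_add]
  additive_sg[of "act _", OF act_add]

lemma br_swap: "br y x = - br x y"
  using br_self[of "x + y"] br_self[of x] br_self[of y]
  by (simp add: br_add_left br_add_right eq_neg_iff_add_eq_0 add.commute)

lemma contract_lie: "contract w (lie z F) = lie z (contract w F) - contract (br z w) F"
  by (simp add: fun_eq_iff contract_apply)

lemma contract_ced: "contract z (ced F) = ced (contract z F) - twist (lie z F)"
  by (simp add: fun_eq_iff contract_apply twist_apply)

lemma lie_add: "lie z (F + G) = lie z F + lie z G"
proof
  show "lie z (F + G) zs = (lie z F + lie z G) zs" for zs
    by (induction zs arbitrary: F G) (simp_all add: algebra_simps)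
qed

lemmas lie_simps [simp] = lie_add additive_zero[of "lie _", OF lie_add]
  additive_minus[of "lie _", OF lie_add] additive_diff[of "lie _", OF lie_add]

lemma lie_twist [simp]: "lie z (twist F) = twist (lie z F)"
proof
  show "lie z (twist F) zs = twist (lie z F) zs" for zs
  proof (induction zs arbitrary: F)
    case (Cons w ws)
    have "lie z (twist F) (w # ws) = - lie z (twist (contract w F)) ws - twist F (br z w # ws)" by simp
    also have "\<dots> = twist (lie z F) (w # ws)" unfolding Cons by (simp add: twist_apply)
    finally show ?case .
  qed simp
qed

text \<open>Contraction by \<open>br z w\<close> obeys the product rule for contractions, so the
  recursion for \<open>lie\<close> hands the present rule down to shorter lists. No sign occurs
  because \<open>lie\<close> commutes with \<open>twist\<close>.\<close>

lemma lie_koszul: "lie z (koszul F G) = koszul (lie z F) G + koszul F (lie z G)"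
proof
  show "lie z (koszul F G) zs = (koszul (lie z F) G + koszul F (lie z G)) zs" for zs
  proof (induction zs arbitrary: F G)
    case Nil
    then show ?case by (simp add: act_mult)
  next
    case (Cons w ws)
    show ?case by (simp add: contract_koszul contract_lie Cons)
  qed
qed

lemma ced_add: "ced (F + G) = ced F + ced G"
proof
  show "ced (F + G) zs = (ced F + ced G) zs" for zs
    by (induction zs arbitrary: F G) (simp_all add: algebra_simps)
qed

lemmas ced_simps [simp] = ced_add additive_zero[of "ced", OF ced_add]
  additive_minus[of "ced", OF ced_add] additive_diff[of "ced", OF ced_add]

lemma ced_twist [simp]: "ced (twist F) = - twist (ced F)"
proof
  show "ced (twist F) zs = (- twist (ced F)) zs" for zs
  proof (induction zs arbitrary: F)
    case (Cons z zs)
    have "ced (twist F) (z # zs) = - ced (twist (contract z F)) zs - sg (length zs) (twist (lie z F) zs)"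
      by simp
    also have "\<dots> = (- twist (ced F)) (z # zs)" unfolding Cons by (simp add: twist_apply)
    finally show ?case .
  qed simp
qed

text \<open>Contraction by \<open>z\<close> reduces the rule to the same rule for the two products
  in \<open>contract_koszul\<close> and to \<open>lie_koszul\<close>. The degree sign is in
  \<open>twist F\<close>, which covers inhomogeneous \<open>F\<close>.\<close>

lemma ced_koszul: "ced (koszul F G) = koszul (ced F) G + koszul (twist F) (ced G)"
proof
  show "ced (koszul F G) zs = (koszul (ced F) G + koszul (twist F) (ced G)) zs" for zs
  proof (induction zs arbitrary: F G)
    case (Cons z zs)
    have "ced (koszul F G) (z # zs) = ced (koszul (contract z F) (twist G)) zs +
        ced (koszul F (contract z G)) zs - twist (lie z (koszul F G)) zs"
      by (simp add: contract_koszul twist_apply)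
    then show ?case
      unfolding Cons by (simp add: contract_ced lie_koszul twist_koszul)
  qed simp
qed

lemma lie_constant_form: "lie z (constant_form a) = constant_form (act z a)"
proof
  show "lie z (constant_form a) zs = constant_form (act z a) zs" for zs by (cases zs) auto
qed

lemma ced_constant_form: "ced (constant_form a) = linear_form (\<lambda>z. - act z a)"
proof
  show "ced (constant_form a) zs = linear_form (\<lambda>z. - act z a) zs" for zs
    by (cases zs; cases "tl zs") (auto simp: lie_constant_form)
qed

lemma lie_eq_zero: "(\<And>us. length us = length zs \<Longrightarrow> F us = 0) \<Longrightarrow> lie z F zs = 0"
proof (induction zs arbitrary: F)
  case (Cons w ws)
  then show ?case by (simp add: contract_apply)
qed simp

lemma ced_eq_zero: "(\<And>us. Suc (length us) = length zs \<Longrightarrow> F us = 0) \<Longrightarrow> ced F zs = 0"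
proof (induction zs arbitrary: F)
  case (Cons z zs)
  then have "lie z F zs = 0" by (intro lie_eq_zero) auto
  with Cons show ?case by (simp add: contract_apply)
qed simp

section \<open>Behaviour in the vector argument, and preservation of alternating forms\<close>

lemma lie_add_left:
  assumes "alternating_multilinear s (*) F"
  shows "lie (x + y) F zs = lie x F zs + lie y F zs"
  using assms
proof (induction zs arbitrary: F)
  case (Cons w ws)
  then show ?case
    using Cons.IH[OF alternating_contract[OF Cons.prems]] alternating_Cons_add[OF Cons.prems]
    by (simp add: br_add_left)
qed (simp add: act_add_left)

lemma br_scale_left: "br (s a x) y = s a (br x y) - s (act y a) x"
  using br_swap[of y "s a x"] unfolding br_scale br_swap[of y x] by (simp add: algebra_simps)

text \<open>The classical formula with correction term \<open>da\<close> times the contraction by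
  \<open>z\<close>, up to the signs built into \<open>ced\<close> and \<open>twist\<close>. The
  correction cancels in \<open>alternating_ced\<close>.\<close>

lemma lie_scale_left:
  assumes "alternating_multilinear s (*) F"
  shows "lie (s a z) F zs = a * lie z F zs + twist (koszul (ced (constant_form a)) (contract z F)) zs"
  using assms
proof (induction zs arbitrary: F)
  case (Cons w ws)
  note alt = contract_add_scale[OF Cons.prems]
  have br: "F (br (s a z) w # ws) = a * F (br z w # ws) - act w a * F (z # ws)"
    using alternating_Cons_add[OF Cons.prems, of "br (s a z) w" "s (act w a) z" ws]
      alternating_Cons_scale[OF Cons.prems]
    by (simp add: br_scale_left)
  have "lie (s a z) F (w # ws) = a * lie z (contract w F) ws
      + twist (koszul (ced (constant_form a)) (contract z (contract w F))) ws
      - (a * F (br z w # ws) - act w a * F (z # ws))"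
    using Cons.IH[OF alternating_contract[OF Cons.prems]] by (simp add: br)
  also have "contract z (contract w F) = - contract w (contract z F)" by (rule alt)
  also have "a * lie z (contract w F) ws
      + twist (koszul (ced (constant_form a)) (- contract w (contract z F))) ws
      - (a * F (br z w # ws) - act w a * F (z # ws)) =
      a * lie z F (w # ws) + twist (koszul (ced (constant_form a)) (contract z F)) (w # ws)"
    by (simp add: twist_apply ced_constant_form contract_apply algebra_simps sg_mult_right)
  finally show ?case .
qed (simp add: act_scale)

text \<open>A contraction of \<open>lie z F\<close> is again a Lie derivative up to the alternating
  form \<open>contract (br z w) F\<close>, hence a family \<open>X\<close> with an alternating
  summand \<open>G\<close>. The same device serves for \<open>ced\<close>.\<close>

lemma alternating_lie:
  assumes "alternating_multilinear s (*) F"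
  shows "alternating_multilinear s (*) (lie z F)"
proof (rule alternating_multilinear_coinduct
    [where X = "{lie z F + G |F G. alternating_multilinear s (*) F \<and> alternating_multilinear s (*) G}"])
  have "lie z F = lie z F + 0" by simp
  then show "lie z F \<in> {lie z F + G |F G. alternating_multilinear s (*) F \<and> alternating_multilinear s (*) G}"
    using assms alternating_zero[of "(*)" s] by fastforce
next
  fix K w
  assume "K \<in> {lie z F + G |F G. alternating_multilinear s (*) F \<and> alternating_multilinear s (*) G}"
  then obtain F G where K: "K = lie z F + G" "alternating_multilinear s (*) F" "alternating_multilinear s (*) G"
    by blast
  have "contract w K = lie z (contract w F) + (contract w G + - contract (br z w) F)"
    by (simp add: K(1) contract_lie)
  moreover have "alternating_multilinear s (*) (contract w G + - contract (br z w) F)"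
    by (intro alternating_add alternating_uminus alternating_contract K) (auto simp: distrib_left)
  ultimately show "contract w K \<in> {lie z F + G |F G. alternating_multilinear s (*) F \<and> alternating_multilinear s (*) G}"
    using alternating_contract[OF K(2)] by blast
next
  fix K x y zs a
  assume "K \<in> {lie z F + G |F G. alternating_multilinear s (*) F \<and> alternating_multilinear s (*) G}"
  then obtain F G where K: "K = lie z F + G" "alternating_multilinear s (*) F" "alternating_multilinear s (*) G"
    by blast
  note F = contract_add_scale(1-3)[OF K(2)] alternating_Cons_add[OF K(2)] alternating_Cons_scale[OF K(2)]
    and G = alternating_Cons_add[OF K(3)] alternating_Cons_scale[OF K(3)] alternating_Cons_Cons[OF K(3)]
  show "K ((x + y) # zs) = K (x # zs) + K (y # zs)"
    by (simp add: K(1) F G br_add_right algebra_simps)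
  \<comment> \<open>Scaling is written as a product, so that \<open>lie_koszul\<close> gives a term
    with \<open>act z a\<close>. The Leibniz rule of the bracket produces the same term with the
    opposite sign.\<close>
  have "(\<lambda>zs. a * contract x F zs) = koszul (constant_form a) (contract x F)"
    by (simp add: fun_eq_iff)
  then have "lie z (\<lambda>zs. a * contract x F zs) zs = act z a * F (x # zs) + a * lie z (contract x F) zs"
    by (simp add: lie_koszul lie_constant_form contract_apply)
  then show "K (s a x # zs) = a * K (x # zs)"
    by (simp add: K(1) F G br_scale contract_apply algebra_simps)
  have "K (x # x # zs) = contract x (contract x (lie z F)) zs"
    by (simp add: K(1) G contract_apply)
  also have "\<dots> = - (F (br z x # x # zs) + F (x # br z x # zs))"
    unfolding contract_lie contract_simps by (simp add: contract_lie F contract_apply)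
  also have "\<dots> = 0" using alternating_swap[OF K(2), of x "br z x"] by simp
  finally show "K (x # x # zs) = 0" .
qed

lemma alternating_ced:
  assumes "alternating_multilinear s (*) F"
  shows "alternating_multilinear s (*) (ced F)"
proof (rule alternating_multilinear_coinduct
    [where X = "{ced F + G |F G. alternating_multilinear s (*) F \<and> alternating_multilinear s (*) G}"])
  have "ced F = ced F + 0" by simp
  then show "ced F \<in> {ced F + G |F G. alternating_multilinear s (*) F \<and> alternating_multilinear s (*) G}"
    using assms alternating_zero[of "(*)" s] by fastforce
next
  fix K w
  assume "K \<in> {ced F + G |F G. alternating_multilinear s (*) F \<and> alternating_multilinear s (*) G}"
  then obtain F G where K: "K = ced F + G" "alternating_multilinear s (*) F" "alternating_multilinear s (*) G"
    by blast
  have "contract w K = ced (contract w F) + (contract w G + - twist (lie w F))"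
    by (simp add: K(1) contract_ced)
  moreover have "alternating_multilinear s (*) (contract w G + - twist (lie w F))"
    by (intro alternating_add alternating_uminus alternating_twist alternating_contract alternating_lie K)
      (auto simp: distrib_left)
  ultimately show "contract w K \<in> {ced F + G |F G. alternating_multilinear s (*) F \<and> alternating_multilinear s (*) G}"
    using alternating_contract[OF K(2)] by blast
next
  fix K x y zs a
  assume "K \<in> {ced F + G |F G. alternating_multilinear s (*) F \<and> alternating_multilinear s (*) G}"
  then obtain F G where K: "K = ced F + G" "alternating_multilinear s (*) F" "alternating_multilinear s (*) G"
    by blast
  note F = contract_add_scale(1-3)[OF K(2)]
    and G = alternating_Cons_add[OF K(3)] alternating_Cons_scale[OF K(3)] alternating_Cons_Cons[OF K(3)]
  show "K ((x + y) # zs) = K (x # zs) + K (y # zs)"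
    by (simp add: K(1) F G lie_add_left[OF K(2)] algebra_simps)
  \<comment> \<open>The derivative of the scalar that \<open>ced_koszul\<close> produces cancels the
    correction term of \<open>lie_scale_left\<close>.\<close>
  have "(\<lambda>zs. a * contract x F zs) = koszul (constant_form a) (contract x F)"
    by (simp add: fun_eq_iff)
  then have "ced (\<lambda>zs. a * contract x F zs) zs =
      koszul (ced (constant_form a)) (contract x F) zs + a * ced (contract x F) zs"
    by (simp add: ced_koszul)
  then show "K (s a x # zs) = a * K (x # zs)"
    by (simp add: K(1) F G lie_scale_left[OF K(2)] twist_apply sg_mult_right algebra_simps)
  \<comment> \<open>The two contractions produce Lie derivatives of \<open>contract x F\<close> with
    opposite signs; what remains is a contraction by \<open>br x x\<close>.\<close>
  have "K (x # x # zs) = contract x (contract x (ced F)) zs"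
    by (simp add: K(1) G contract_apply)
  also have "\<dots> = 0"
    unfolding contract_ced contract_simps by (simp add: contract_ced contract_lie F br_self twist_apply)
      (simp add: contract_apply additive_zero[of "\<lambda>x. F (x # _)", OF alternating_Cons_add[OF K(2)]])
  finally show "K (x # x # zs) = 0" .
qed

lemma Alt_ced: "F \<in> Alt s \<Longrightarrow> ced F \<in> Alt s"
proof -
  assume F: "F \<in> Alt s"
  then obtain N where "vanishes_from N F" by (auto simp: Alt_iff)
  then have "vanishes_from (Suc N) (ced F)"
    by (auto simp: vanishes_from_def intro!: ced_eq_zero)
  with F show ?thesis by (auto simp: Alt_iff intro: alternating_ced)
qed

lemma lie_scaleR: "lie z (\<lambda>zs. sR r (F zs)) zs = sR r (lie z F zs)"
proof -
  have c: "contract z (\<lambda>zs. sR r (F zs)) = (\<lambda>zs. sR r (contract z F zs))" for z and F :: "'l list \<Rightarrow> 'a"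
    by (simp add: fun_eq_iff contract_apply)
  show ?thesis by (induction zs arbitrary: F) (simp_all add: act_scaleR c sR_additive)
qed

lemma ced_scaleR: "ced (\<lambda>zs. sR r (F zs)) zs = sR r (ced F zs)"
proof -
  have c: "contract z (\<lambda>zs. sR r (F zs)) = (\<lambda>zs. sR r (contract z F zs))" for z and F :: "'l list \<Rightarrow> 'a"
    by (simp add: fun_eq_iff contract_apply)
  show ?thesis by (induction zs arbitrary: F) (simp_all add: lie_scaleR c sR_additive)
qed

section \<open>The square of the operator under the Jacobi identity and the compatibility of the
  action\<close>

context
  assumes jacobi: "br x (br y z) + br y (br z x) + br z (br x y) = 0"
    and act_br: "act (br x y) a = act x (act y a) - act y (act x a)"
begin

lemma br_br: "br (br z w) u = br z (br w u) - br w (br z u)"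
proof -
  have "br u (br z w) + br z (br w u) + br w (br u z) = 0" by (rule jacobi)
  moreover have "br w (br u z) = - br w (br z u)"
    unfolding br_swap[of u z] by (rule additive_minus) (rule br_add_right)
  moreover have "br u (br z w) = - br (br z w) u" by (rule br_swap)
  ultimately show ?thesis by (simp add: algebra_simps)
qed

text \<open>The compatibility of the action starts the induction, and the Jacobi identity, in the
  form \<open>br_br\<close>, carries it across one argument.\<close>

lemma lie_lie:
  assumes "alternating_multilinear s (*) F"
  shows "lie z (lie w F) zs - lie w (lie z F) zs = lie (br z w) F zs"
  using assms
proof (induction zs arbitrary: F)
  case Nil
  then show ?case by (simp add: act_br)
next
  case (Cons u us)
  have "F (br (br z w) u # us) = F (br z (br w u) # us) - F (br w (br z u) # us)"
    unfolding br_br using additive_diff[of "\<lambda>x. F (x # us)", OF alternating_Cons_add[OF Cons.prems]] .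
  then show ?case
    using Cons.IH[OF alternating_contract[OF Cons.prems], of u]
    by (simp add: contract_lie algebra_simps)
qed

text \<open>Contraction by \<open>w\<close> leaves the commutator of \<open>lie z\<close> and
  \<open>lie w\<close>, to be compared with \<open>lie (br z w)\<close> by
  \<open>lie_lie\<close>.\<close>

lemma ced_lie:
  assumes "alternating_multilinear s (*) F"
  shows "ced (lie z F) zs = lie z (ced F) zs"
  using assms
proof (induction zs arbitrary: F)
  case (Cons w ws)
  show ?case
    using Cons.IH[OF alternating_contract[OF Cons.prems], of w]
    by (simp add: contract_lie contract_ced lie_lie[OF Cons.prems, symmetric] twist_apply algebra_simps)
qed simp

text \<open>Contraction by \<open>z\<close> turns the square on \<open>F\<close> into the square on
  \<open>contract z F\<close>; the two terms with a Lie derivative cancel by \<open>ced_lie\<close>,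
  since \<open>ced\<close> anticommutes with \<open>twist\<close>.\<close>

lemma ced_ced:
  assumes "alternating_multilinear s (*) F"
  shows "ced (ced F) zs = 0"
  using assms
proof (induction zs arbitrary: F)
  case (Cons z zs)
  have "ced (ced F) (z # zs) = ced (ced (contract z F)) zs"
    by (simp add: contract_ced twist_apply ced_lie[OF Cons.prems])
  then show ?case using Cons.IH[OF alternating_contract[OF Cons.prems]] by simp
qed simp

end

lemma act_br_if_ced_ced:
  assumes "ced (ced (constant_form a)) [x, y] = 0"
  shows "act (br x y) a = act x (act y a) - act y (act x a)"
  using assms by (simp add: ced_constant_form algebra_simps)

text \<open>In degree 1 the square consists of terms that measure the failure of
  \<open>act_br\<close>, which vanish by assumption, and of the value of \<open>\<phi>\<close> on
  the cyclic sum.\<close>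

lemma jacobi_if_ced_ced:
  assumes act_br: "\<And>x y a. act (br x y) a = act x (act y a) - act y (act x a)"
    and "module_hom_to_ring s \<phi>" "ced (ced (linear_form \<phi>)) [x, y, z] = 0"
  shows "\<phi> (br x (br y z) + br y (br z x) + br z (br x y)) = 0"
proof -
  have add: "\<phi> (x + y) = \<phi> x + \<phi> y" for x y
    using assms(2) by (simp add: module_hom_to_ring_def)
  note simps = add additive_minus[of \<phi>, OF add] additive_diff[of \<phi>, OF add]
  have r: "br (br x y) z = - br z (br x y)" "br y (br x z) = - br y (br z x)" "br (br y z) x = - br x (br y z)"
    using additive_minus[of "br y", OF br_add_right]
    by (simp_all add: br_swap[of z "br x y"] br_swap[of x "br y z"] br_swap[of z x])
  show ?thesis
    using assms(3) by (simp add: act_br r simps algebra_simps)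
qed

end


section \<open>Dual bases and generation in degree one\<close>

lemma sum_fun_apply: "sum f A x = (\<Sum>i\<in>A. f i x)"
  by (induction A rule: infinite_finite_induct) simp_all

definition pullback :: "('m \<Rightarrow> 'n) \<Rightarrow> ('n list \<Rightarrow> 'a) \<Rightarrow> 'm list \<Rightarrow> 'a" where
  "pullback P F = (\<lambda>zs. F (map P zs))"

lemma contract_pullback: "contract z (pullback P F) = pullback P (contract (P z) F)"
  by (simp add: fun_eq_iff pullback_def contract_apply)

lemma alternating_pullback:
  assumes "alternating_multilinear t (*) F"
    and add: "\<And>x y. P (x + y) = P x + P y" and scale: "\<And>a x. P (s a x) = t a (P x)"
  shows "alternating_multilinear s (*) (pullback P F)"
proof (rule alternating_multilinear_coinduct[where X = "pullback P ` {F. alternating_multilinear t (*) F}"])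
  fix G z x y zs a
  assume "G \<in> pullback P ` {F. alternating_multilinear t (*) F}"
  then obtain F where G: "G = pullback P F" "alternating_multilinear t (*) F" by blast
  show "contract z G \<in> pullback P ` {F. alternating_multilinear t (*) F}"
    using alternating_contract[OF G(2)] by (auto simp: G(1) contract_pullback)
  show "G ((x + y) # zs) = G (x # zs) + G (y # zs)" "G (s a x # zs) = a * G (x # zs)" "G (x # x # zs) = 0"
    using alternating_Cons_add[OF G(2)] alternating_Cons_scale[OF G(2)] alternating_Cons_Cons[OF G(2)]
    by (simp_all add: G(1) pullback_def add scale)
qed (use assms(1) in blast)

lemma Alt_pullback:
  assumes "F \<in> Alt t" "\<And>x y. P (x + y) = P x + P y" "\<And>a x. P (s a x) = t a (P x)"
  shows "pullback P F \<in> Alt s"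
proof -
  have "vanishes_from N (pullback P F)" if "vanishes_from N F" for N
    using that by (auto simp: vanishes_from_def pullback_def)
  then show ?thesis using assms alternating_pullback[of t F P s] by (auto simp: Alt_iff)
qed

text \<open>If contraction by \<open>e\<close> kills \<open>F\<close>, multiples of \<open>e\<close>
  in an argument are invisible, and contraction by any other vector preserves this property.\<close>

lemma pullback_eq_if_contract_eq_0:
  fixes F :: "'m::ab_group_add list \<Rightarrow> 'a::{comm_ring, comm_monoid_mult}"
  assumes "alternating_multilinear s (*) F" and P': "\<And>z. P' z = P z + s (c z) e"
    and "contract e F = 0"
  shows "pullback P' F zs = pullback P F zs"
  using assms(1,3)
proof (induction zs arbitrary: F)
  case (Cons z zs)
  have "contract e (contract (P z) F) = 0"
    by (simp only: contract_add_scale(4)[OF Cons.prems(1), of e "P z"] Cons.prems(2) contract_simps minus_zero)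
  then have "pullback P' (contract (P z) F) zs = pullback P (contract (P z) F) zs"
    using Cons.IH[OF alternating_contract[OF Cons.prems(1)]] by simp
  moreover have "pullback P' F (z # zs) = pullback P' (contract (P z) F) zs + c z * contract e F (map P' zs)"
    using alternating_Cons_add[OF Cons.prems(1)] alternating_Cons_scale[OF Cons.prems(1)]
    by (simp add: pullback_def P' contract_apply)
  ultimately show ?case by (simp add: Cons.prems(2) pullback_def contract_apply)
qed (simp add: pullback_def)

text \<open>
  If \<open>P'\<close> and \<open>P\<close> differ by a map of rank one, then of the terms in the expansion of the
  pullback along \<open>P'\<close>, those in which the image of this map occurs twice vanish.
\<close>

lemma pullback_rank_one_change:
  fixes F :: "'m::ab_group_add list \<Rightarrow> 'a::{comm_ring, comm_monoid_mult}"
  assumes "alternating_multilinear s (*) F" and P': "\<And>z. P' z = P z + s (c z) e"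
  shows "pullback P' F zs =
    pullback P F zs + koszul (linear_form c) (twist (pullback P (contract e F))) zs"
  using assms(1)
proof (induction zs arbitrary: F)
  case (Cons z zs)
  note F = Cons.prems
  have "contract e (contract e F) = 0" by (rule contract_add_scale(3)[OF F])
  then have e: "pullback P' (contract e F) zs = pullback P (contract e F) zs"
    by (intro pullback_eq_if_contract_eq_0[OF alternating_contract[OF F] P'])
  have swap: "contract e (contract (P z) F) = - contract (P z) (contract e F)"
    by (rule contract_add_scale(4)[OF F])
  have "pullback P (- G) = - pullback P G" for G :: "'m list \<Rightarrow> 'a"
    by (simp add: fun_eq_iff pullback_def)
  \<comment> \<open>Two signs cancel: contraction passes \<open>twist\<close>, and \<open>e\<close>
    is exchanged with \<open>P z\<close>.\<close>
  then have "koszul (linear_form c) (contract z (twist (pullback P (contract e F)))) =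
      koszul (linear_form c) (twist (pullback P (contract e (contract (P z) F))))"
    by (simp add: contract_pullback swap)
  moreover have "pullback P' F (z # zs) = pullback P' (contract (P z) F) zs + c z * pullback P' (contract e F) zs"
    using alternating_Cons_add[OF F] alternating_Cons_scale[OF F]
    by (simp add: pullback_def P' contract_apply)
  moreover have "pullback P F (z # zs) = pullback P (contract (P z) F) zs"
    by (simp add: pullback_def contract_apply)
  ultimately show ?case
    using Cons.IH[OF alternating_contract[OF F], of "P z"] by (simp add: e)
qed (simp add: pullback_def)

text \<open>By the dual basis lemma such data characterize finitely generated projective modules.
  The \<open>e k\<close> generate the module but may be linearly dependent.\<close>

locale dual_basis = module_over s
  for s :: "'a::{comm_ring, comm_monoid_mult} \<Rightarrow> 'm::ab_group_add \<Rightarrow> 'm" +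
  fixes K :: nat and e :: "nat \<Rightarrow> 'm" and \<phi> :: "nat \<Rightarrow> 'm \<Rightarrow> 'a"
  assumes hom: "k < K \<Longrightarrow> module_hom_to_ring s (\<phi> k)"
    and expansion: "(\<Sum>k<K. s (\<phi> k x) (e k)) = x"
begin

lemma hom_add: "k < K \<Longrightarrow> \<phi> k (x + y) = \<phi> k x + \<phi> k y"
  and hom_scale: "k < K \<Longrightarrow> \<phi> k (s a x) = a * \<phi> k x"
  using hom by (auto simp: module_hom_to_ring_def)

lemma eq_if_homs_eq:
  assumes "\<And>\<psi>. module_hom_to_ring s \<psi> \<Longrightarrow> \<psi> x = \<psi> y"
  shows "x = y"
proof -
  have "(\<Sum>k<K. s (\<phi> k x) (e k)) = (\<Sum>k<K. s (\<phi> k y) (e k))"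
    by (rule sum.cong) (auto simp: assms[OF hom])
  then show ?thesis by (simp add: expansion)
qed

lemma hom_expansion:
  assumes "module_hom_to_ring s \<psi>"
  shows "\<psi> x = (\<Sum>k<K. \<psi> (e k) * \<phi> k x)"
proof -
  have add: "\<psi> (x + y) = \<psi> x + \<psi> y" and scale: "\<psi> (s a x) = a * \<psi> x" for a x y
    using assms by (auto simp: module_hom_to_ring_def)
  have "\<psi> x = \<psi> (\<Sum>k<K. s (\<phi> k x) (e k))" by (simp add: expansion)
  also have "\<dots> = (\<Sum>k<K. \<psi> (e k) * \<phi> k x)"
    by (simp add: additive_sum[of \<psi>, OF add] scale mult.commute)
  finally show ?thesis .
qed

text \<open>The partial sums \<open>P k\<close> of the expansion lead from \<open>P 0 = 0\<close> to
  the identity \<open>P K\<close>. The pullbacks of \<open>F\<close> along them telescope: each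
  difference has the factor \<open>linear_form (\<phi> k)\<close> by
  \<open>pullback_rank_one_change\<close>, and the pullback along 0 keeps only \<open>F []\<close>.
  The factor \<open>G k\<close> comes from a contraction, which lowers the degree bound.\<close>

lemma Alt_decomposition:
  assumes F: "F \<in> Alt s"
  obtains G where "\<And>k. k < K \<Longrightarrow> G k \<in> Alt s"
    and "F = constant_form (F []) + (\<Sum>k<K. koszul (linear_form (\<phi> k)) (G k))"
    and "\<And>N k. vanishes_from (Suc N) F \<Longrightarrow> vanishes_from N (G k)"
proof -
  define P where "P k z = (\<Sum>i<k. s (\<phi> i z) (e i))" for k z
  define G where "G k = twist (pullback (P k) (contract (e k) F))" for k
  have alt: "alternating_multilinear s (*) F" using F by (simp add: Alt_iff)
  have P_add: "P k (x + y) = P k x + P k y" if "k \<le> K" for k x y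
    using that by (auto simp: P_def hom_add scale_left_distrib sum.distrib[symmetric] intro!: sum.cong)
  have P_scale: "P k (s a x) = s a (P k x)" if "k \<le> K" for k a x
    using that by (auto simp: P_def hom_scale scale_scale
      additive_sum[of "s a", OF scale_right_distrib] intro!: sum.cong)
  have telescope: "pullback (P k) F zs = pullback (P 0) F zs + (\<Sum>i<k. koszul (linear_form (\<phi> i)) (G i) zs)"
    if "k \<le> K" for k zs
    using that
  proof (induction k)
    case (Suc k)
    have "pullback (P (Suc k)) F zs = pullback (P k) F zs + koszul (linear_form (\<phi> k)) (G k) zs"
      unfolding G_def by (rule pullback_rank_one_change[OF alt]) (simp add: P_def)
    with Suc show ?case by simp
  qed simp
  have PK: "P K = (\<lambda>z. z)" by (simp add: fun_eq_iff P_def expansion)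
  have expand: "F zs = F (map (P 0) zs) + (\<Sum>i<K. koszul (linear_form (\<phi> i)) (G i) zs)" for zs
    using telescope[of K zs] by (simp add: pullback_def PK)
  have zero: "F (0 # zs) = 0" for zs
    by (rule additive_zero[of "\<lambda>x. F (x # zs)"]) (rule alternating_Cons_add[OF alt])
  have base: "F (map (P 0) zs) = constant_form (F []) zs" for zs
    by (cases zs) (simp_all add: P_def zero)
  have "F = constant_form (F []) + (\<Sum>k<K. koszul (linear_form (\<phi> k)) (G k))"
  proof
    show "F zs = (constant_form (F []) + (\<Sum>k<K. koszul (linear_form (\<phi> k)) (G k))) zs" for zs
      unfolding expand[of zs] base plus_fun_apply sum_fun_apply ..
  qed
  moreover have "G k \<in> Alt s" if "k < K" for k
    unfolding G_def using that by (auto intro!: Alt_twist Alt_pullback Alt_contract F simp: P_add P_scale)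
  moreover have "vanishes_from N (G k)" if "vanishes_from (Suc N) F" for N k
    using that by (auto simp: G_def vanishes_from_def twist_apply pullback_def contract_apply)
  ultimately show thesis using that by blast
qed

text \<open>Induction on the degree bound: in each product of \<open>Alt_decomposition\<close> the
  left factor is a linear form and the right factor falls under the induction hypothesis.\<close>

lemma Alt_derivation_unique:
  assumes add: "\<And>F G. F \<in> Alt s \<Longrightarrow> G \<in> Alt s \<Longrightarrow> D (F + G) = D F + D G"
    and add': "\<And>F G. F \<in> Alt s \<Longrightarrow> G \<in> Alt s \<Longrightarrow> D' (F + G) = D' F + D' G"
    and mult: "\<And>\<psi> G. module_hom_to_ring s \<psi> \<Longrightarrow> G \<in> Alt s \<Longrightarrow>
      D (koszul (linear_form \<psi>) G) = koszul (D (linear_form \<psi>)) G - koszul (linear_form \<psi>) (D G)"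
    and mult': "\<And>\<psi> G. module_hom_to_ring s \<psi> \<Longrightarrow> G \<in> Alt s \<Longrightarrow>
      D' (koszul (linear_form \<psi>) G) = koszul (D' (linear_form \<psi>)) G - koszul (linear_form \<psi>) (D' G)"
    and const: "\<And>a. D (constant_form a) = D' (constant_form a)"
    and lin: "\<And>\<psi>. module_hom_to_ring s \<psi> \<Longrightarrow> D (linear_form \<psi>) = D' (linear_form \<psi>)"
    and "F \<in> Alt s"
  shows "D F = (D' F :: 'm list \<Rightarrow> 'a)"
proof -
  have zero: "D 0 = 0" "D' 0 = 0" using add[of 0 0] add'[of 0 0] by auto
  have sum: "D (sum G I) = (\<Sum>k\<in>I. D (G k))" "D' (sum G I) = (\<Sum>k\<in>I. D' (G k))"
    if "finite I" "\<And>k. k \<in> I \<Longrightarrow> G k \<in> Alt s" for I :: "nat set" and G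
    using that by (induction I rule: finite_induct) (simp_all add: zero add add' Alt_sum)
  have "D F = D' F" if "vanishes_from N F" "F \<in> Alt s" for N F
    using that
  proof (induction N arbitrary: F)
    case 0
    then have "F = 0" by (auto simp: vanishes_from_def)
    then show ?case by (simp only: zero)
  next
    case (Suc N)
    obtain G where G: "\<And>k. k < K \<Longrightarrow> G k \<in> Alt s"
      and F: "F = constant_form (F []) + (\<Sum>k<K. koszul (linear_form (\<phi> k)) (G k))"
      and van: "\<And>k. vanishes_from N (G k)"
      using Alt_decomposition[OF Suc.prems(2)] Suc.prems(1) by metis
    have Alt: "koszul (linear_form (\<phi> k)) (G k) \<in> Alt s" if "k < K" for k
      using that by (intro Alt_koszul Alt_linear_form hom G)
    let ?S = "\<Sum>k<K. koszul (linear_form (\<phi> k)) (G k)"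
    have S: "?S \<in> Alt s" by (rule Alt_sum) (simp add: Alt)
    have "D F = D (constant_form (F []) + ?S)" by (rule arg_cong[OF F])
    also have "\<dots> = D (constant_form (F [])) + D ?S" by (rule add[OF Alt_constant_form S])
    also have "D ?S = (\<Sum>k<K. D (koszul (linear_form (\<phi> k)) (G k)))" by (rule sum) (simp_all add: Alt)
    also have "(\<Sum>k<K. D (koszul (linear_form (\<phi> k)) (G k))) = (\<Sum>k<K. D' (koszul (linear_form (\<phi> k)) (G k)))"
      by (rule sum.cong) (auto simp: mult mult' hom G lin Suc.IH[OF van])
    also have "\<dots> = D' ?S" by (rule sum(2)[symmetric]) (simp_all add: Alt)
    also have "D (constant_form (F [])) + D' ?S = D' (constant_form (F []) + ?S)"
      unfolding const by (rule add'[OF Alt_constant_form S, symmetric])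
    also have "\<dots> = D' F" by (rule arg_cong[OF F, symmetric])
    finally show ?case .
  qed
  with \<open>F \<in> Alt s\<close> show ?thesis by (auto simp: Alt_iff)
qed

end

text \<open>The vectors are the images of the standard basis under \<open>\<pi>\<close>, the linear
  forms are the coordinates of \<open>\<iota>\<close>.\<close>

lemma (in fg_projective_module) obtain_dual_basis:
  obtains K e \<phi> where "dual_basis s K e \<phi>"
proof -
  obtain n \<iota> \<pi> where \<iota>: "\<And>x. \<iota> x \<in> free_module n" "\<And>x y. \<iota> (x + y) = \<iota> x + \<iota> y"
      "\<And>a x. \<iota> (s a x) = (\<lambda>k. a * \<iota> x k)"
    and \<pi>: "\<And>u v. u \<in> free_module n \<Longrightarrow> v \<in> free_module n \<Longrightarrow> \<pi> (u + v) = \<pi> u + \<pi> v"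
      "\<And>a u. u \<in> free_module n \<Longrightarrow> \<pi> (\<lambda>k. a * u k) = s a (\<pi> u)"
    and inv: "\<And>x. \<pi> (\<iota> x) = x"
    using direct_summand_of_free by blast
  define b where "b i = (\<lambda>k. if k = i then 1 else (0::'a))" for i :: nat
  have b: "b i \<in> free_module n" if "i < n" for i using that by (auto simp: b_def free_module_def)
  \<comment> \<open>Truncation after \<open>m\<close> coordinates permits an induction on
    \<open>m\<close> that stays inside \<open>free_module n\<close>, where \<open>\<pi>\<close> is
    known to be linear.\<close>
  have \<pi>_sum: "\<pi> (\<lambda>k. if k < m then u k else 0) = (\<Sum>i<m. s (u i) (\<pi> (b i)))" if "m \<le> n" for u m
    using that
  proof (induction m)
    case 0
    have "(0 :: nat \<Rightarrow> 'a) \<in> free_module n" by (simp add: free_module_def)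
    from \<pi>(1)[OF this this, unfolded add_0_left] have "\<pi> 0 = 0" by (simp only: add_cancel_right_right)
    then show ?case by (simp add: zero_fun_def)
  next
    case (Suc m)
    have "(\<lambda>k. if k < Suc m then u k else 0) = (\<lambda>k. if k < m then u k else 0) + (\<lambda>k. u m * b m k)"
      by (auto simp: fun_eq_iff b_def less_Suc_eq)
    moreover have "(\<lambda>k. if k < m then u k else 0) \<in> free_module n" "(\<lambda>k. u m * b m k) \<in> free_module n"
      using Suc.prems by (auto simp: free_module_def b_def)
    ultimately show ?case using Suc b[of m] by (simp add: \<pi>)
  qed
  have "x = (\<Sum>i<n. s (\<iota> x i) (\<pi> (b i)))" for x
  proof -
    have "(\<lambda>k. if k < n then \<iota> x k else 0) = \<iota> x" using \<iota>(1)[of x] by (auto simp: free_module_def)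
    with \<pi>_sum[of n "\<iota> x"] show ?thesis by (simp add: inv)
  qed
  then have "dual_basis s n (\<lambda>i. \<pi> (b i)) (\<lambda>i x. \<iota> x i)"
    by unfold_locales (simp_all add: \<iota> module_hom_to_ring_def)
  then show thesis by (rule that)
qed

lemma module_over_scale_prod:
  assumes "module_over s" "module_over t"
  shows "module_over (scale_prod s t)"
  using assms by (simp add: module_over_def scale_prod_def split_beta)

lemma sum_lessThan_add:
  fixes g :: "nat \<Rightarrow> 'a::comm_monoid_add"
  shows "(\<Sum>k<m + n. g k) = (\<Sum>k<m. g k) + (\<Sum>k<n. g (m + k))"
  by (induction n) (simp_all add: add.assoc)

lemma dual_basis_scale_prod:
  assumes "dual_basis s m e \<phi>" "dual_basis t n f \<psi>"
  shows "dual_basis (scale_prod s t) (m + n) (\<lambda>k. if k < m then (e k, 0) else (0, f (k - m)))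
    (\<lambda>k z. if k < m then \<phi> k (fst z) else \<psi> (k - m) (snd z))"
proof -
  interpret s: dual_basis s m e \<phi> by fact
  interpret t: dual_basis t n f \<psi> by fact
  interpret module_over "scale_prod s t"
    by (intro module_over_scale_prod s.module_over_axioms t.module_over_axioms)
  have s0: "s a 0 = 0" "t a 0 = 0" for a
    using additive_zero[of "s a"] additive_zero[of "t a"] s.scale_right_distrib t.scale_right_distrib by auto
  show ?thesis
  proof
    fix k assume "k < m + n"
    then show "module_hom_to_ring (scale_prod s t) (\<lambda>z. if k < m then \<phi> k (fst z) else \<psi> (k - m) (snd z))"
      using s.hom[of k] t.hom[of "k - m"] by (auto simp: module_hom_to_ring_def scale_prod_def split_beta)
  next
    fix x
    show "(\<Sum>k<m + n. scale_prod s t (if k < m then \<phi> k (fst x) else \<psi> (k - m) (snd x))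
        (if k < m then (e k, 0) else (0, f (k - m)))) = x"
      by (rule prod_eqI)
        (simp_all add: sum_lessThan_add fst_sum snd_sum scale_prod_def s0 s.expansion t.expansion)
  qed
qed


section \<open>Derivations are Chevalley-Eilenberg operators\<close>

text \<open>Product rule and degree are prescribed on constants and linear forms, which generate;
  there the sign is explicit and no homogeneous components have to be mentioned.\<close>

locale form_derivation = algebra_over sR + dual_basis s K e \<phi>
  for sR :: "'r::{comm_ring, comm_monoid_mult} \<Rightarrow> 'a::{comm_ring, comm_monoid_mult} \<Rightarrow> 'a"
    and s :: "'a \<Rightarrow> 'l::ab_group_add \<Rightarrow> 'l" and K e \<phi> +
  fixes D :: "('l list \<Rightarrow> 'a) \<Rightarrow> 'l list \<Rightarrow> 'a"
  assumes D_Alt: "F \<in> Alt s \<Longrightarrow> D F \<in> Alt s"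
    and D_add: "F \<in> Alt s \<Longrightarrow> G \<in> Alt s \<Longrightarrow> D (F + G) = D F + D G"
    and D_scaleR: "F \<in> Alt s \<Longrightarrow> D (\<lambda>zs. sR r (F zs)) = (\<lambda>zs. sR r (D F zs))"
    and D_constant_mult: "G \<in> Alt s \<Longrightarrow>
      D (koszul (constant_form a) G) = koszul (D (constant_form a)) G + koszul (constant_form a) (D G)"
    and D_linear_mult: "module_hom_to_ring s \<psi> \<Longrightarrow> G \<in> Alt s \<Longrightarrow>
      D (koszul (linear_form \<psi>) G) = koszul (D (linear_form \<psi>)) G - koszul (linear_form \<psi>) (D G)"
    and D_constant_degree: "length zs \<noteq> 1 \<Longrightarrow> D (constant_form a) zs = 0"
    and D_linear_degree: "module_hom_to_ring s \<psi> \<Longrightarrow> length zs \<noteq> 2 \<Longrightarrow> D (linear_form \<psi>) zs = 0"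
begin

text \<open>The sign inverts \<open>ced_constant_form\<close>.\<close>

definition act :: "'l \<Rightarrow> 'a \<Rightarrow> 'a" where
  "act z a = - D (constant_form a) [z]"

text \<open>The value of a linear form \<open>\<psi>\<close> on the bracket of \<open>z\<close> and \<open>w\<close> that is to be defined.\<close>

definition bracket_value :: "('l \<Rightarrow> 'a) \<Rightarrow> 'l \<Rightarrow> 'l \<Rightarrow> 'a" where
  "bracket_value \<psi> z w = act z (\<psi> w) - act w (\<psi> z) - D (linear_form \<psi>) [z, w]"

text \<open>\<open>bracket_value\<close> is what results from solving the formula for
  \<open>ced\<close> on a form of degree 1 for the value on the bracket; its values at the
  \<open>\<phi> k\<close> serve as coefficients.\<close>

definition br :: "'l \<Rightarrow> 'l \<Rightarrow> 'l" where
  "br z w = (\<Sum>k<K. s (bracket_value (\<phi> k) z w) (e k))"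

lemma D_constant_form: "D (constant_form a) [z] = - act z a"
  by (simp add: act_def)

lemma D_sum:
  assumes "finite I" "\<And>k. k \<in> I \<Longrightarrow> G k \<in> Alt s"
  shows "D (sum G I) = (\<Sum>k\<in>I. D (G k))"
  using assms D_add[of 0 0] by (induction I rule: finite_induct) (simp_all add: D_add Alt_sum)

lemma act_add_right: "act z (a + b) = act z a + act z b"
proof -
  have "constant_form (a + b) = (constant_form a + constant_form b :: 'l list \<Rightarrow> 'a)"
    by (auto simp: fun_eq_iff constant_form_def)
  then show ?thesis by (simp add: act_def D_add)
qed

lemma act_is_derivation: "is_derivation sR (act z)"
proof -
  have "act z (sR r a) = sR r (act z a)" for r a
  proof -
    have "constant_form (sR r a) = (\<lambda>zs :: 'l list. sR r (constant_form a zs))"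
      by (auto simp: fun_eq_iff constant_form_def sR_additive)
    then show ?thesis by (simp add: act_def D_scaleR sR_additive)
  qed
  moreover have "act z (a * b) = act z a * b + a * act z b" for a b
  proof -
    have "constant_form (a * b) = koszul (constant_form a) (constant_form b :: 'l list \<Rightarrow> 'a)"
      by (auto simp: fun_eq_iff) (auto simp: constant_form_def)
    then show ?thesis by (simp add: act_def D_constant_mult)
  qed
  ultimately show ?thesis by (simp add: is_derivation_def act_add_right)
qed

lemma act_mult: "act x (a * b) = act x a * b + a * act x b"
  using act_is_derivation[of x] by (simp add: is_derivation_def)

lemma alternating_D: "F \<in> Alt s \<Longrightarrow> alternating_multilinear s (*) (D F)"
  using D_Alt by (simp add: Alt_iff)

lemma act_add_left: "act (x + y) a = act x a + act y a"
  using alternating_Cons_add[OF alternating_D[OF Alt_constant_form]] by (simp add: act_def)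

lemma act_scale: "act (s a x) b = a * act x b"
  using alternating_Cons_scale[OF alternating_D[OF Alt_constant_form]] by (simp add: act_def)

text \<open>The point is that \<open>bracket_value\<close> is \<open>A\<close>-linear in
  \<open>\<psi>\<close>: for a multiple by \<open>c\<close>, the terms with \<open>act z c\<close>
  and \<open>act w c\<close> cancel those from \<open>D (constant_form c)\<close>. Expanding
  \<open>\<psi>\<close> by \<open>hom_expansion\<close> then gives the definition of
  \<open>br\<close>.\<close>

lemma hom_br:
  assumes \<psi>: "module_hom_to_ring s \<psi>"
  shows "\<psi> (br z w) = bracket_value \<psi> z w"
proof -
  have add: "\<psi> (x + y) = \<psi> x + \<psi> y" and scale: "\<psi> (s a x) = a * \<psi> x" for a x y
    using \<psi> by (auto simp: module_hom_to_ring_def)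
  let ?c = "\<lambda>k. constant_form (\<psi> (e k)) :: 'l list \<Rightarrow> 'a"
  have Alt: "koszul (?c k) (linear_form (\<phi> k)) \<in> Alt s" if "k < K" for k
    using that by (intro Alt_koszul Alt_constant_form Alt_linear_form hom)
  have lin: "linear_form \<psi> = (\<Sum>k<K. koszul (?c k) (linear_form (\<phi> k)))"
  proof
    fix zs
    show "linear_form \<psi> zs = (\<Sum>k<K. koszul (?c k) (linear_form (\<phi> k))) zs"
      using hom_expansion[OF \<psi>, of "hd zs"] by (cases zs; cases "tl zs") (auto simp: sum_fun_apply)
  qed
  have "D (linear_form \<psi>) = (\<Sum>k<K. D (koszul (?c k) (linear_form (\<phi> k))))"
    unfolding lin by (rule D_sum) (simp_all only: finite_lessThan lessThan_iff Alt)
  then have D: "D (linear_form \<psi>) [z, w] = (\<Sum>k<K. D (koszul (?c k) (linear_form (\<phi> k))) [z, w])"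
    by (simp only: sum_fun_apply)
  have "bracket_value \<psi> z w = (\<Sum>k<K. act z (\<psi> (e k) * \<phi> k w) - act w (\<psi> (e k) * \<phi> k z)
      - D (koszul (?c k) (linear_form (\<phi> k))) [z, w])"
    unfolding bracket_value_def D hom_expansion[OF \<psi>, of w] hom_expansion[OF \<psi>, of z]
    by (simp add: additive_sum[of "act _", OF act_add_right] sum_subtractf)
  also have "\<dots> = (\<Sum>k<K. \<psi> (e k) * bracket_value (\<phi> k) z w)"
    by (rule sum.cong)
      (auto simp: D_constant_mult Alt_linear_form hom act_mult bracket_value_def D_constant_form
        algebra_simps)
  also have "\<dots> = \<psi> (br z w)"
    by (simp add: br_def additive_sum[of \<psi>, OF add] scale mult.commute)
  finally show ?thesis by simp
qed

text \<open>Linear forms separate vectors, so each rule for \<open>br\<close> reduces to one for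
  \<open>bracket_value\<close>, which follows from the alternating form
  \<open>D (linear_form \<psi>)\<close> and the rules for \<open>act\<close>.\<close>

lemma almost_lie_rinehart: "almost_lie_rinehart sR s br act"
proof
  fix x y z a b
  have lin: "bracket_value \<psi> (x + y) z = bracket_value \<psi> x z + bracket_value \<psi> y z"
    "bracket_value \<psi> x (y + z) = bracket_value \<psi> x y + bracket_value \<psi> x z"
    "bracket_value \<psi> x x = 0"
    "bracket_value \<psi> x (s a y) = act x a * \<psi> y + a * bracket_value \<psi> x y"
    if \<psi>: "module_hom_to_ring s \<psi>" for \<psi>
  proof -
    have \<psi>': "\<psi> (x + y) = \<psi> x + \<psi> y" "\<psi> (s a x) = a * \<psi> x" for x y a
      using \<psi> by (auto simp: module_hom_to_ring_def)
    note A = alternating_D[OF Alt_linear_form[OF \<psi>]]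
    note D = alternating_Cons_add[OF A] alternating_Cons_Cons[OF A]
      alternating_Cons_add[OF alternating_contract[OF A], unfolded contract_apply]
      alternating_Cons_scale[OF alternating_contract[OF A], unfolded contract_apply]
    show "bracket_value \<psi> (x + y) z = bracket_value \<psi> x z + bracket_value \<psi> y z"
      "bracket_value \<psi> x (y + z) = bracket_value \<psi> x y + bracket_value \<psi> x z"
      "bracket_value \<psi> x x = 0"
      "bracket_value \<psi> x (s a y) = act x a * \<psi> y + a * bracket_value \<psi> x y"
      by (simp_all add: bracket_value_def D \<psi>' act_add_left act_add_right act_scale act_mult algebra_simps)
  qed
  have z: "\<psi> 0 = 0" if "module_hom_to_ring s \<psi>" for \<psi>
    using that by (intro additive_zero) (simp add: module_hom_to_ring_def)
  have hom_simps: "\<psi> (x + y) = \<psi> x + \<psi> y" "\<psi> (s a x) = a * \<psi> x"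
    if "module_hom_to_ring s \<psi>" for x y a \<psi>
    using that by (auto simp: module_hom_to_ring_def)
  show "br (x + y) z = br x z + br y z"
    by (rule eq_if_homs_eq) (simp add: hom_br hom_simps lin)
  show "br x (y + z) = br x y + br x z"
    by (rule eq_if_homs_eq) (simp add: hom_br hom_simps lin)
  show "br x x = 0"
    by (rule eq_if_homs_eq) (simp add: hom_br z lin)
  show "br x (s a y) = s (act x a) y + s a (br x y)"
    by (rule eq_if_homs_eq) (simp add: hom_br hom_simps lin)
qed (rule act_add_left act_is_derivation act_scale)+

sublocale almost_lie_rinehart sR s br act
  by (rule almost_lie_rinehart)

text \<open>Both are derivations, and \<open>act\<close> and \<open>br\<close> were chosen to make
  them agree on constants and linear forms.\<close>

lemma D_eq_ced:
  assumes "F \<in> Alt s"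
  shows "D F = ced F"
proof (rule Alt_derivation_unique[OF _ _ _ _ _ _ assms])
  fix F G assume "F \<in> Alt s" "G \<in> Alt s"
  then show "D (F + G) = D F + D G" by (rule D_add)
  show "ced (F + G) = ced F + ced G" by (rule ced_add)
next
  fix \<psi> G assume "module_hom_to_ring s \<psi>" "G \<in> Alt s"
  then show "D (koszul (linear_form \<psi>) G) = koszul (D (linear_form \<psi>)) G - koszul (linear_form \<psi>) (D G)"
    by (rule D_linear_mult)
  have "twist (linear_form \<psi>) = - linear_form \<psi>"
    by (auto simp: fun_eq_iff twist_apply linear_form_def split: list.split)
  then show "ced (koszul (linear_form \<psi>) G) = koszul (ced (linear_form \<psi>)) G - koszul (linear_form \<psi>) (ced G)"
    by (simp add: ced_koszul)
next
  fix a
  show "D (constant_form a) = ced (constant_form a)"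
  proof
    fix zs
    show "D (constant_form a) zs = ced (constant_form a) zs"
      using D_constant_degree[of zs a]
      by (auto simp: ced_constant_form linear_form_def act_def split: list.split)
  qed
next
  fix \<psi> assume \<psi>: "module_hom_to_ring s \<psi>"
  show "D (linear_form \<psi>) = ced (linear_form \<psi>)"
  proof
    fix zs
    show "D (linear_form \<psi>) zs = ced (linear_form \<psi>) zs"
    proof (cases "length zs = 2")
      case True
      then obtain z w where "zs = [z, w]" by (auto simp: numeral_2_eq_2 length_Suc_conv)
      then show ?thesis by (simp add: hom_br[OF \<psi>] bracket_value_def ced_constant_form)
    next
      case False
      then have "ced (linear_form \<psi>) zs = 0"
        by (intro ced_eq_zero) (auto simp: linear_form_def split: list.split)
      then show ?thesis using D_linear_degree[OF \<psi> False] by simp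
    qed
  qed
qed

end


section \<open>The identification of the two spaces of forms\<close>

lemma alternating_compose:
  assumes "alternating_multilinear s t f"
    and "\<And>u v. h (u + v) = h u + h v" and "\<And>a u. h (t a u) = t' a (h u)"
  shows "alternating_multilinear s t' (\<lambda>zs. h (f zs))"
  using assms(1) additive_zero[of h, OF assms(2)] unfolding alternating_multilinear_def
  by (simp add: assms(2,3))

lemma alternating_guard:
  fixes F :: "'m::ab_group_add list \<Rightarrow> 'n::ab_group_add"
  assumes "alternating_multilinear s t F" "\<And>a. t a 0 = 0"
  shows "alternating_multilinear s t (\<lambda>zs. if length zs = n then F zs else 0)"
  unfolding alternating_multilinear_def
proof (intro conjI allI impI)
  note F = assms(1)[unfolded alternating_multilinear_def]
  fix zs :: "'m list" and i x y a
  assume "i < length zs"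
  then show "(if length (zs[i := x + y]) = n then F (zs[i := x + y]) else 0) =
      (if length (zs[i := x]) = n then F (zs[i := x]) else 0) + (if length (zs[i := y]) = n then F (zs[i := y]) else 0)"
    "(if length (zs[i := s a x]) = n then F (zs[i := s a x]) else 0) =
      t a (if length (zs[i := x]) = n then F (zs[i := x]) else 0)"
    using F assms(2) by simp_all
next
  fix zs :: "'m list" and i j assume "i < j \<and> j < length zs \<and> zs ! i = zs ! j"
  then have "F zs = 0" using assms(1) unfolding alternating_multilinear_def by blast
  then show "(if length zs = n then F zs else 0) = 0" by simp
qed

lemma alternating_prefix:
  assumes "alternating_multilinear s t F"
  shows "alternating_multilinear s t (\<lambda>zs. F (us @ zs))"
  using assms
proof (induction us arbitrary: F)
  case (Cons u us)
  from Cons.IH[OF alternating_contract[OF Cons.prems, of u]] show ?case by (simp add: contract_apply)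
qed simp

locale two_modules = H: module_over sH + Q: module_over sQ
  for sH :: "'a::{comm_ring, comm_monoid_mult} \<Rightarrow> 'h::ab_group_add \<Rightarrow> 'h"
    and sQ :: "'a \<Rightarrow> 'q::ab_group_add \<Rightarrow> 'q"
begin

abbreviation "sL \<equiv> scale_prod sQ sH"

lemma sH_zero [simp]: "sH a 0 = 0" and sQ_zero [simp]: "sQ a 0 = 0"
  by (rule additive_zero, rule H.scale_right_distrib) (rule additive_zero, rule Q.scale_right_distrib)

lemma sH_zero_left [simp]: "sH 0 x = 0" and sQ_zero_left [simp]: "sQ 0 \<xi> = 0"
  using additive_zero[of "\<lambda>a. sH a x"] additive_zero[of "\<lambda>a. sQ a \<xi>"]
  by (simp_all add: H.scale_left_distrib Q.scale_left_distrib)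

definition alternating2 :: "('a, 'h, 'q) form \<Rightarrow> bool" where
  "alternating2 f \<longleftrightarrow> (\<forall>\<xi>s. alternating_multilinear sH (*) (f \<xi>s)) \<and>
     alternating_multilinear sQ (\<lambda>a g xs. a * g xs) f"

text \<open>A bound on the total degree bounds both degrees, and also gives the finiteness required
  of each \<open>f \<xi>s\<close>.\<close>

lemma Alt2_iff:
  "f \<in> Alt2 sH sQ \<longleftrightarrow> alternating2 f \<and> (\<exists>N. \<forall>\<xi>s xs. N \<le> length \<xi>s + length xs \<longrightarrow> f \<xi>s xs = 0)"
  (is "_ \<longleftrightarrow> _ \<and> ?b")
proof
  assume f: "f \<in> Alt2 sH sQ"
  then have "finite {(length \<xi>s, length xs) |\<xi>s xs. f \<xi>s xs \<noteq> 0}" by (simp add: Alt2_def)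
  then have "finite ((\<lambda>(m, n). m + n) ` {(length \<xi>s, length xs) |\<xi>s xs. f \<xi>s xs \<noteq> 0})" by (rule finite_imageI)
  then have "\<exists>N. \<forall>n\<in>(\<lambda>(m, n). m + n) ` {(length \<xi>s, length xs) |\<xi>s xs. f \<xi>s xs \<noteq> 0}. n < N"
    by (rule finite_nat_set_iff_bounded[THEN iffD1])
  then obtain N where N: "\<forall>n\<in>(\<lambda>(m, n). m + n) ` {(length \<xi>s, length xs) |\<xi>s xs. f \<xi>s xs \<noteq> 0}. n < N" ..
  have "f \<xi>s xs = 0" if "N \<le> length \<xi>s + length xs" for \<xi>s xs
  proof (rule ccontr)
    assume "f \<xi>s xs \<noteq> 0"
    then have "length \<xi>s + length xs < N" by (intro N[rule_format]) force
    with that show False by simp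
  qed
  with f show "alternating2 f \<and> ?b" by (auto simp: alternating2_def Alt2_def Alt_iff)
next
  assume f: "alternating2 f \<and> ?b"
  then obtain N where N: "\<And>\<xi>s xs. N \<le> length \<xi>s + length xs \<Longrightarrow> f \<xi>s xs = 0" by blast
  then have "{(length \<xi>s, length xs) |\<xi>s xs. f \<xi>s xs \<noteq> 0} \<subseteq> {..N} \<times> {..N}"
    by (force simp: not_le[symmetric])
  then have "finite {(length \<xi>s, length xs) |\<xi>s xs. f \<xi>s xs \<noteq> 0}" by (rule finite_subset) simp
  moreover have "vanishes_from N (f \<xi>s)" for \<xi>s by (auto simp: vanishes_from_def intro: N)
  ultimately show "f \<in> Alt2 sH sQ" using f by (auto simp: alternating2_def Alt2_def Alt_iff)
qed

lemma alternating2_simps: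
  assumes "alternating2 f"
  shows "f ((\<xi> + \<eta>) # \<xi>s) xs = f (\<xi> # \<xi>s) xs + f (\<eta> # \<xi>s) xs"
    and "f (sQ a \<xi> # \<xi>s) xs = a * f (\<xi> # \<xi>s) xs"
    and "f (\<xi> # \<xi> # \<xi>s) xs = 0" and "f (0 # \<xi>s) xs = 0"
    and "f \<xi>s ((x + y) # xs) = f \<xi>s (x # xs) + f \<xi>s (y # xs)"
    and "f \<xi>s (sH a x # xs) = a * f \<xi>s (x # xs)"
    and "f \<xi>s (x # x # xs) = 0" and "f \<xi>s (0 # xs) = 0"
proof -
  have o: "alternating_multilinear sQ (\<lambda>a g xs. a * g xs) f" and i: "alternating_multilinear sH (*) (f \<xi>s)" for \<xi>s
    using assms by (auto simp: alternating2_def)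
  show add: "f ((\<xi> + \<eta>) # \<xi>s) xs = f (\<xi> # \<xi>s) xs + f (\<eta> # \<xi>s) xs" for \<xi> \<eta> \<xi>s xs
    using alternating_Cons_add[OF o, of \<xi> \<eta> \<xi>s] by simp
  show "f (sQ a \<xi> # \<xi>s) xs = a * f (\<xi> # \<xi>s) xs"
    using alternating_Cons_scale[OF o, of a \<xi> \<xi>s] by simp
  show "f (\<xi> # \<xi> # \<xi>s) xs = 0"
    using alternating_Cons_Cons[OF o, of \<xi> \<xi>s] by simp
  show "f (0 # \<xi>s) xs = 0" by (rule additive_zero[of "\<lambda>\<xi>. f (\<xi> # \<xi>s) xs"]) (rule add)
  show add': "f \<xi>s ((x + y) # xs) = f \<xi>s (x # xs) + f \<xi>s (y # xs)" for x y \<xi>s xs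
    by (rule alternating_Cons_add[OF i])
  show "f \<xi>s (sH a x # xs) = a * f \<xi>s (x # xs)" by (rule alternating_Cons_scale[OF i])
  show "f \<xi>s (x # x # xs) = 0" by (rule alternating_Cons_Cons[OF i])
  show "f \<xi>s (0 # xs) = 0" by (rule additive_zero[of "\<lambda>x. f \<xi>s (x # xs)"]) (rule add')
qed

lemma uncombine_apply: "uncombine F \<xi>s xs = F (map (\<lambda>\<xi>. (\<xi>, 0)) \<xi>s @ map (\<lambda>x. (0, x)) xs)"
  by (simp add: uncombine_def)

lemma contract_uncombine: "contract \<xi> (uncombine F) = uncombine (contract (\<xi>, 0) F)"
  by (simp add: fun_eq_iff contract_apply uncombine_apply)

lemma alternating2_uncombine:
  assumes "alternating_multilinear sL (*) F"
  shows "alternating2 (uncombine F)"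
  unfolding alternating2_def
proof (intro conjI allI)
  fix \<xi>s
  have "uncombine F \<xi>s = pullback (\<lambda>x. (0, x)) (\<lambda>zs. F (map (\<lambda>\<xi>. (\<xi>, 0)) \<xi>s @ zs))"
    by (simp add: fun_eq_iff uncombine_apply pullback_def)
  then show "alternating_multilinear sH (*) (uncombine F \<xi>s)"
    using alternating_pullback[OF alternating_prefix[OF assms], of "\<lambda>x. (0, x)" sH]
    by (simp add: scale_prod_def)
next
  show "alternating_multilinear sQ (\<lambda>a g xs. a * g xs) (uncombine F)"
  proof (rule alternating_multilinear_coinduct[where X = "uncombine ` {F. alternating_multilinear sL (*) F}"])
    show "uncombine F \<in> uncombine ` {F. alternating_multilinear sL (*) F}" using assms by blast
  next
    fix f \<xi> \<eta> \<xi>s a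
    assume "f \<in> uncombine ` {F. alternating_multilinear sL (*) F}"
    then obtain F where F: "f = uncombine F" "alternating_multilinear sL (*) F" by blast
    show "contract \<xi> f \<in> uncombine ` {F. alternating_multilinear sL (*) F}"
      using alternating_contract[OF F(2)] by (auto simp only: F(1) contract_uncombine)
    show "f ((\<xi> + \<eta>) # \<xi>s) = f (\<xi> # \<xi>s) + f (\<eta> # \<xi>s)"
      using alternating_Cons_add[OF F(2), of "(\<xi>, 0)" "(\<eta>, 0)"] by (simp add: fun_eq_iff F(1) uncombine_apply)
    show "f (sQ a \<xi> # \<xi>s) = (\<lambda>xs. a * f (\<xi> # \<xi>s) xs)"
      using alternating_Cons_scale[OF F(2), of a "(\<xi>, 0)"]
      by (simp add: fun_eq_iff F(1) uncombine_apply scale_prod_def)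
    show "f (\<xi> # \<xi> # \<xi>s) = 0"
      using alternating_Cons_Cons[OF F(2)] by (simp add: fun_eq_iff F(1) uncombine_apply)
  qed
qed

lemma uncombine_in_Alt2:
  assumes "F \<in> Alt sL"
  shows "uncombine F \<in> Alt2 sH sQ"
proof -
  obtain N where "vanishes_from N F" using assms by (auto simp: Alt_iff)
  then have "\<forall>\<xi>s xs. N \<le> length \<xi>s + length xs \<longrightarrow> uncombine F \<xi>s xs = 0"
    by (auto simp: vanishes_from_def uncombine_apply)
  then show ?thesis using assms alternating2_uncombine by (auto simp: Alt2_iff Alt_iff)
qed

text \<open>Contraction by \<open>z\<close> on the bigraded side. The \<open>H\<close>-component of
  \<open>z\<close> has to pass the arguments from \<open>Q\<close>, hence the sign.\<close>

definition insert_argument :: "'q \<times> 'h \<Rightarrow> ('a, 'h, 'q) form \<Rightarrow> ('a, 'h, 'q) form" where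
  "insert_argument z f = (\<lambda>\<xi>s xs. f (fst z # \<xi>s) xs + sg (length \<xi>s) (f \<xi>s (snd z # xs)))"

text \<open>The inverse of \<open>uncombine\<close>. Inserting one argument after the other avoids a
  sum over shuffles.\<close>

primrec recombine :: "('a, 'h, 'q) form \<Rightarrow> ('q \<times> 'h) list \<Rightarrow> 'a" where
  "recombine f [] = f [] []"
| "recombine f (z # zs) = recombine (insert_argument z f) zs"

lemma contract_recombine: "contract z (recombine f) = recombine (insert_argument z f)"
  by (simp add: fun_eq_iff contract_apply)

lemma alternating2_insert_argument:
  assumes "alternating2 f"
  shows "alternating2 (insert_argument z f)"
proof -
  have o: "alternating_multilinear sQ (\<lambda>a g xs. a * g xs) f" and i: "alternating_multilinear sH (*) (f \<xi>s)" for \<xi>s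
    using assms by (auto simp: alternating2_def)
  have "alternating_multilinear sH (*) (insert_argument z f \<xi>s)" for \<xi>s
  proof -
    have "insert_argument z f \<xi>s = f (fst z # \<xi>s) + (if even (length \<xi>s) then contract (snd z) (f \<xi>s) else - contract (snd z) (f \<xi>s))"
      by (simp add: fun_eq_iff insert_argument_def contract_apply sg_def)
    moreover have "alternating_multilinear sH (*) (if even (length \<xi>s) then contract (snd z) (f \<xi>s) else - contract (snd z) (f \<xi>s))"
      by (auto intro!: alternating_uminus alternating_contract i)
    ultimately show ?thesis by (simp only:) (intro alternating_add i, auto simp: distrib_left)
  qed
  moreover have "insert_argument z f = contract (fst z) f + twist (\<lambda>\<xi>s. contract (snd z) (f \<xi>s))"
    by (simp add: fun_eq_iff insert_argument_def contract_apply twist_apply sg_def)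
  moreover have "alternating_multilinear sQ (\<lambda>a g xs. a * g xs) (contract (fst z) f + twist (\<lambda>\<xi>s. contract (snd z) (f \<xi>s)))"
    by (intro alternating_add alternating_contract[OF o] alternating_twist alternating_compose[OF o])
      (auto simp: fun_eq_iff distrib_left contract_apply)
  ultimately show ?thesis unfolding alternating2_def by (simp only: simp_thms)
qed

lemma recombine_add: "recombine (f + g) zs = recombine f zs + recombine g zs"
proof (induction zs arbitrary: f g)
  case (Cons z zs)
  have "insert_argument z (f + g) = insert_argument z f + insert_argument z g"
    by (simp add: fun_eq_iff insert_argument_def)
  then show ?case by (simp only: recombine.simps Cons)
qed simp

lemma recombine_scale: "recombine (\<lambda>\<xi>s xs. a * f \<xi>s xs) zs = a * recombine f zs"
proof (induction zs arbitrary: f)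
  case (Cons z zs)
  have "insert_argument z (\<lambda>\<xi>s xs. a * f \<xi>s xs) = (\<lambda>\<xi>s xs. a * insert_argument z f \<xi>s xs)"
    by (simp add: fun_eq_iff insert_argument_def distrib_left sg_mult_right)
  then show ?case by (simp only: recombine.simps Cons)
qed simp

lemma recombine_eq_zero:
  "(\<And>\<xi>s xs. length \<xi>s + length xs = length zs \<Longrightarrow> f \<xi>s xs = 0) \<Longrightarrow> recombine f zs = 0"
  by (induction zs arbitrary: f) (simp_all add: insert_argument_def)

lemma recombine_in_Alt:
  assumes "f \<in> Alt2 sH sQ"
  shows "recombine f \<in> Alt sL"
proof -
  have "alternating_multilinear sL (*) (recombine f)"
  proof (rule alternating_multilinear_coinduct[where X = "recombine ` {f. alternating2 f}"])
    show "recombine f \<in> recombine ` {f. alternating2 f}" using assms by (simp add: Alt2_iff)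
  next
    fix F z w zs a
    assume "F \<in> recombine ` {f. alternating2 f}"
    then obtain f where f: "F = recombine f" "alternating2 f" by blast
    note simps = alternating2_simps[OF f(2)]
    show "contract z F \<in> recombine ` {f. alternating2 f}"
      unfolding f(1) contract_recombine
      by (intro imageI CollectI alternating2_insert_argument f(2))
    have "insert_argument (z + w) f = insert_argument z f + insert_argument w f"
      by (simp add: fun_eq_iff insert_argument_def simps)
    then show "F ((z + w) # zs) = F (z # zs) + F (w # zs)"
      by (simp only: f(1) recombine.simps recombine_add)
    have "insert_argument (sL a z) f = (\<lambda>\<xi>s xs. a * insert_argument z f \<xi>s xs)"
      by (simp add: fun_eq_iff insert_argument_def simps scale_prod_def split_beta distrib_left sg_mult_right)
    then show "F (sL a z # zs) = a * F (z # zs)"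
      by (simp only: f(1) recombine.simps recombine_scale)
    \<comment> \<open>The mixed terms cancel: the \<open>Q\<close>-component of \<open>z\<close> is
      counted in the sign of one of them and not in that of the other.\<close>
    have "insert_argument z (insert_argument z f) \<xi>s xs = 0" for \<xi>s xs
      by (simp add: insert_argument_def simps)
    then show "F (z # z # zs) = 0" by (simp add: f(1) recombine_eq_zero)
  qed
  moreover obtain N where N: "\<forall>\<xi>s xs. N \<le> length \<xi>s + length xs \<longrightarrow> f \<xi>s xs = 0"
    using assms by (auto simp: Alt2_iff)
  have "vanishes_from N (recombine f)"
    unfolding vanishes_from_def using N by (auto intro: recombine_eq_zero)
  ultimately show ?thesis by (auto simp: Alt_iff)
qed

lemma uncombine_recombine:
  assumes "f \<in> Alt2 sH sQ"
  shows "uncombine (recombine f) = f"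
proof -
  have f: "alternating2 f" using assms by (simp add: Alt2_iff)
  have H: "recombine f (map (\<lambda>x. (0, x)) xs) = f [] xs" if "alternating2 f" for f xs
    using that
  proof (induction xs arbitrary: f)
    case (Cons x xs)
    then show ?case
      using Cons.IH[OF alternating2_insert_argument[OF Cons.prems, of "(0, x)"]]
      by (simp add: insert_argument_def alternating2_simps[OF Cons.prems])
  qed simp
  have "recombine f (map (\<lambda>\<xi>. (\<xi>, 0)) \<xi>s @ map (\<lambda>x. (0, x)) xs) = f \<xi>s xs" if "alternating2 f" for f \<xi>s xs
    using that
  proof (induction \<xi>s arbitrary: f)
    case (Cons \<xi> \<xi>s)
    then show ?case
      using Cons.IH[OF alternating2_insert_argument[OF Cons.prems, of "(\<xi>, 0)"]]
      by (simp add: insert_argument_def alternating2_simps[OF Cons.prems])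
  qed (simp add: H)
  with f show ?thesis by (simp add: fun_eq_iff uncombine_apply)
qed

lemma recombine_uncombine:
  assumes "alternating_multilinear sL (*) F"
  shows "recombine (uncombine F) = F"
proof
  show "recombine (uncombine F) zs = F zs" for zs
    using assms
  proof (induction zs arbitrary: F)
    case Nil
    then show ?case by (simp add: uncombine_apply)
  next
    case (Cons z zs)
    \<comment> \<open>\<open>uncombine\<close> intertwines contraction with
      \<open>insert_argument\<close>; the sign is that of \<open>alternating_move\<close>.\<close>
    have "insert_argument z (uncombine F) = uncombine (contract z F)"
    proof (intro ext)
      fix \<xi>s :: "'q list" and xs :: "'h list"
      let ?us = "map (\<lambda>\<xi>. (\<xi>, 0 :: 'h)) \<xi>s" and ?vs = "map (\<lambda>x. (0 :: 'q, x)) xs"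
      have "F (?us @ (0, snd z) # ?vs) = sg (length \<xi>s) (F ((0, snd z) # ?us @ ?vs))"
        using alternating_move[OF Cons.prems, of ?us] by simp
      moreover have "F (z # ?us @ ?vs) = F ((fst z, 0) # ?us @ ?vs) + F ((0, snd z) # ?us @ ?vs)"
        using alternating_Cons_add[OF Cons.prems, of "(fst z, 0)" "(0, snd z)"] by simp
      ultimately show "insert_argument z (uncombine F) \<xi>s xs = uncombine (contract z F) \<xi>s xs"
        by (simp add: insert_argument_def uncombine_apply contract_apply)
    qed
    then have "recombine (uncombine F) (z # zs) = recombine (uncombine (contract z F)) zs"
      by (simp only: recombine.simps)
    also have "\<dots> = contract z F zs" by (rule Cons.IH[OF alternating_contract[OF Cons.prems]])
    also have "\<dots> = F (z # zs)" by (rule contract_apply)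
    finally show ?case .
  qed
qed

lemma bij_betw_uncombine: "bij_betw uncombine (Alt sL) (Alt2 sH sQ)"
proof (rule bij_betw_byWitness[where f' = recombine])
  show "\<forall>F\<in>Alt sL. recombine (uncombine F) = F" using recombine_uncombine by (auto simp: Alt_iff)
  show "\<forall>f\<in>Alt2 sH sQ. uncombine (recombine f) = f" using uncombine_recombine by blast
  show "uncombine ` Alt sL \<subseteq> Alt2 sH sQ" using uncombine_in_Alt2 by blast
  show "recombine ` Alt2 sH sQ \<subseteq> Alt sL" using recombine_in_Alt by blast
qed

lemma Alt2_obtain_uncombine:
  assumes "f \<in> Alt2 sH sQ"
  obtains F where "F \<in> Alt sL" "f = uncombine F"
  using assms recombine_in_Alt uncombine_recombine by metis

lemma uncombine_inject: "F \<in> Alt sL \<Longrightarrow> G \<in> Alt sL \<Longrightarrow> uncombine F = uncombine G \<Longrightarrow> F = G"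
  using bij_betw_uncombine by (auto simp: bij_betw_def inj_on_def)

lemma Alt2_mult_uncombine:
  assumes "F \<in> Alt sL" "G \<in> Alt sL"
  shows "Alt2_mult sH sQ (uncombine F) (uncombine G) = uncombine (koszul F G)"
proof -
  have "combine sH sQ (uncombine F) = F" if "F \<in> Alt sL" for F
    unfolding combine_def using bij_betw_uncombine that by (simp add: bij_betw_def the_inv_into_f_f)
  with assms show ?thesis by (simp add: Alt2_mult_def ek_prod_eq_koszul)
qed

lemma uncombine_add: "uncombine (F + G) = uncombine F + uncombine G"
  by (simp add: fun_eq_iff uncombine_apply)

lemma Alt2_add: "f \<in> Alt2 sH sQ \<Longrightarrow> g \<in> Alt2 sH sQ \<Longrightarrow> f + g \<in> Alt2 sH sQ"
  by (metis Alt2_obtain_uncombine Alt_add uncombine_add uncombine_in_Alt2)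

lemma Alt2_zero: "0 \<in> Alt2 sH sQ"
proof -
  have "uncombine 0 = (0 :: ('a, 'h, 'q) form)" by (simp add: fun_eq_iff uncombine_apply)
  with uncombine_in_Alt2[OF Alt_zero] show ?thesis by (simp only:)
qed

definition component :: "nat \<times> nat \<Rightarrow> ('a, 'h, 'q) form \<Rightarrow> ('a, 'h, 'q) form" where
  "component i f = (\<lambda>\<xi>s xs. if length \<xi>s = fst i \<and> length xs = snd i then f \<xi>s xs else 0)"

lemma component_in_Alt2_comp:
  assumes "f \<in> Alt2 sH sQ"
  shows "component (p, q) f \<in> Alt2_comp sH sQ (int p) (int q)"
proof -
  have f: "alternating2 f" using assms by (simp add: Alt2_iff)
  have "alternating2 (component (p, q) f)"
  proof -
    have o: "alternating_multilinear sQ (\<lambda>a g xs. a * g xs) f"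
      and i: "alternating_multilinear sH (*) (f \<xi>s)" for \<xi>s
      using f by (auto simp: alternating2_def)
    have eq: "component (p, q) f =
        (\<lambda>\<xi>s. if length \<xi>s = p then (\<lambda>xs. if length xs = q then f \<xi>s xs else 0) else 0)"
      by (simp add: fun_eq_iff component_def)
    have "alternating_multilinear sQ (\<lambda>a g xs. a * g xs) (component (p, q) f)"
      unfolding eq by (intro alternating_guard alternating_compose[OF o]) (auto simp: fun_eq_iff)
    moreover have "component (p, q) f \<xi>s =
        (if length \<xi>s = p then \<lambda>xs. if length xs = q then f \<xi>s xs else 0 else 0)" for \<xi>s
      unfolding eq ..
    moreover have "alternating_multilinear sH (*) (if length \<xi>s = p then \<lambda>xs. if length xs = q then f \<xi>s xs else 0 else 0)" for \<xi>s
      using alternating_guard[OF i[of \<xi>s], of q] alternating_zero[of "(*)" sH] by (cases "length \<xi>s = p") simp_all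
    ultimately show ?thesis unfolding alternating2_def by (simp only: simp_thms)
  qed
  moreover have "\<forall>\<xi>s xs. Suc (p + q) \<le> length \<xi>s + length xs \<longrightarrow> component (p, q) f \<xi>s xs = 0"
    by (auto simp: component_def)
  ultimately show ?thesis by (auto simp: Alt2_comp_def Alt2_iff) (auto simp: component_def split: if_splits)
qed

text \<open>A form is the finite sum of its components below its degree bound. Bidegree conditions
  can be exploited on such components only.\<close>

lemma Alt2_induct [consumes 1, case_names zero add component]:
  assumes "f \<in> Alt2 sH sQ"
    and zero: "P 0"
    and add: "\<And>f g. f \<in> Alt2 sH sQ \<Longrightarrow> g \<in> Alt2 sH sQ \<Longrightarrow> P f \<Longrightarrow> P g \<Longrightarrow> P (f + g)"
    and component: "\<And>p q f. f \<in> Alt2_comp sH sQ (int p) (int q) \<Longrightarrow> P f"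
  shows "P f"
proof -
  obtain N where N: "\<And>\<xi>s xs. N \<le> length \<xi>s + length xs \<Longrightarrow> f \<xi>s xs = 0"
    using assms(1) by (auto simp: Alt2_iff)
  have comp: "component i f \<in> Alt2 sH sQ \<and> P (component i f)" for i
    using component_in_Alt2_comp[OF assms(1), of "fst i" "snd i"] component by (auto simp: Alt2_comp_def)
  have "(\<Sum>i\<in>I. component i f) \<in> Alt2 sH sQ \<and> P (\<Sum>i\<in>I. component i f)" if "finite I" for I
    using that
  proof (induction I rule: finite_induct)
    case empty
    then show ?case using Alt2_zero zero by (simp only: sum.empty)
  next
    case (insert i I)
    then show ?case using comp[of i] add Alt2_add unfolding sum.insert[OF insert.hyps] by blast
  qed
  moreover have "(\<Sum>i\<in>{..N} \<times> {..N}. component i f) = f"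
  proof (intro ext)
    fix \<xi>s xs
    have "(\<Sum>i\<in>{..N} \<times> {..N}. component i f) \<xi>s xs =
        (\<Sum>i\<in>{..N} \<times> {..N}. if i = (length \<xi>s, length xs) then f \<xi>s xs else 0)"
      unfolding sum_fun_apply by (rule sum.cong) (auto simp: component_def)
    also have "\<dots> = f \<xi>s xs" using N[of \<xi>s xs] by (subst sum.delta) auto
    finally show "(\<Sum>i\<in>{..N} \<times> {..N}. component i f) \<xi>s xs = f \<xi>s xs" .
  qed
  ultimately show ?thesis by (metis finite_SigmaI finite_atMost)
qed

end


section \<open>The operators of a triple\<close>

lemma nths_Cons_Compl:
  "nths (z # zs) (- {0}) = zs"
  "nths (z # zs) (- {Suc j}) = z # nths zs (- {j})"
  "nths (z # zs) (- {0, Suc k}) = nths zs (- {k})"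
  "nths (z # zs) (- {Suc j, Suc k}) = z # nths zs (- {j, k})"
proof -
  have "{i. Suc i \<in> - {0}} = UNIV" "{i. Suc i \<in> - {Suc j}} = - {j}" "{i. Suc i \<in> - {0, Suc k}} = - {k}"
    "{i. Suc i \<in> - {Suc j, Suc k}} = - {j, k}"
    by auto
  then show "nths (z # zs) (- {0}) = zs" "nths (z # zs) (- {Suc j}) = z # nths zs (- {j})"
    "nths (z # zs) (- {0, Suc k}) = nths zs (- {k})"
    "nths (z # zs) (- {Suc j, Suc k}) = z # nths zs (- {j, k})"
    by (simp_all add: nths_Cons nths_all)
qed

lemma length_nths_Compl1:
  assumes "j < length zs"
  shows "Suc (length (nths zs (- {j}))) = length zs"
proof -
  have "{l. l < length zs \<and> l \<in> - {j}} = {..<length zs} - {j}" by auto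
  then show ?thesis using assms by (simp add: length_nths)
qed

lemma length_nths_Compl2:
  assumes "j < k" "k < length zs"
  shows "Suc (Suc (length (nths zs (- {j, k})))) = length zs"
proof -
  have "{l. l < length zs \<and> l \<in> - {j, k}} = {..<length zs} - {j, k}" by auto
  moreover have "{j, k} \<subseteq> {..<length zs}" "card {j, k} = 2" using assms by auto
  ultimately show ?thesis
    using assms card_mono[of "{..<length zs}" "{j, k}"] by (simp add: length_nths card_Diff_subset)
qed

context almost_lie_rinehart
begin

lemma lie_explicit:
  assumes "alternating_multilinear s (*) F"
  shows "lie z F zs = act z (F zs) - (\<Sum>k<length zs. sg k (F (br z (zs ! k) # nths zs (- {k}))))"
  using assms
proof (induction zs arbitrary: F)
  case (Cons w ws)
  have swap: "F (w # x # us) = - F (x # w # us)" for x us by (rule alternating_swap[OF Cons.prems])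
  have "lie z F (w # ws) = act z (F (w # ws)) -
      (\<Sum>k<length ws. sg k (F (w # br z (ws ! k) # nths ws (- {k})))) - F (br z w # ws)"
    unfolding lie_derivative.simps Cons.IH[OF alternating_contract[OF Cons.prems]]
    by (simp only: contract_apply)
  also have "\<dots> = act z (F (w # ws)) -
      (\<Sum>k<length (w # ws). sg k (F (br z ((w # ws) ! k) # nths (w # ws) (- {k}))))"
    unfolding list.size add_Suc_right add_0_right sum.lessThan_Suc_shift
    by (simp add: nths_Cons_Compl swap sum_negf)
  finally show ?case .
qed simp

text \<open>Of the usual sums, the terms in which the first argument acts or is bracketed come from
  \<open>lie_explicit\<close>; the others come from the contraction, with indices shifted by
  1.\<close>

lemma ced_explicit:
  assumes "alternating_multilinear s (*) F"
  shows "ced F zs = sg (length zs)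
    ((\<Sum>j<length zs. sg j (act (zs ! j) (F (nths zs (- {j}))))) +
     (\<Sum>k<length zs. \<Sum>j<k. sg (j + k) (F (br (zs ! j) (zs ! k) # nths zs (- {j, k})))))"
  using assms
proof (induction zs arbitrary: F)
  case (Cons z zs)
  let ?n = "length zs"
  have swap: "F (z # x # us) = - F (x # z # us)" for x us by (rule alternating_swap[OF Cons.prems])
  have "ced F (z # zs) = sg ?n
      ((\<Sum>j<?n. sg j (act (zs ! j) (F (z # nths zs (- {j}))))) +
       (\<Sum>k<?n. \<Sum>j<k. sg (j + k) (F (z # br (zs ! j) (zs ! k) # nths zs (- {j, k}))))) -
      sg ?n (act z (F zs) - (\<Sum>k<?n. sg k (F (br z (zs ! k) # nths zs (- {k})))))"
    unfolding ce_differential.simps Cons.IH[OF alternating_contract[OF Cons.prems]]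
      lie_explicit[OF Cons.prems]
    by (simp only: contract_apply)
  also have "\<dots> = sg (Suc ?n)
    ((\<Sum>j<Suc ?n. sg j (act ((z # zs) ! j) (F (nths (z # zs) (- {j}))))) +
     (\<Sum>k<Suc ?n. \<Sum>j<k. sg (j + k) (F (br ((z # zs) ! j) ((z # zs) ! k) # nths (z # zs) (- {j, k})))))"
    unfolding sum.lessThan_Suc_shift
    by (simp add: nths_Cons_Compl swap sum_negf sum.distrib sum_subtractf)
  finally show ?case by simp
qed simp

lemma act_scaleR_one: "act x (sR r 1) = 0"
  using act_mult[of x 1 1] by (simp add: act_scaleR sR_additive)

text \<open>\<open>R\<close> acts through the elements \<open>sR r 1\<close>, on which derivations
  vanish, so the Leibniz rule loses its derivative term.\<close>

lemma br_scaleR: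
  "br x (restrict_scalars sR s r y) = restrict_scalars sR s r (br x y)"
  "br (restrict_scalars sR s r x) y = restrict_scalars sR s r (br x y)"
proof -
  have "s 0 y = 0" for y using scale_left_distrib[of 0 0 y] by simp
  then show "br x (restrict_scalars sR s r y) = restrict_scalars sR s r (br x y)"
    "br (restrict_scalars sR s r x) y = restrict_scalars sR s r (br x y)"
    by (simp_all add: restrict_scalars_def br_scale br_scale_left act_scaleR_one)
qed

lemma act_restrict_scalars: "act (restrict_scalars sR s r x) a = sR r (act x a)"
  using scale_mult[of r 1 "act x a"] by (simp add: restrict_scalars_def act_scale)

end

text \<open>The swap moves the total bracket to \<open>'q \<times> 'h\<close>, the order used by
  \<open>uncombine\<close>.\<close>

definition triple_bracket ::
  "('a, 'h::ab_group_add, 'q::ab_group_add) triple \<Rightarrow> 'q \<times> 'h \<Rightarrow> 'q \<times> 'h \<Rightarrow> 'q \<times> 'h" where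
  "triple_bracket T z w = prod.swap (total_bracket T (prod.swap z) (prod.swap w))"

definition triple_action :: "('a::plus, 'h, 'q) triple \<Rightarrow> 'q \<times> 'h \<Rightarrow> 'a \<Rightarrow> 'a" where
  "triple_action T z = total_action T (prod.swap z)"

lemma triple_bracket_Pair:
  "triple_bracket T (\<xi>, x) (\<eta>, y) =
     (brQ T \<xi> \<eta> + dotHQ T x \<eta> - dotHQ T y \<xi>, brH T x y + delta T \<xi> \<eta> - dotQH T \<eta> x + dotQH T \<xi> y)"
  by (simp add: triple_bracket_def total_bracket_def)

lemma triple_action_Pair: "triple_action T (\<xi>, x) a = actH T x a + actQ T \<xi> a"
  by (simp add: triple_action_def total_action_def)

lemma bilinear_overD:
  assumes "bilinear_over s1 s2 s3 b"
  shows "b (x + x') y = b x y + b x' y" "b x (y + y') = b x y + b x y'"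
    "b (s1 c x) y = s3 c (b x y)" "b x (s2 c y) = s3 c (b x y)" "b 0 y = 0" "b x 0 = 0"
proof -
  show add: "b (x + x') y = b x y + b x' y" "b x (y + y') = b x y + b x y'" for x x' y y'
    using assms by (auto simp: bilinear_over_def)
  show "b (s1 c x) y = s3 c (b x y)" "b x (s2 c y) = s3 c (b x y)"
    using assms by (auto simp: bilinear_over_def)
  show "b 0 y = 0" "b x 0 = 0"
    using additive_zero[of "\<lambda>x. b x y"] additive_zero[of "b x"] add by blast+
qed

context almost_pre_lie_rinehart_triple
begin

sublocale two_modules sH sQ ..

lemmas brH_simps = bilinear_overD[OF brH_bilinear]
lemmas brQ_simps = bilinear_overD[OF brQ_bilinear]
lemmas actH_simps = bilinear_overD[OF actH_bilinear]
lemmas actQ_simps = bilinear_overD[OF actQ_bilinear]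
lemmas dotHQ_simps = bilinear_overD[OF dotHQ_bilinear]
lemmas dotQH_simps = bilinear_overD[OF dotQH_bilinear]
lemmas delta_simps = bilinear_overD[OF delta_bilinear]

lemmas zero_simps [simp] =
  brH_simps(5,6) brQ_simps(5,6) actH_simps(5,6) actQ_simps(5,6) dotHQ_simps(5,6) dotQH_simps(5,6)
  delta_simps(5,6)

lemma almost_lie_rinehart_total: "almost_lie_rinehart sR sL (triple_bracket T) (triple_action T)"
proof -
  interpret L: module_over sL
    by (rule module_over_scale_prod) (rule Q.module_over_axioms H.module_over_axioms)+
  have dist: "sH a (x - y) = sH a x - sH a y" "sQ a (\<xi> - \<eta>) = sQ a \<xi> - sQ a \<eta>" for a x y \<xi> \<eta>
    by (rule additive_diff, rule H.scale_right_distrib) (rule additive_diff, rule Q.scale_right_distrib)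
  show ?thesis
  proof
    fix z w v :: "'q \<times> 'h" and a b
    show "triple_bracket T (z + w) v = triple_bracket T z v + triple_bracket T w v"
      by (cases z; cases w; cases v) (simp add: triple_bracket_Pair brH_simps(1) brQ_simps(1)
        dotHQ_simps(1,2) dotQH_simps(1,2) delta_simps(1))
    show "triple_bracket T z (w + v) = triple_bracket T z w + triple_bracket T z v"
      by (cases z; cases w; cases v) (simp add: triple_bracket_Pair brH_simps(2) brQ_simps(2)
        dotHQ_simps(1,2) dotQH_simps(1,2) delta_simps(2))
    show "triple_bracket T z z = 0"
      by (cases z) (simp add: triple_bracket_Pair brH_self brQ_self delta_self zero_prod_def)
    show "triple_action T (z + w) a = triple_action T z a + triple_action T w a"
      by (cases z; cases w) (simp add: triple_action_Pair actH_simps(1) actQ_simps(1))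
    show "is_derivation sR (triple_action T z)"
      using actH_derivation[of "snd z"] actQ_derivation[of "fst z"]
      by (cases z) (simp add: is_derivation_def triple_action_Pair scale_right_distrib algebra_simps)
    show "triple_action T (sL a z) b = a * triple_action T z b"
      by (cases z) (simp add: scale_prod_def triple_action_Pair actH_scale actQ_scale distrib_left)
    show "triple_bracket T z (sL a w) = sL (triple_action T z a) w + sL a (triple_bracket T z w)"
      using bilinear_overD(4)[OF delta_bilinear]
      by (cases z; cases w) (simp add: scale_prod_def triple_bracket_Pair triple_action_Pair brH_scale brQ_scale
        dotHQ_scale_left dotHQ_scale_right dotQH_scale_left dotQH_scale_right dist
        H.scale_left_distrib H.scale_right_distrib Q.scale_left_distrib Q.scale_right_distrib)
  qed
qed

sublocale L: almost_lie_rinehart sR sL "triple_bracket T" "triple_action T"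
  by (rule almost_lie_rinehart_total)

text \<open>For arguments from \<open>Q\<close> followed by arguments from \<open>H\<close>, the
  index ranges in \<open>ced_explicit\<close> are split at \<open>length \<xi>s\<close>. The actions
  (\<open>A1\<close>, \<open>A2\<close>) and the brackets within \<open>Q\<close>
  (\<open>B1\<close>), between \<open>Q\<close> and \<open>H\<close> (\<open>B2\<close>) and within
  \<open>H\<close> (\<open>B3\<close>) give all terms of the three operators.\<close>

lemma op_sum_uncombine:
  assumes F: "alternating_multilinear sL (*) F"
  shows "uncombine (L.ced F) \<xi>s xs =
    op0 T (uncombine F) \<xi>s xs + op1 T (uncombine F) \<xi>s xs + op2 T (uncombine F) \<xi>s xs"
proof -
  define i where "i = (\<lambda>\<xi>. (\<xi>, 0) :: 'q \<times> 'h)"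
  define h where "h = (\<lambda>x. (0, x) :: 'q \<times> 'h)"
  let ?p = "length \<xi>s" and ?q = "length xs"
  let ?zs = "map i \<xi>s @ map h xs"
  have U: "F (map i \<eta>s @ map h ys) = uncombine F \<eta>s ys" for \<eta>s ys
    by (simp add: uncombine_apply i_def h_def)
  have UQ: "F (i \<eta> # map i \<eta>s @ map h ys) = uncombine F (\<eta> # \<eta>s) ys" for \<eta> \<eta>s ys
    by (simp add: uncombine_apply i_def h_def)
  have UH: "F (h y # map i \<eta>s @ map h ys) = sg (length \<eta>s) (uncombine F \<eta>s (y # ys))" for y \<eta>s ys
    using alternating_move[OF F, of "map i \<eta>s" "h y" "map h ys"] by (simp add: uncombine_apply i_def h_def)
  have add: "F ((x + y) # zs) = F (x # zs) + F (y # zs)" for x y zs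
    by (rule alternating_Cons_add[OF F])
  have U0: "uncombine F (- \<eta> # \<eta>s) ys = - uncombine F (\<eta> # \<eta>s) ys" for \<eta> \<eta>s ys
    using alternating2_simps(1)[OF alternating2_uncombine[OF F]]
    by (rule additive_minus[of "\<lambda>\<eta>. uncombine F (\<eta> # \<eta>s) ys"])
  have nthQ: "?zs ! j = i (\<xi>s ! j)" if "j < ?p" for j using that by (simp add: nth_append)
  have nthH: "?zs ! (?p + k) = h (xs ! k)" if "k < ?q" for k using that by (simp add: nth_append)
  have nths: "nths ?zs A = map i (nths \<xi>s A) @ map h (nths xs {j. j + ?p \<in> A})" for A
    by (simp add: nths_append nths_map)
  have nQ: "nths ?zs (- {j}) = map i (nths \<xi>s (- {j})) @ map h xs" if "j < ?p" for j
    unfolding nths using that by (simp add: nths_all)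
  have nH: "nths ?zs (- {?p + k}) = map i \<xi>s @ map h (nths xs (- {k}))" for k
  proof -
    have "{j. j + ?p \<in> - {?p + k}} = - {k}" by auto
    then show ?thesis unfolding nths by (simp add: nths_all)
  qed
  have nQQ: "nths ?zs (- {j, k}) = map i (nths \<xi>s (- {j, k})) @ map h xs" if "j < ?p" "k < ?p" for j k
    unfolding nths using that by (simp add: nths_all)
  have nQH: "nths ?zs (- {j, ?p + k}) = map i (nths \<xi>s (- {j})) @ map h (nths xs (- {k}))" if "j < ?p" for j k
  proof -
    have "{j'. j' + ?p \<in> - {j, ?p + k}} = - {k}" using that by auto
    moreover have "nths \<xi>s (- {j, ?p + k}) = nths \<xi>s (- {j})"
      unfolding nths_def by (rule arg_cong[where f = "map fst"], rule filter_cong) (auto simp: set_zip)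
    ultimately show ?thesis unfolding nths by simp
  qed
  have nHH: "nths ?zs (- {?p + j, ?p + k}) = map i \<xi>s @ map h (nths xs (- {j, k}))" for j k
  proof -
    have "{j'. j' + ?p \<in> - {?p + j, ?p + k}} = - {j, k}" by auto
    then show ?thesis unfolding nths by (simp add: nths_all)
  qed
  \<comment> \<open>A bracket component in \<open>H\<close> stands in front and has to pass those of
    the \<open>p\<close> arguments from \<open>Q\<close> that were not removed: \<open>p - 1\<close>
    in \<open>B2\<close>, \<open>p - 2\<close> in \<open>B1\<close>.\<close>
  have len1: "sg (length (nths \<xi>s (- {j}))) a = - sg ?p a" if "j < ?p" for j and a :: 'a
    using length_nths_Compl1[OF that] by (metis sg_simps(3) minus_minus)
  have len2: "sg (length (nths \<xi>s (- {j, k}))) a = sg ?p a" if "j < k" "k < ?p" for j k and a :: 'a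
    using length_nths_Compl2[OF that] by (metis sg_simps(3) minus_minus)
  let ?f = "uncombine F"
  let ?A = "\<lambda>j. sg j (triple_action T (?zs ! j) (F (nths ?zs (- {j}))))"
  let ?B = "\<lambda>j k. sg (j + k) (F (triple_bracket T (?zs ! j) (?zs ! k) # nths ?zs (- {j, k})))"
  have A1: "(\<Sum>j<?p. ?A j) = (\<Sum>j<?p. sg j (actQ T (\<xi>s ! j) (?f (nths \<xi>s (- {j})) xs)))"
    by (rule sum.cong) (auto simp: nthQ nQ U, simp add: i_def triple_action_Pair)
  have A2: "(\<Sum>k<?q. ?A (?p + k)) = (\<Sum>k<?q. sg (?p + k) (actH T (xs ! k) (?f \<xi>s (nths xs (- {k})))))"
    by (rule sum.cong) (auto simp: nthH nH U, simp add: h_def triple_action_Pair)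
  have B1: "(\<Sum>k<?p. \<Sum>j<k. ?B j k) =
      (\<Sum>k<?p. \<Sum>j<k. sg (j + k) (?f (brQ T (\<xi>s ! j) (\<xi>s ! k) # nths \<xi>s (- {j, k})) xs)) +
      (\<Sum>k<?p. \<Sum>j<k. sg (j + k + ?p) (?f (nths \<xi>s (- {j, k})) (delta T (\<xi>s ! j) (\<xi>s ! k) # xs)))"
    unfolding sum.distrib[symmetric]
  proof (intro sum.cong refl)
    fix k j assume k: "k \<in> {..<?p}" "j \<in> {..<k}"
    then have "triple_bracket T (?zs ! j) (?zs ! k) = i (brQ T (\<xi>s ! j) (\<xi>s ! k)) + h (delta T (\<xi>s ! j) (\<xi>s ! k))"
      by (simp add: nthQ) (simp add: i_def h_def triple_bracket_Pair)
    then show "?B j k = sg (j + k) (?f (brQ T (\<xi>s ! j) (\<xi>s ! k) # nths \<xi>s (- {j, k})) xs) +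
        sg (j + k + ?p) (?f (nths \<xi>s (- {j, k})) (delta T (\<xi>s ! j) (\<xi>s ! k) # xs))"
      using k by (simp add: nQQ add UQ UH len2 sg_sg)
  qed
  have B2: "(\<Sum>k<?q. \<Sum>j<?p. ?B j (?p + k)) =
      (\<Sum>j<?p. \<Sum>k<?q. sg (j + k + ?p + 1) (?f (dotHQ T (xs ! k) (\<xi>s ! j) # nths \<xi>s (- {j})) (nths xs (- {k})))) +
      (\<Sum>j<?p. \<Sum>k<?q. sg (j + k + 1) (?f (nths \<xi>s (- {j})) (dotQH T (\<xi>s ! j) (xs ! k) # nths xs (- {k}))))"
    unfolding sum.distrib[symmetric] sum.swap[of _ "{..<?q}" "{..<?p}"]
  proof (intro sum.cong refl)
    fix k j assume k: "j \<in> {..<?p}" "k \<in> {..<?q}"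
    then have "triple_bracket T (?zs ! j) (?zs ! (?p + k)) = i (- dotHQ T (xs ! k) (\<xi>s ! j)) + h (dotQH T (\<xi>s ! j) (xs ! k))"
      by (simp add: nthQ nthH) (simp add: i_def h_def triple_bracket_Pair)
    then show "?B j (?p + k) =
        sg (j + k + ?p + 1) (?f (dotHQ T (xs ! k) (\<xi>s ! j) # nths \<xi>s (- {j})) (nths xs (- {k}))) +
        sg (j + k + 1) (?f (nths \<xi>s (- {j})) (dotQH T (\<xi>s ! j) (xs ! k) # nths xs (- {k})))"
      using k by (simp add: nQH add UQ UH U0 len1 sg_sg) (auto simp: sg_def)
  qed
  have B3: "(\<Sum>k<?q. \<Sum>j<k. ?B (?p + j) (?p + k)) =
      (\<Sum>k<?q. \<Sum>j<k. sg (?p + j + k) (?f \<xi>s (brH T (xs ! j) (xs ! k) # nths xs (- {j, k}))))"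
  proof (intro sum.cong refl)
    fix k j assume k: "k \<in> {..<?q}" "j \<in> {..<k}"
    then have "triple_bracket T (?zs ! (?p + j)) (?zs ! (?p + k)) = h (brH T (xs ! j) (xs ! k))"
      by (simp add: nthH) (simp add: i_def h_def triple_bracket_Pair)
    then show "?B (?p + j) (?p + k) = sg (?p + j + k) (?f \<xi>s (brH T (xs ! j) (xs ! k) # nths xs (- {j, k})))"
      using k by (simp add: nHH UH sg_sg) (auto simp: sg_def)
  qed
  have "uncombine (L.ced F) \<xi>s xs = L.ced F ?zs" by (simp add: uncombine_apply i_def h_def)
  also have "\<dots> = sg (?p + ?q) ((\<Sum>j<?p. ?A j) + (\<Sum>k<?q. ?A (?p + k)) +
      ((\<Sum>k<?p. \<Sum>j<k. ?B j k) + ((\<Sum>k<?q. \<Sum>j<?p. ?B j (?p + k)) + (\<Sum>k<?q. \<Sum>j<k. ?B (?p + j) (?p + k)))))"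
    unfolding L.ced_explicit[OF F] length_append length_map sum_lessThan_add sum.distrib ..
  finally show ?thesis
    unfolding A1 A2 B1 B2 B3 op0_def op1_def op2_def neg_one_power_mult
    by (simp only: sg_simps(4) ac_simps)
qed

end

definition op_sum ::
  "('a::{comm_ring, comm_monoid_mult}, 'h, 'q) triple \<Rightarrow> ('a, 'h, 'q) form \<Rightarrow> ('a, 'h, 'q) form" where
  "op_sum T f = op0 T f + op1 T f + op2 T f"

context almost_pre_lie_rinehart_triple
begin

lemma op_sum_eq:
  assumes "F \<in> Alt sL"
  shows "op_sum T (uncombine F) = uncombine (L.ced F)"
proof (intro ext)
  have F: "alternating_multilinear sL (*) F" using assms by (simp add: Alt_iff)
  show "op_sum T (uncombine F) \<xi>s xs = uncombine (L.ced F) \<xi>s xs" for \<xi>s xs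
    unfolding op_sum_def plus_fun_apply op_sum_uncombine[OF F] ..
qed

text \<open>The value of \<open>recombine\<close> on a list depends only on components of total
  degree equal to its length, so \<open>F\<close> is homogeneous of degree
  \<open>p + q\<close>.\<close>

lemma twist_if_homogeneous:
  assumes "F \<in> Alt sL" "uncombine F \<in> Alt2_comp sH sQ (int p) (int q)"
  shows "twist F = (\<lambda>zs. sg (p + q) (F zs))"
proof
  fix zs
  have "F = recombine (uncombine F)" using assms(1) recombine_uncombine[of F] by (simp only: Alt_iff)
  moreover have "recombine (uncombine F) zs = 0" if "length zs \<noteq> p + q"
  proof (rule recombine_eq_zero)
    fix \<xi>s xs assume "length (\<xi>s :: 'q list) + length (xs :: 'h list) = length zs"
    then have "\<not> (int (length \<xi>s) = int p \<and> int (length xs) = int q)" using that by linarith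
    then show "uncombine F \<xi>s xs = 0" using assms(2) unfolding Alt2_comp_def by blast
  qed
  ultimately have "F zs = 0" if "length zs \<noteq> p + q" using that by metis
  then show "twist F zs = sg (p + q) (F zs)" by (cases "length zs = p + q") (simp_all add: twist_apply)
qed

lemma op_sum_in_Alt2: "f \<in> Alt2 sH sQ \<Longrightarrow> op_sum T f \<in> Alt2 sH sQ"
  by (metis Alt2_obtain_uncombine op_sum_eq uncombine_in_Alt2 L.Alt_ced)

text \<open>The rules for \<open>ced\<close> transported along \<open>uncombine\<close>; in the
  product rule, \<open>twist_if_homogeneous\<close> supplies the degree sign.\<close>

lemma derivation_op_sum: "Alt2_derivation sR sH sQ (restrict (op_sum T) (Alt2 sH sQ))"
  unfolding Alt2_derivation_def
proof (intro conjI ballI allI)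
  show "restrict (op_sum T) (Alt2 sH sQ) \<in> Alt2 sH sQ \<rightarrow>\<^sub>E Alt2 sH sQ"
    using op_sum_in_Alt2 by auto
next
  fix f g assume fg: "f \<in> Alt2 sH sQ" "g \<in> Alt2 sH sQ"
  obtain F G where F: "F \<in> Alt sL" "f = uncombine F" and G: "G \<in> Alt sL" "g = uncombine G"
    using fg by (meson Alt2_obtain_uncombine)
  have "op_sum T (f + g) = op_sum T f + op_sum T g"
    by (simp only: F G uncombine_add[symmetric] op_sum_eq Alt_add L.ced_add)
  then show "restrict (op_sum T) (Alt2 sH sQ) (f + g) =
      restrict (op_sum T) (Alt2 sH sQ) f + restrict (op_sum T) (Alt2 sH sQ) g"
    by (simp only: restrict_apply fg Alt2_add if_True)
next
  fix r f assume f: "f \<in> Alt2 sH sQ"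
  obtain F where F: "F \<in> Alt sL" "f = uncombine F" using f by (meson Alt2_obtain_uncombine)
  have eq: "(\<lambda>\<xi>s xs. sR r (f \<xi>s xs)) = uncombine (\<lambda>zs. sR r (F zs))"
    by (simp add: fun_eq_iff F(2) uncombine_apply)
  have "op_sum T (\<lambda>\<xi>s xs. sR r (f \<xi>s xs)) = (\<lambda>\<xi>s xs. sR r (op_sum T f \<xi>s xs))"
    unfolding eq op_sum_eq[OF Alt_scaleR[OF F(1)]] unfolding F(2) op_sum_eq[OF F(1)]
    by (simp add: fun_eq_iff uncombine_apply L.ced_scaleR)
  moreover have "(\<lambda>\<xi>s xs. sR r (f \<xi>s xs)) \<in> Alt2 sH sQ"
    unfolding eq by (rule uncombine_in_Alt2[OF Alt_scaleR[OF F(1)]])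
  ultimately show "restrict (op_sum T) (Alt2 sH sQ) (\<lambda>\<xi>s xs. sR r (f \<xi>s xs)) =
      (\<lambda>\<xi>s xs. sR r (restrict (op_sum T) (Alt2 sH sQ) f \<xi>s xs))"
    by (simp only: restrict_apply f if_True)
next
  fix p q f g assume fg: "f \<in> Alt2_comp sH sQ (int p) (int q)" "g \<in> Alt2 sH sQ"
  then have f: "f \<in> Alt2 sH sQ" by (simp add: Alt2_comp_def)
  obtain F G where F: "F \<in> Alt sL" "f = uncombine F" and G: "G \<in> Alt sL" "g = uncombine G"
    using f fg(2) by (meson Alt2_obtain_uncombine)
  have tw: "twist F = (\<lambda>zs. sg (p + q) (F zs))"
    using twist_if_homogeneous[OF F(1)] fg(1) F(2) by blast
  have "koszul (twist F) (L.ced G) = (\<lambda>zs. sg (p + q) (koszul F (L.ced G) zs))"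
  proof (cases "even (p + q)")
    case True
    then have "twist F = F" by (simp add: tw sg_def)
    with True show ?thesis by (simp only: sg_def if_True)
  next
    case False
    then have "twist F = - F" by (simp add: tw sg_def fun_eq_iff)
    then have "koszul (twist F) (L.ced G) = - koszul F (L.ced G)" by (simp only: koszul_additive_simps)
    with False show ?thesis by (simp only: sg_def if_False) (simp add: fun_eq_iff)
  qed
  then have "op_sum T (Alt2_mult sH sQ f g) = Alt2_mult sH sQ (op_sum T f) g +
      (\<lambda>\<xi>s xs. (-1) ^ (p + q) * Alt2_mult sH sQ f (op_sum T g) \<xi>s xs)"
    unfolding F(2) G(2) op_sum_eq[OF F(1)] op_sum_eq[OF G(1)]
      Alt2_mult_uncombine[OF F(1) G(1)] Alt2_mult_uncombine[OF L.Alt_ced[OF F(1)] G(1)]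
      Alt2_mult_uncombine[OF F(1) L.Alt_ced[OF G(1)]] op_sum_eq[OF Alt_koszul[OF F(1) G(1)]] L.ced_koszul
    by (simp add: fun_eq_iff uncombine_apply)
  moreover have "Alt2_mult sH sQ f g \<in> Alt2 sH sQ"
    unfolding F(2) G(2) Alt2_mult_uncombine[OF F(1) G(1)]
    by (rule uncombine_in_Alt2[OF Alt_koszul[OF F(1) G(1)]])
  ultimately show "restrict (op_sum T) (Alt2 sH sQ) (Alt2_mult sH sQ f g) =
      Alt2_mult sH sQ (restrict (op_sum T) (Alt2 sH sQ) f) g +
      (\<lambda>\<xi>s xs. (-1) ^ (p + q) * Alt2_mult sH sQ f (restrict (op_sum T) (Alt2 sH sQ) g) \<xi>s xs)"
    by (simp only: restrict_apply f fg(2) if_True)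
qed

lemma bilinear_over_zero: "(\<And>c. s3 c 0 = 0) \<Longrightarrow> bilinear_over s1 s2 s3 (\<lambda>_ _. 0)"
  by (simp add: bilinear_over_def)

lemma zero_bilinear_and_derivation:
  "bilinear_over (restrict_scalars sR sX) (restrict_scalars sR sY) (restrict_scalars sR sH) (\<lambda>_ _. 0)"
  "bilinear_over (restrict_scalars sR sX) (restrict_scalars sR sY) (restrict_scalars sR sQ) (\<lambda>_ _. 0)"
  "bilinear_over (restrict_scalars sR sX) sR sR (\<lambda>_ _. 0)"
  "bilinear_over sX sY sH (\<lambda>_ _. 0)"
  "is_derivation sR (\<lambda>_. 0)"
  by (auto intro!: bilinear_over_zero simp: restrict_scalars_def sR_additive is_derivation_def)

text \<open>
  Each of the three operators is the sum of all three for a triple in which the structure maps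
  that do not occur in it are replaced by zero, and this again is an almost pre-Lie-Rinehart triple.
\<close>

lemma derivation_op0: "Alt2_derivation sR sH sQ (restrict (op0 T) (Alt2 sH sQ))"
proof -
  let ?T = "T\<lparr>brQ := \<lambda>_ _. 0, actQ := \<lambda>_ _. 0, dotQH := \<lambda>_ _. 0, delta := \<lambda>_ _. 0\<rparr>"
  interpret T: almost_pre_lie_rinehart_triple sR sH sQ ?T
    by unfold_locales (simp_all add: zero_bilinear_and_derivation brH_bilinear brH_self actH_bilinear
      dotHQ_bilinear actH_derivation actH_scale brH_scale dotHQ_scale_right dotHQ_scale_left)
  \<comment> \<open>Forms vanish on a zero argument, so every term with one of the replaced maps
    disappears.\<close>
  have "op_sum ?T f = op0 T f" if "f \<in> Alt2 sH sQ" for f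
  proof -
    have "alternating2 f" using that by (simp add: Alt2_iff)
    from alternating2_simps(4,8)[OF this] show ?thesis
      by (simp add: fun_eq_iff op_sum_def op0_def op1_def op2_def)
  qed
  then have "restrict (op_sum ?T) (Alt2 sH sQ) = restrict (op0 T) (Alt2 sH sQ)" by auto
  with T.derivation_op_sum show ?thesis by (simp only:)
qed

lemma derivation_op1: "Alt2_derivation sR sH sQ (restrict (op1 T) (Alt2 sH sQ))"
proof -
  let ?T = "T\<lparr>brH := \<lambda>_ _. 0, actH := \<lambda>_ _. 0, dotHQ := \<lambda>_ _. 0, delta := \<lambda>_ _. 0\<rparr>"
  interpret T: almost_pre_lie_rinehart_triple sR sH sQ ?T
    by unfold_locales (simp_all add: zero_bilinear_and_derivation brQ_bilinear brQ_self actQ_bilinear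
      dotQH_bilinear actQ_derivation actQ_scale brQ_scale dotQH_scale_right dotQH_scale_left)
  have "op_sum ?T f = op1 T f" if "f \<in> Alt2 sH sQ" for f
  proof -
    have "alternating2 f" using that by (simp add: Alt2_iff)
    from alternating2_simps(4,8)[OF this] show ?thesis
      by (simp add: fun_eq_iff op_sum_def op0_def op1_def op2_def)
  qed
  then have "restrict (op_sum ?T) (Alt2 sH sQ) = restrict (op1 T) (Alt2 sH sQ)" by auto
  with T.derivation_op_sum show ?thesis by (simp only:)
qed

lemma derivation_op2: "Alt2_derivation sR sH sQ (restrict (op2 T) (Alt2 sH sQ))"
proof -
  let ?T = "T\<lparr>brH := \<lambda>_ _. 0, actH := \<lambda>_ _. 0, dotHQ := \<lambda>_ _. 0, brQ := \<lambda>_ _. 0, actQ := \<lambda>_ _. 0,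
    dotQH := \<lambda>_ _. 0\<rparr>"
  interpret T: almost_pre_lie_rinehart_triple sR sH sQ ?T
    by unfold_locales (simp_all add: zero_bilinear_and_derivation delta_bilinear delta_self)
  have "op_sum ?T f = op2 T f" if "f \<in> Alt2 sH sQ" for f
  proof -
    have "alternating2 f" using that by (simp add: Alt2_iff)
    from alternating2_simps(4,8)[OF this] show ?thesis
      by (simp add: fun_eq_iff op_sum_def op0_def op1_def op2_def)
  qed
  then have "restrict (op_sum ?T) (Alt2 sH sQ) = restrict (op2 T) (Alt2 sH sQ)" by auto
  with T.derivation_op_sum show ?thesis by (simp only:)
qed

text \<open>Each term evaluates \<open>f\<close> on lists whose lengths differ from those of
  \<open>\<xi>s\<close> and \<open>xs\<close> by fixed numbers. That the results lie in
  \<open>Alt2 sH sQ\<close> is part of the derivation property.\<close>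

lemma bidegree_ops:
  shows "has_bidegree sH sQ 0 (restrict (op0 T) (Alt2 sH sQ))"
    and "has_bidegree sH sQ 1 (restrict (op1 T) (Alt2 sH sQ))"
    and "has_bidegree sH sQ 2 (restrict (op2 T) (Alt2 sH sQ))"
proof -
  have op0: "op0 T f \<xi>s xs = 0" if f: "f \<in> Alt2_comp sH sQ p q"
    and n: "\<not> (int (length \<xi>s) = p + 0 \<and> int (length xs) = q - 0 + 1)" for p q f \<xi>s xs
  proof -
    have z: "f us vs = 0" if "int (length us) \<noteq> p \<or> int (length vs) \<noteq> q" for us vs
      using f that by (auto simp: Alt2_comp_def)
    have "f \<xi>s (nths xs (- {j})) = 0" if "j < length xs" for j
      using n length_nths_Compl1[OF that] by (intro z) auto
    moreover have "f \<xi>s (x # nths xs (- {j, k})) = 0" if "j < k" "k < length xs" for x j k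
      using n length_nths_Compl2[OF that] by (intro z) auto
    moreover have "f (\<xi> # nths \<xi>s (- {j})) (nths xs (- {k})) = 0" if "j < length \<xi>s" "k < length xs" for \<xi> j k
      using n length_nths_Compl1[OF that(1)] length_nths_Compl1[OF that(2)] by (intro z) auto
    ultimately show ?thesis by (simp add: op0_def)
  qed
  have op1: "op1 T f \<xi>s xs = 0" if f: "f \<in> Alt2_comp sH sQ p q"
    and n: "\<not> (int (length \<xi>s) = p + 1 \<and> int (length xs) = q - 1 + 1)" for p q f \<xi>s xs
  proof -
    have z: "f us vs = 0" if "int (length us) \<noteq> p \<or> int (length vs) \<noteq> q" for us vs
      using f that by (auto simp: Alt2_comp_def)
    have "f (nths \<xi>s (- {j})) xs = 0" if "j < length \<xi>s" for j
      using n length_nths_Compl1[OF that] by (intro z) auto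
    moreover have "f (\<xi> # nths \<xi>s (- {j, k})) xs = 0" if "j < k" "k < length \<xi>s" for \<xi> j k
      using n length_nths_Compl2[OF that] by (intro z) auto
    moreover have "f (nths \<xi>s (- {j})) (x # nths xs (- {k})) = 0" if "j < length \<xi>s" "k < length xs" for x j k
      using n length_nths_Compl1[OF that(1)] length_nths_Compl1[OF that(2)] by (intro z) auto
    ultimately show ?thesis by (simp add: op1_def)
  qed
  have op2: "op2 T f \<xi>s xs = 0" if f: "f \<in> Alt2_comp sH sQ p q"
    and n: "\<not> (int (length \<xi>s) = p + 2 \<and> int (length xs) = q - 2 + 1)" for p q f \<xi>s xs
  proof -
    have z: "f us vs = 0" if "int (length us) \<noteq> p \<or> int (length vs) \<noteq> q" for us vs
      using f that by (auto simp: Alt2_comp_def)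
    have "f (nths \<xi>s (- {j, k})) (x # xs) = 0" if "j < k" "k < length \<xi>s" for x j k
      using n length_nths_Compl2[OF that] by (intro z) auto
    then show ?thesis by (simp add: op2_def)
  qed
  have *: "has_bidegree sH sQ j (restrict op (Alt2 sH sQ))"
    if zero: "\<And>p q f \<xi>s xs. f \<in> Alt2_comp sH sQ p q \<Longrightarrow>
        \<not> (int (length \<xi>s) = p + j \<and> int (length xs) = q - j + 1) \<Longrightarrow> op f \<xi>s xs = 0"
      and der: "Alt2_derivation sR sH sQ (restrict op (Alt2 sH sQ))" for op and j :: int
  proof -
    have "op f \<in> Alt2_comp sH sQ (p + j) (q - j + 1)" if f: "f \<in> Alt2_comp sH sQ p q" for f p q
    proof -
      have "f \<in> Alt2 sH sQ" using f by (simp add: Alt2_comp_def)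
      then have "op f \<in> Alt2 sH sQ"
        using der by (auto simp: Alt2_derivation_def PiE_iff)
      with zero[OF f] show ?thesis
        unfolding Alt2_comp_def by blast
    qed
    moreover have "f \<in> Alt2 sH sQ" if "f \<in> Alt2_comp sH sQ p q" for f p q
      using that by (simp add: Alt2_comp_def)
    ultimately show ?thesis by (auto simp: has_bidegree_def)
  qed
  show "has_bidegree sH sQ 0 (restrict (op0 T) (Alt2 sH sQ))" by (rule *[OF op0 derivation_op0])
  show "has_bidegree sH sQ 1 (restrict (op1 T) (Alt2 sH sQ))" by (rule *[OF op1 derivation_op1])
  show "has_bidegree sH sQ 2 (restrict (op2 T) (Alt2 sH sQ))" by (rule *[OF op2 derivation_op2])
qed

text \<open>The other axioms of the total algebra hold for every almost pre-Lie-Rinehart triple;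
  they are carried over from \<open>L\<close> by \<open>prod.swap\<close>.\<close>

lemma lie_rinehart_triple_iff:
  "lie_rinehart_triple sR sH sQ T \<longleftrightarrow>
     (\<forall>x y z. triple_bracket T x (triple_bracket T y z) + triple_bracket T y (triple_bracket T z x) +
        triple_bracket T z (triple_bracket T x y) = 0) \<and>
     (\<forall>x y a. triple_action T (triple_bracket T x y) a =
        triple_action T x (triple_action T y a) - triple_action T y (triple_action T x a))"
  (is "_ \<longleftrightarrow> ?jacobi \<and> ?action")
proof
  assume "lie_rinehart_triple sR sH sQ T"
  then interpret lie_rinehart_algebra sR "scale_prod sH sQ" "total_bracket T" "total_action T"
    by (rule lie_rinehart_triple.total_lie_rinehart)
  have swap: "prod.swap x + prod.swap y = prod.swap (x + y)" for x y :: "'h \<times> 'q"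
    by (cases x; cases y) simp
  have ?jacobi using jacobi by (simp add: triple_bracket_def swap) (simp add: zero_prod_def)
  moreover have ?action using action_bracket by (simp add: triple_bracket_def triple_action_def)
  ultimately show "?jacobi \<and> ?action" ..
next
  assume *: "?jacobi \<and> ?action"
  then have jac: "triple_bracket T x (triple_bracket T y z) + triple_bracket T y (triple_bracket T z x) +
      triple_bracket T z (triple_bracket T x y) = 0"
    and flat: "triple_action T (triple_bracket T x y) a =
      triple_action T x (triple_action T y a) - triple_action T y (triple_action T x a)" for x y z a
    by blast+
  have swap: "prod.swap (x + y) = prod.swap x + prod.swap y" for x y :: "'c::plus \<times> 'd::plus"
    by (cases x; cases y) simp
  have br: "total_bracket T x y = prod.swap (triple_bracket T (prod.swap x) (prod.swap y))" for x y
    by (simp add: triple_bracket_def)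
  have act: "total_action T x a = triple_action T (prod.swap x) a" for x a
    by (simp add: triple_action_def)
  have s: "scale_prod sH sQ a x = prod.swap (sL a (prod.swap x))" for a x
    by (cases x) (simp add: scale_prod_def)
  have r: "restrict_scalars sR (scale_prod sH sQ) c x = prod.swap (restrict_scalars sR sL c (prod.swap x))" for c x
    by (simp add: restrict_scalars_def s)
  have z: "prod.swap 0 = (0 :: 'h \<times> 'q)" by (simp add: zero_prod_def)
  interpret M: module_over "scale_prod sH sQ"
    by (rule module_over_scale_prod) (rule Q.module_over_axioms H.module_over_axioms)+
  have "lie_rinehart_algebra sR (scale_prod sH sQ) (total_bracket T) (total_action T)"
  proof
    show "bilinear_over (restrict_scalars sR (scale_prod sH sQ)) (restrict_scalars sR (scale_prod sH sQ))
        (restrict_scalars sR (scale_prod sH sQ)) (total_bracket T)"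
      by (simp add: bilinear_over_def br r swap L.br_add_left L.br_add_right L.br_scaleR)
    show "bilinear_over (restrict_scalars sR (scale_prod sH sQ)) sR sR (total_action T)"
      by (simp add: bilinear_over_def act r swap L.act_add_left L.act_restrict_scalars L.act_scaleR)
  next
    fix x y z a b
    show "total_bracket T x x = 0" by (simp add: br L.br_self z)
    show "total_bracket T x (total_bracket T y z) + total_bracket T y (total_bracket T z x) +
        total_bracket T z (total_bracket T x y) = 0"
      by (simp add: br z jac flip: swap)
    show "is_derivation sR (total_action T x)"
      using L.act_derivation[of "prod.swap x"] by (simp add: is_derivation_def act)
    show "total_action T (total_bracket T x y) a =
        total_action T x (total_action T y a) - total_action T y (total_action T x a)"
      by (simp add: br act flat)
    show "total_action T (scale_prod sH sQ a x) b = a * total_action T x b"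
      by (simp add: act s L.act_scale)
    show "total_bracket T x (scale_prod sH sQ a y) =
        scale_prod sH sQ (total_action T x a) y + scale_prod sH sQ a (total_bracket T x y)"
      by (simp add: act br s L.br_scale swap)
  qed
  then show "lie_rinehart_triple sR sH sQ T"
    by (intro lie_rinehart_triple.intro lie_rinehart_triple_axioms.intro almost_pre_lie_rinehart_triple_axioms)
qed

lemma triple_operators_in_maurer_cartan:
  assumes "lie_rinehart_triple sR sH sQ T"
  shows "triple_operators sH sQ T \<in> maurer_cartan_structures sR sH sQ"
proof -
  have D: "restrict (op0 T) (Alt2 sH sQ) f + restrict (op1 T) (Alt2 sH sQ) f + restrict (op2 T) (Alt2 sH sQ) f =
      op_sum T f" if "f \<in> Alt2 sH sQ" for f
    unfolding op_sum_def using that by (simp only: restrict_apply if_True)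
  have "op_sum T (op_sum T f) = 0" if f: "f \<in> Alt2 sH sQ" for f
  proof -
    obtain F where F: "F \<in> Alt sL" "f = uncombine F" using f by (meson Alt2_obtain_uncombine)
    have "L.ced (L.ced F) zs = 0" for zs
      using assms F(1) unfolding lie_rinehart_triple_iff Alt_iff by (intro L.ced_ced) blast+
    then show ?thesis
      unfolding F(2) op_sum_eq[OF F(1)] op_sum_eq[OF L.Alt_ced[OF F(1)]] by (simp add: fun_eq_iff uncombine_apply)
  qed
  note square = this
  have "\<forall>f\<in>Alt2 sH sQ. restrict (op0 T) (Alt2 sH sQ) (restrict (op0 T) (Alt2 sH sQ) f +
      restrict (op1 T) (Alt2 sH sQ) f + restrict (op2 T) (Alt2 sH sQ) f) +
    restrict (op1 T) (Alt2 sH sQ) (restrict (op0 T) (Alt2 sH sQ) f +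
      restrict (op1 T) (Alt2 sH sQ) f + restrict (op2 T) (Alt2 sH sQ) f) +
    restrict (op2 T) (Alt2 sH sQ) (restrict (op0 T) (Alt2 sH sQ) f +
      restrict (op1 T) (Alt2 sH sQ) f + restrict (op2 T) (Alt2 sH sQ) f) = 0"
  proof
    fix f assume f: "f \<in> Alt2 sH sQ"
    show "restrict (op0 T) (Alt2 sH sQ) (restrict (op0 T) (Alt2 sH sQ) f +
        restrict (op1 T) (Alt2 sH sQ) f + restrict (op2 T) (Alt2 sH sQ) f) +
      restrict (op1 T) (Alt2 sH sQ) (restrict (op0 T) (Alt2 sH sQ) f +
        restrict (op1 T) (Alt2 sH sQ) f + restrict (op2 T) (Alt2 sH sQ) f) +
      restrict (op2 T) (Alt2 sH sQ) (restrict (op0 T) (Alt2 sH sQ) f +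
        restrict (op1 T) (Alt2 sH sQ) f + restrict (op2 T) (Alt2 sH sQ) f) = 0"
      unfolding D[OF f] D[OF op_sum_in_Alt2[OF f]] by (rule square[OF f])
  qed
  then show ?thesis
    unfolding maurer_cartan_structures_def triple_operators_def Let_def mem_Collect_eq case_prod_conv
    by (intro conjI derivation_op0 derivation_op1 derivation_op2 bidegree_ops)
qed

end


section \<open>Maurer-Cartan structures come from triples\<close>

context two_modules
begin

text \<open>Conjugation by the identification makes \<open>d\<close> a derivation on forms over
  \<open>L\<close>; the rules are checked after applying the injective map
  \<open>uncombine\<close>.\<close>

lemma recombine_derivation:
  fixes sR :: "'r::{comm_ring, comm_monoid_mult} \<Rightarrow> 'a \<Rightarrow> 'a"
  assumes "algebra_over sR" and d: "Alt2_derivation sR sH sQ d"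
  defines "D \<equiv> \<lambda>F. recombine (d (uncombine F))"
  shows "F \<in> Alt sL \<Longrightarrow> uncombine (D F) = d (uncombine F)"
    and "F \<in> Alt sL \<Longrightarrow> D F \<in> Alt sL"
    and "F \<in> Alt sL \<Longrightarrow> G \<in> Alt sL \<Longrightarrow> D (F + G) = D F + D G"
    and "F \<in> Alt sL \<Longrightarrow> D (\<lambda>zs. sR r (F zs)) = (\<lambda>zs. sR r (D F zs))"
    and "F \<in> Alt sL \<Longrightarrow> G \<in> Alt sL \<Longrightarrow> uncombine F \<in> Alt2_comp sH sQ (int p) (int q) \<Longrightarrow>
      D (koszul F G) = koszul (D F) G + (\<lambda>zs. sg (p + q) (koszul F (D G) zs))"
proof -
  interpret algebra_over sR by fact
  have d_in: "d (uncombine F) \<in> Alt2 sH sQ" if "F \<in> Alt sL" for F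
    using d uncombine_in_Alt2[OF that] unfolding Alt2_derivation_def by (auto simp: PiE_iff)
  have UD: "uncombine (D F) = d (uncombine F)" if "F \<in> Alt sL" for F
    unfolding D_def by (rule uncombine_recombine[OF d_in[OF that]])
  have D_in: "D F \<in> Alt sL" if "F \<in> Alt sL" for F
    unfolding D_def by (rule recombine_in_Alt[OF d_in[OF that]])
  show "F \<in> Alt sL \<Longrightarrow> uncombine (D F) = d (uncombine F)" "F \<in> Alt sL \<Longrightarrow> D F \<in> Alt sL"
    by (erule UD) (erule D_in)
  show "D (F + G) = D F + D G" if FG: "F \<in> Alt sL" "G \<in> Alt sL"
  proof (rule uncombine_inject)
    show "D (F + G) \<in> Alt sL" "D F + D G \<in> Alt sL" using FG by (auto intro!: Alt_add D_in)
    have "d (uncombine F + uncombine G) = d (uncombine F) + d (uncombine G)"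
      using d FG uncombine_in_Alt2 unfolding Alt2_derivation_def by blast
    then show "uncombine (D (F + G)) = uncombine (D F + D G)"
      by (simp only: uncombine_add UD FG Alt_add)
  qed
  show "D (\<lambda>zs. sR r (F zs)) = (\<lambda>zs. sR r (D F zs))" if F: "F \<in> Alt sL"
  proof -
    have U: "uncombine (\<lambda>zs. sR r (F zs)) = (\<lambda>\<xi>s xs. sR r (uncombine F \<xi>s xs))" for F
      by (simp add: fun_eq_iff uncombine_apply)
    have "d (\<lambda>\<xi>s xs. sR r (uncombine F \<xi>s xs)) = (\<lambda>\<xi>s xs. sR r (d (uncombine F) \<xi>s xs))"
      using d uncombine_in_Alt2[OF F] unfolding Alt2_derivation_def by blast
    then show ?thesis
      by (intro uncombine_inject Alt_scaleR D_in F) (simp only: U UD F Alt_scaleR)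
  qed
  show "D (koszul F G) = koszul (D F) G + (\<lambda>zs. sg (p + q) (koszul F (D G) zs))"
    if FG: "F \<in> Alt sL" "G \<in> Alt sL" and pq: "uncombine F \<in> Alt2_comp sH sQ (int p) (int q)"
  proof -
    have sg: "(\<lambda>zs. sg n (K zs)) \<in> Alt sL" if "K \<in> Alt sL" for K n
      using that Alt_uminus[OF that] by (cases "even n") (simp_all add: sg_def fun_Compl_def)
    have U: "uncombine (\<lambda>zs. sg n (K zs)) = (\<lambda>\<xi>s xs. (-1) ^ n * uncombine K \<xi>s xs)"
      for n :: nat and K :: "('q \<times> 'h) list \<Rightarrow> 'a"
      by (simp add: fun_eq_iff uncombine_apply)
    have "d (Alt2_mult sH sQ (uncombine F) (uncombine G)) =
        Alt2_mult sH sQ (d (uncombine F)) (uncombine G) +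
        (\<lambda>\<xi>s xs. (-1) ^ (p + q) * Alt2_mult sH sQ (uncombine F) (d (uncombine G)) \<xi>s xs)"
      using d uncombine_in_Alt2[OF FG(2)] pq unfolding Alt2_derivation_def by blast
    then show ?thesis
      unfolding UD[OF FG(1), symmetric] UD[OF FG(2), symmetric]
        Alt2_mult_uncombine[OF FG] Alt2_mult_uncombine[OF D_in[OF FG(1)] FG(2)]
        Alt2_mult_uncombine[OF FG(1) D_in[OF FG(2)]]
      unfolding UD[OF Alt_koszul[OF FG], symmetric] U[symmetric] uncombine_add[symmetric]
      by (intro uncombine_inject D_in Alt_add sg Alt_koszul FG)
  qed
qed

lemma Alt2_derivation_add:
  assumes "Alt2_derivation sR sH sQ d" "f \<in> Alt2 sH sQ" "g \<in> Alt2 sH sQ"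
  shows "d (f + g) = d f + d g"
  using assms unfolding Alt2_derivation_def by blast

lemma Alt2_derivation_zero:
  assumes "Alt2_derivation sR sH sQ d"
  shows "d 0 = 0"
proof -
  have "d (0 + 0) = d 0 + d 0" by (rule Alt2_derivation_add[OF assms Alt2_zero Alt2_zero])
  then show ?thesis unfolding add_0_left by (rule add_cancel_right_right[THEN iffD1])
qed

lemma Alt2_derivation_restrict_add:
  assumes "Alt2_derivation sR sH sQ (restrict op (Alt2 sH sQ))"
    and "f \<in> Alt2 sH sQ" "g \<in> Alt2 sH sQ"
  shows "op (f + g) = op f + op g"
  using Alt2_derivation_add[OF assms] by (simp only: restrict_apply assms(2,3) Alt2_add if_True)

text \<open>The bidegree \<open>(j, 1 - j)\<close> has total degree 1 for every \<open>j\<close>, so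
  the sum of the lifted operators is homogeneous of degree 1.\<close>

lemma recombine_bidegree:
  assumes "has_bidegree sH sQ j d" "f \<in> Alt2_comp sH sQ p q" "int (length zs) \<noteq> p + q + 1"
  shows "recombine (d f) zs = 0"
proof (rule recombine_eq_zero)
  fix \<xi>s xs assume "length (\<xi>s :: 'q list) + length (xs :: 'h list) = length zs"
  then have "\<not> (int (length \<xi>s) = p + j \<and> int (length xs) = q - j + 1)" using assms(3) by linarith
  moreover have "d f \<in> Alt2_comp sH sQ (p + j) (q - j + 1)"
    using assms(1,2) unfolding has_bidegree_def by blast
  ultimately show "d f \<xi>s xs = 0" unfolding Alt2_comp_def by blast
qed

lemma uncombine_constant_form: "uncombine (constant_form a) \<in> Alt2_comp sH sQ 0 0"
proof -
  have "length \<xi>s = 0 \<and> length xs = 0" if "uncombine (constant_form a) \<xi>s xs \<noteq> 0" for \<xi>s xs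
    using that by (auto simp: uncombine_apply constant_form_def split: if_splits)
  then show ?thesis unfolding Alt2_comp_def using uncombine_in_Alt2[OF Alt_constant_form] by auto
qed

lemma uncombine_linear_form_fst:
  assumes "module_hom_to_ring sQ \<psi>"
  shows "linear_form (\<lambda>z. \<psi> (fst z)) \<in> Alt sL"
    and "uncombine (linear_form (\<lambda>z. \<psi> (fst z))) \<in> Alt2_comp sH sQ 1 0"
proof -
  have "module_hom_to_ring sL (\<lambda>z. \<psi> (fst z))"
    using assms by (simp add: module_hom_to_ring_def scale_prod_def split_beta)
  then show A: "linear_form (\<lambda>z. \<psi> (fst z)) \<in> Alt sL" by (rule Alt_linear_form)
  have "\<psi> 0 = 0" using assms by (intro additive_zero) (simp add: module_hom_to_ring_def)
  then have "length \<xi>s = 1 \<and> length xs = 0"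
    if "uncombine (linear_form (\<lambda>z. \<psi> (fst z))) \<xi>s xs \<noteq> 0" for \<xi>s and xs :: "'h list"
    using that by (cases \<xi>s; cases "tl \<xi>s"; cases xs; cases "tl xs") (auto simp: uncombine_apply)
  then show "uncombine (linear_form (\<lambda>z. \<psi> (fst z))) \<in> Alt2_comp sH sQ 1 0"
    unfolding Alt2_comp_def using uncombine_in_Alt2[OF A] by auto
qed

lemma uncombine_linear_form_snd:
  assumes "module_hom_to_ring sH \<psi>"
  shows "linear_form (\<lambda>z. \<psi> (snd z)) \<in> Alt sL"
    and "uncombine (linear_form (\<lambda>z. \<psi> (snd z))) \<in> Alt2_comp sH sQ 0 1"
proof -
  have "module_hom_to_ring sL (\<lambda>z. \<psi> (snd z))"
    using assms by (simp add: module_hom_to_ring_def scale_prod_def split_beta)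
  then show A: "linear_form (\<lambda>z. \<psi> (snd z)) \<in> Alt sL" by (rule Alt_linear_form)
  have "\<psi> 0 = 0" using assms by (intro additive_zero) (simp add: module_hom_to_ring_def)
  then have "length \<xi>s = 0 \<and> length xs = 1"
    if "uncombine (linear_form (\<lambda>z. \<psi> (snd z))) \<xi>s xs \<noteq> 0" for \<xi>s :: "'q list" and xs
    using that by (cases \<xi>s; cases "tl \<xi>s"; cases xs; cases "tl xs") (auto simp: uncombine_apply)
  then show "uncombine (linear_form (\<lambda>z. \<psi> (snd z))) \<in> Alt2_comp sH sQ 0 1"
    unfolding Alt2_comp_def using uncombine_in_Alt2[OF A] by auto
qed

text \<open>In general a linear form on \<open>L\<close> is not bihomogeneous; the product rule for
  \<open>d\<close> applies to its parts of bidegrees \<open>(1, 0)\<close> and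
  \<open>(0, 1)\<close>.\<close>

lemma linear_form_split:
  assumes "module_hom_to_ring sL \<psi>"
  obtains \<alpha> \<beta> where "module_hom_to_ring sQ \<alpha>" "module_hom_to_ring sH \<beta>"
    "linear_form \<psi> = linear_form (\<lambda>z. \<alpha> (fst z)) + linear_form (\<lambda>z. \<beta> (snd z))"
proof
  have add: "\<psi> (x + y) = \<psi> x + \<psi> y" and scale: "\<psi> (sL a x) = a * \<psi> x" for x y a
    using assms unfolding module_hom_to_ring_def by blast+
  show "module_hom_to_ring sQ (\<lambda>\<xi>. \<psi> (\<xi>, 0))"
    using add[of "(_, 0)" "(_, 0)"] scale[of _ "(_, 0)"] by (simp add: module_hom_to_ring_def scale_prod_def)
  show "module_hom_to_ring sH (\<lambda>x. \<psi> (0, x))"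
    using add[of "(0, _)" "(0, _)"] scale[of _ "(0, _)"] by (simp add: module_hom_to_ring_def scale_prod_def)
  have split: "\<psi> z = \<psi> (fst z, 0) + \<psi> (0, snd z)" for z
    using add[of "(fst z, 0)" "(0, snd z)"] by simp
  show "linear_form \<psi> = linear_form (\<lambda>z. \<psi> (fst z, 0)) + linear_form (\<lambda>z. \<psi> (0, snd z))"
  proof
    show "linear_form \<psi> zs = (linear_form (\<lambda>z. \<psi> (fst z, 0)) + linear_form (\<lambda>z. \<psi> (0, snd z))) zs" for zs
      using split[of "hd zs"] by (cases zs; cases "tl zs") auto
  qed
qed

end

text \<open>The operators are indexed so that they can be summed. The condition on the square enters
  in \<open>lie_rinehart_triple\<close>.\<close>

locale maurer_cartan = algebra_over sR + two_modules sH sQ + Q: dual_basis sQ KQ eQ \<phi>Q + H: dual_basis sH KH eH \<phi>H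
  for sR :: "'r::{comm_ring, comm_monoid_mult} \<Rightarrow> 'a::{comm_ring, comm_monoid_mult} \<Rightarrow> 'a"
    and sH :: "'a \<Rightarrow> 'h::ab_group_add \<Rightarrow> 'h" and sQ :: "'a \<Rightarrow> 'q::ab_group_add \<Rightarrow> 'q"
    and KQ eQ \<phi>Q KH eH \<phi>H +
  fixes d :: "nat \<Rightarrow> ('a, 'h, 'q) form \<Rightarrow> ('a, 'h, 'q) form"
  assumes derivation: "j < 3 \<Longrightarrow> Alt2_derivation sR sH sQ (d j)"
    and bidegree: "j < 3 \<Longrightarrow> has_bidegree sH sQ (int j) (d j)"
begin

definition D :: "(('q \<times> 'h) list \<Rightarrow> 'a) \<Rightarrow> ('q \<times> 'h) list \<Rightarrow> 'a" where
  "D F = (\<Sum>j<3. recombine (d j (uncombine F)))"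

lemma D_apply: "D F zs = (\<Sum>j<3. recombine (d j (uncombine F)) zs)"
  by (simp add: D_def sum_fun_apply)

lemmas lift = recombine_derivation[OF algebra_over_axioms derivation]

lemma uncombine_D: "F \<in> Alt sL \<Longrightarrow> uncombine (D F) = (\<Sum>j<3. d j (uncombine F))"
proof (intro ext)
  fix \<xi>s xs assume F: "F \<in> Alt sL"
  have "uncombine (D F) \<xi>s xs = (\<Sum>j<3. uncombine (recombine (d j (uncombine F))) \<xi>s xs)"
    by (simp only: uncombine_apply D_apply)
  also have "\<dots> = (\<Sum>j<3. d j (uncombine F)) \<xi>s xs"
    unfolding sum_fun_apply using lift(1)[OF _ F] by (intro sum.cong) auto
  finally show "uncombine (D F) \<xi>s xs = (\<Sum>j<3. d j (uncombine F)) \<xi>s xs" .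
qed

lemma D_add: "F \<in> Alt sL \<Longrightarrow> G \<in> Alt sL \<Longrightarrow> D (F + G) = D F + D G"
  unfolding D_def sum.distrib[symmetric] by (intro sum.cong refl lift(3)) auto

lemma D_koszul:
  assumes "F \<in> Alt sL" "G \<in> Alt sL" "uncombine F \<in> Alt2_comp sH sQ (int p) (int q)"
  shows "D (koszul F G) zs = koszul (D F) G zs + sg (p + q) (koszul F (D G) zs)"
proof -
  have "koszul (\<Sum>j<n. K j) G zs = (\<Sum>j<n. koszul (K j) G zs)" for K and n :: nat and zs
    by (simp only: additive_sum[of "\<lambda>F. koszul F G", OF koszul_add_left] sum_fun_apply)
  moreover have "koszul F (\<Sum>j<n. K j) zs = (\<Sum>j<n. koszul F (K j) zs)" for K and n :: nat and zs
    by (simp only: additive_sum[of "koszul F", OF koszul_add_right] sum_fun_apply)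
  moreover have "D (koszul F G) zs = (\<Sum>j<3. koszul (recombine (d j (uncombine F))) G zs +
      sg (p + q) (koszul F (recombine (d j (uncombine G))) zs))"
    unfolding D_apply by (intro sum.cong refl) (subst lift(5)[OF _ assms], auto)
  ultimately show ?thesis by (simp add: D_def sum.distrib sg_sum)
qed

lemma D_degree:
  assumes "uncombine F \<in> Alt2_comp sH sQ (int p) (int q)" "length zs \<noteq> p + q + 1"
  shows "D F zs = 0"
  unfolding D_apply
proof (rule sum.neutral, rule ballI)
  fix j :: nat assume "j \<in> {..<3}"
  then show "recombine (d j (uncombine F)) zs = 0"
    using assms(2) by (intro recombine_bidegree[OF bidegree assms(1)]) auto
qed

sublocale L: dual_basis sL "KQ + KH" "\<lambda>k. if k < KQ then (eQ k, 0) else (0, eH (k - KQ))"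
  "\<lambda>k z. if k < KQ then \<phi>Q k (fst z) else \<phi>H (k - KQ) (snd z)"
  by (rule dual_basis_scale_prod) (rule Q.dual_basis_axioms H.dual_basis_axioms)+

sublocale form_derivation sR sL "KQ + KH" "\<lambda>k. if k < KQ then (eQ k, 0) else (0, eH (k - KQ))"
  "\<lambda>k z. if k < KQ then \<phi>Q k (fst z) else \<phi>H (k - KQ) (snd z)" D
proof
  fix F :: "('q \<times> 'h) list \<Rightarrow> 'a" assume F: "F \<in> Alt sL"
  show "D F \<in> Alt sL" unfolding D_def using lift(2)[OF _ F] by (intro Alt_sum) auto
  show "D (F + G) = D F + D G" if "G \<in> Alt sL" for G by (rule D_add[OF F that])
  show "D (\<lambda>zs. sR r (F zs)) = (\<lambda>zs. sR r (D F zs))" for r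
  proof
    have "sR r (\<Sum>j<n. c j) = (\<Sum>j<n. sR r (c j))" for c and n :: nat
      by (induction n) (simp_all add: sR_additive)
    then show "D (\<lambda>zs. sR r (F zs)) zs = sR r (D F zs)" for zs
      unfolding D_apply using lift(4)[OF _ F] by simp
  qed
  show "D (koszul (constant_form a) F) = koszul (D (constant_form a)) F + koszul (constant_form a) (D F)" for a
    using D_koszul[OF Alt_constant_form F, of a 0 0] uncombine_constant_form by (simp add: fun_eq_iff)
  show "D (koszul (linear_form \<psi>) F) = koszul (D (linear_form \<psi>)) F - koszul (linear_form \<psi>) (D F)"
    if \<psi>: "module_hom_to_ring sL \<psi>" for \<psi>
  proof -
    obtain \<alpha> \<beta> where \<alpha>: "module_hom_to_ring sQ \<alpha>" and \<beta>: "module_hom_to_ring sH \<beta>"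
      and split: "linear_form \<psi> = linear_form (\<lambda>z. \<alpha> (fst z)) + linear_form (\<lambda>z. \<beta> (snd z))"
      using linear_form_split[OF \<psi>] .
    note a = uncombine_linear_form_fst[OF \<alpha>] and b = uncombine_linear_form_snd[OF \<beta>]
    show ?thesis
    proof
      fix zs
      \<comment> \<open>Both parts have total degree 1 and hence the same sign.\<close>
      show "D (koszul (linear_form \<psi>) F) zs = (koszul (D (linear_form \<psi>)) F - koszul (linear_form \<psi>) (D F)) zs"
        unfolding split koszul_add_left D_add[OF Alt_koszul[OF a(1) F] Alt_koszul[OF b(1) F]]
          D_add[OF a(1) b(1)] plus_fun_apply minus_apply
        using D_koszul[OF a(1) F, of 1 0 zs] D_koszul[OF b(1) F, of 0 1 zs] a(2) b(2) by simp
    qed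
  qed
next
  fix zs :: "('q \<times> 'h) list" and a assume "length zs \<noteq> 1"
  then show "D (constant_form a) zs = 0"
    using uncombine_constant_form by (intro D_degree[of _ 0 0]) auto
next
  fix zs :: "('q \<times> 'h) list" and \<psi> assume \<psi>: "module_hom_to_ring sL \<psi>" and n: "length zs \<noteq> 2"
  obtain \<alpha> \<beta> where \<alpha>: "module_hom_to_ring sQ \<alpha>" and \<beta>: "module_hom_to_ring sH \<beta>"
    and split: "linear_form \<psi> = linear_form (\<lambda>z. \<alpha> (fst z)) + linear_form (\<lambda>z. \<beta> (snd z))"
    using linear_form_split[OF \<psi>] .
  note a = uncombine_linear_form_fst[OF \<alpha>] and b = uncombine_linear_form_snd[OF \<beta>]
  show "D (linear_form \<psi>) zs = 0"
    unfolding split D_add[OF a(1) b(1)] plus_fun_apply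
    using D_degree[of "linear_form (\<lambda>z. \<alpha> (fst z))" 1 0 zs]
      D_degree[of "linear_form (\<lambda>z. \<beta> (snd z))" 0 1 zs] a(2) b(2) n by simp
qed

text \<open>
  The part of the bracket from \<open>H \<times> H\<close> to \<open>Q\<close> would be seen in a component of
  bidegree \<open>(-1, 2)\<close> of the derivation.
\<close>

lemma br_H_H: "fst (br (0, x) (0, y)) = 0"
proof (rule Q.eq_if_homs_eq)
  fix \<alpha> assume \<alpha>: "module_hom_to_ring sQ \<alpha>"
  note a = uncombine_linear_form_fst[OF \<alpha>]
  have \<psi>: "module_hom_to_ring sL (\<lambda>z. \<alpha> (fst z))"
    using \<alpha> by (simp add: module_hom_to_ring_def scale_prod_def split_beta)
  have \<alpha>0: "\<alpha> 0 = 0" using \<alpha> by (intro additive_zero) (simp add: module_hom_to_ring_def)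
  have "D (linear_form (\<lambda>z. \<alpha> (fst z))) [(0, x), (0, y)] =
      uncombine (D (linear_form (\<lambda>z. \<alpha> (fst z)))) [] [x, y]"
    by (simp add: uncombine_apply)
  also have "\<dots> = (\<Sum>j<3. d j (uncombine (linear_form (\<lambda>z. \<alpha> (fst z)))) [] [x, y])"
    by (simp add: uncombine_D[OF a(1)] sum_fun_apply)
  also have "\<dots> = 0"
  proof (rule sum.neutral, rule ballI)
    fix j :: nat assume "j \<in> {..<3}"
    \<comment> \<open>The result has degree \<open>1 + j > 0\<close> in the arguments from
      \<open>Q\<close>, of which there are none here.\<close>
    then have "d j (uncombine (linear_form (\<lambda>z. \<alpha> (fst z)))) \<in> Alt2_comp sH sQ (1 + int j) (0 - int j + 1)"
      using bidegree[of j] a(2) unfolding has_bidegree_def by blast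
    then show "d j (uncombine (linear_form (\<lambda>z. \<alpha> (fst z)))) [] [x, y] = 0"
      unfolding Alt2_comp_def by force
  qed
  finally show "\<alpha> (fst (br (0, x) (0, y))) = \<alpha> 0"
    using hom_br[OF \<psi>, of "(0, x)" "(0, y)"] by (simp add: bracket_value_def \<alpha>0)
qed

text \<open>The blocks of \<open>br\<close> and \<open>act\<close> with respect to \<open>Q\<close>
  and \<open>H\<close>. A triple has no place for the block from \<open>H \<times> H\<close> to
  \<open>Q\<close>, which is zero by \<open>br_H_H\<close>.\<close>

definition triple :: "('a, 'h, 'q) triple" where
  "triple = \<lparr>brH = \<lambda>x y. snd (br (0, x) (0, y)), brQ = \<lambda>\<xi> \<eta>. fst (br (\<xi>, 0) (\<eta>, 0)),
     actH = \<lambda>x. act (0, x), actQ = \<lambda>\<xi>. act (\<xi>, 0),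
     dotHQ = \<lambda>x \<xi>. fst (br (0, x) (\<xi>, 0)), dotQH = \<lambda>\<xi> x. snd (br (\<xi>, 0) (0, x)),
     delta = \<lambda>\<xi> \<eta>. snd (br (\<xi>, 0) (\<eta>, 0))\<rparr>"

lemma triple_action: "triple_action triple z a = act z a"
  using act_add_left[of "(fst z, 0)" "(0, snd z)" a]
  by (cases z) (simp add: triple_def triple_action_Pair add.commute)

lemma triple_bracket: "triple_bracket triple z w = br z w"
proof -
  obtain \<xi> x \<eta> y where zw: "z = (\<xi>, x)" "w = (\<eta>, y)" by (cases z; cases w)
  have split: "br z w = br (\<xi>, 0) (\<eta>, 0) + br (\<xi>, 0) (0, y) + br (0, x) (\<eta>, 0) + br (0, x) (0, y)"
    using br_add_left[of "(\<xi>, 0)" "(0, x)" w] br_add_right[of _ "(\<eta>, 0)" "(0, y)"] by (simp add: zw add.assoc)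
  show ?thesis
  proof (rule prod_eqI)
    show "fst (triple_bracket triple z w) = fst (br z w)"
      unfolding split br_swap[of "(\<xi>, 0)" "(0, y)"] by (simp add: zw triple_bracket_Pair triple_def br_H_H)
    show "snd (triple_bracket triple z w) = snd (br z w)"
      unfolding split br_swap[of "(0, x)" "(\<eta>, 0)"] by (simp add: zw triple_bracket_Pair triple_def)
  qed
qed

lemma restrict_scalars_Pair:
  "restrict_scalars sR sL r (\<xi>, x) = (restrict_scalars sR sQ r \<xi>, restrict_scalars sR sH r x)"
  by (simp add: restrict_scalars_def scale_prod_def)

text \<open>Each axiom is a component of a rule for \<open>br\<close> or \<open>act\<close>. The
  Leibniz term of the bracket is a multiple of the argument that was scaled and lies in the same
  summand as it. It therefore survives where a triple requires a Leibniz rule, and drops out of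
  \<open>delta\<close> and of the first variable of \<open>dotHQ\<close> and
  \<open>dotQH\<close>.\<close>

sublocale T: almost_pre_lie_rinehart_triple sR sH sQ triple
proof
  have sl: "sL a (\<xi>, x) = (sQ a \<xi>, sH a x)" for a \<xi> x by (simp add: scale_prod_def)
  have r0: "restrict_scalars sR sQ r 0 = 0" "restrict_scalars sR sH r 0 = 0" for r
    by (simp_all add: restrict_scalars_def)
  have r: "(restrict_scalars sR sQ r \<xi>, 0) = restrict_scalars sR sL r (\<xi>, 0)"
    "(0, restrict_scalars sR sH r x) = restrict_scalars sR sL r (0, x)" for r \<xi> x
    by (simp_all add: restrict_scalars_Pair r0)
  have p: "(\<xi> + \<eta>, 0 :: 'h) = (\<xi>, 0) + (\<eta>, 0)" "(0 :: 'q, x + y) = (0, x) + (0, y)"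
    for \<xi> \<eta> :: 'q and x y :: 'h by simp_all
  have fs: "fst (restrict_scalars sR sL r z) = restrict_scalars sR sQ r (fst z)"
    "snd (restrict_scalars sR sL r z) = restrict_scalars sR sH r (snd z)"
    "fst (sL a z) = sQ a (fst z)" "snd (sL a z) = sH a (snd z)" for a r z
    by (cases z, simp add: restrict_scalars_Pair scale_prod_def)+
  have s: "(sQ a \<xi>, 0) = sL a (\<xi>, 0)" "(0, sH a x) = sL a (0, x)" for a \<xi> x by (simp_all add: sl)
  note lin = br_add_left br_add_right br_scaleR act_add_left act_add act_restrict_scalars act_scaleR
  show "bilinear_over (restrict_scalars sR sH) (restrict_scalars sR sH) (restrict_scalars sR sH) (brH triple)"
    "bilinear_over (restrict_scalars sR sQ) (restrict_scalars sR sQ) (restrict_scalars sR sQ) (brQ triple)"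
    "bilinear_over (restrict_scalars sR sH) sR sR (actH triple)"
    "bilinear_over (restrict_scalars sR sQ) sR sR (actQ triple)"
    "bilinear_over (restrict_scalars sR sH) (restrict_scalars sR sQ) (restrict_scalars sR sQ) (dotHQ triple)"
    "bilinear_over (restrict_scalars sR sQ) (restrict_scalars sR sH) (restrict_scalars sR sH) (dotQH triple)"
    by (simp_all add: bilinear_over_def triple_def p r lin fs del: add_Pair)
  have scale_left: "br (sL a z) w = sL a (br z w) - sL (act w a) z" for a z w
    by (rule br_scale_left)
  show "bilinear_over sQ sQ sH (delta triple)"
    by (simp add: bilinear_over_def triple_def p s lin br_scale scale_left fs del: add_Pair)
  fix x y :: 'h and \<xi> \<eta> :: 'q and a b
  show "brH triple x x = 0" "brQ triple \<xi> \<xi> = 0" "delta triple \<xi> \<xi> = 0"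
    by (simp_all add: triple_def br_self)
  show "is_derivation sR (actH triple x)" "is_derivation sR (actQ triple \<xi>)"
    by (simp_all add: triple_def act_derivation)
  show "actH triple (sH a x) b = a * actH triple x b" "actQ triple (sQ a \<xi>) b = a * actQ triple \<xi> b"
    by (simp_all add: triple_def s act_scale)
  show "brH triple x (sH a y) = sH (actH triple x a) y + sH a (brH triple x y)"
    "brQ triple \<xi> (sQ a \<eta>) = sQ (actQ triple \<xi> a) \<eta> + sQ a (brQ triple \<xi> \<eta>)"
    "dotHQ triple x (sQ a \<xi>) = sQ (actH triple x a) \<xi> + sQ a (dotHQ triple x \<xi>)"
    "dotHQ triple (sH a x) \<xi> = sQ a (dotHQ triple x \<xi>)"
    "dotQH triple \<xi> (sH a x) = sH (actQ triple \<xi> a) x + sH a (dotQH triple \<xi> x)"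
    "dotQH triple (sQ a \<xi>) x = sH a (dotQH triple \<xi> x)"
    by (simp_all add: triple_def s br_scale scale_left fs)
qed

lemma T_ced: "T.L.ced = ced"
proof -
  have "triple_bracket triple = br" "triple_action triple = act"
    by (simp_all add: fun_eq_iff triple_bracket triple_action)
  then show ?thesis by (simp only:)
qed

lemma op_sum_triple: "f \<in> Alt2 sH sQ \<Longrightarrow> op_sum triple f = (\<Sum>j<3. d j f)"
proof -
  assume "f \<in> Alt2 sH sQ"
  then obtain F where F: "F \<in> Alt sL" "f = uncombine F" by (meson Alt2_obtain_uncombine)
  show ?thesis
    unfolding F(2) T.op_sum_eq[OF F(1)] T_ced D_eq_ced[OF F(1), symmetric] uncombine_D[OF F(1)] ..
qed

text \<open>By \<open>op_sum_triple\<close> the sums agree. On a bihomogeneous form, at most one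
  summand on each side is nonzero for a given number of arguments from \<open>Q\<close>.\<close>

lemma ops_triple:
  assumes f: "f \<in> Alt2 sH sQ"
  shows "op0 triple f = d 0 f \<and> op1 triple f = d 1 f \<and> op2 triple f = d 2 f"
  using f
proof (induction rule: Alt2_induct)
  case zero
  have "op0 triple 0 = 0" "op1 triple 0 = 0" "op2 triple 0 = 0"
    using Alt2_derivation_zero[OF T.derivation_op0] Alt2_derivation_zero[OF T.derivation_op1]
      Alt2_derivation_zero[OF T.derivation_op2]
    by (simp_all only: restrict_apply Alt2_zero if_True)
  then show ?case
    by (simp only: Alt2_derivation_zero[OF derivation] simp_thms)
next
  case (add f g)
  note d = Alt2_derivation_add[OF derivation add.hyps(1,2)]
  note ops = Alt2_derivation_restrict_add[OF T.derivation_op0 add.hyps(1,2)]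
    Alt2_derivation_restrict_add[OF T.derivation_op1 add.hyps(1,2)]
    Alt2_derivation_restrict_add[OF T.derivation_op2 add.hyps(1,2)]
  show ?case
    unfolding ops using d[of 0] d[of 1] d[of 2] add.IH by (simp only: simp_thms)
next
  case (component p q f)
  have f: "f \<in> Alt2 sH sQ" using component by (simp add: Alt2_comp_def)
  have zero_d: "d j f \<xi>s xs = 0" if "j < 3" "length \<xi>s \<noteq> p + j" for j \<xi>s xs
  proof -
    have "d j f \<in> Alt2_comp sH sQ (int p + int j) (int q - int j + 1)"
      using bidegree[OF that(1)] component unfolding has_bidegree_def by blast
    then show ?thesis using that(2) unfolding Alt2_comp_def by force
  qed
  have ops: "op0 triple f \<in> Alt2_comp sH sQ (int p + 0) (int q - 0 + 1)"
    "op1 triple f \<in> Alt2_comp sH sQ (int p + 1) (int q - 1 + 1)"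
    "op2 triple f \<in> Alt2_comp sH sQ (int p + 2) (int q - 2 + 1)"
    using T.bidegree_ops f component unfolding has_bidegree_def image_subset_iff by (metis restrict_apply)+
  have sum: "op0 triple f \<xi>s xs + op1 triple f \<xi>s xs + op2 triple f \<xi>s xs =
      d 0 f \<xi>s xs + d 1 f \<xi>s xs + d 2 f \<xi>s xs" for \<xi>s xs
    using op_sum_triple[OF f] by (simp add: fun_eq_iff op_sum_def numeral_3_eq_3 numeral_2_eq_2)
  have "op0 triple f \<xi>s xs = d 0 f \<xi>s xs \<and> op1 triple f \<xi>s xs = d 1 f \<xi>s xs \<and> op2 triple f \<xi>s xs = d 2 f \<xi>s xs"
    for \<xi>s xs
  proof -
    have 0: "op0 triple f \<xi>s xs = 0 \<and> d 0 f \<xi>s xs = 0" if "length \<xi>s \<noteq> p"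
      using zero_d[of 0 \<xi>s xs] ops(1) that unfolding Alt2_comp_def by force
    have 1: "op1 triple f \<xi>s xs = 0 \<and> d 1 f \<xi>s xs = 0" if "length \<xi>s \<noteq> p + 1"
      using zero_d[of 1 \<xi>s xs] ops(2) that unfolding Alt2_comp_def by force
    have 2: "op2 triple f \<xi>s xs = 0 \<and> d 2 f \<xi>s xs = 0" if "length \<xi>s \<noteq> p + 2"
      using zero_d[of 2 \<xi>s xs] ops(3) that unfolding Alt2_comp_def by force
    show ?thesis using 0 1 2 sum[of \<xi>s xs]
      by (cases "length \<xi>s = p"; cases "length \<xi>s = p + 1"; cases "length \<xi>s = p + 2") auto
  qed
  then show ?case by (simp add: fun_eq_iff)
qed

lemma lie_rinehart_triple:
  assumes square: "\<And>f. f \<in> Alt2 sH sQ \<Longrightarrow> (\<Sum>j<3. d j (\<Sum>i<3. d i f)) = 0"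
  shows "lie_rinehart_triple sR sH sQ triple"
proof -
  have "ced (ced F) = 0" if F: "F \<in> Alt sL" for F
  proof (rule uncombine_inject)
    show "ced (ced F) \<in> Alt sL" "0 \<in> Alt sL" using F by (auto intro: Alt_ced)
    have "uncombine (ced (ced F)) = (\<Sum>j<3. d j (\<Sum>i<3. d i (uncombine F)))"
      unfolding D_eq_ced[OF F, symmetric] D_eq_ced[OF D_Alt[OF F], symmetric]
        uncombine_D[OF D_Alt[OF F]] uncombine_D[OF F] ..
    also have "\<dots> = 0" by (rule square[OF uncombine_in_Alt2[OF F]])
    finally show "uncombine (ced (ced F)) = uncombine 0" by (simp add: fun_eq_iff uncombine_apply)
  qed
  then have sq: "ced (ced F) zs = 0" if "F \<in> Alt sL" for F zs using that by simp
  \<comment> \<open>Degree 0 comes before degree 1, since \<open>jacobi_if_ced_ced\<close>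
    presupposes the compatibility of the action.\<close>
  have flat: "act (br x y) a = act x (act y a) - act y (act x a)" for x y a
    by (rule act_br_if_ced_ced) (rule sq[OF Alt_constant_form])
  have "br x (br y z) + br y (br z x) + br z (br x y) = 0" for x y z
  proof (rule L.eq_if_homs_eq)
    fix \<psi> assume \<psi>: "module_hom_to_ring sL \<psi>"
    have "\<psi> 0 = 0" using \<psi> unfolding module_hom_to_ring_def by (intro additive_zero) blast
    then show "\<psi> (br x (br y z) + br y (br z x) + br z (br x y)) = \<psi> 0"
      using jacobi_if_ced_ced[OF flat \<psi> sq[OF Alt_linear_form[OF \<psi>]]] by simp
  qed
  with flat show ?thesis
    unfolding T.lie_rinehart_triple_iff triple_bracket triple_action by blast
qed

end


section \<open>The bijection\<close>

text \<open>The action is read off from \<open>ced\<close> on constants; then linear forms, which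
  separate vectors, show the bracket. Each structure map is a component, up to sign, of these at
  vectors from \<open>Q\<close> or \<open>H\<close>.\<close>

lemma triple_eq_if_ops_eq:
  assumes "almost_pre_lie_rinehart_triple sR sH sQ T" "almost_pre_lie_rinehart_triple sR sH sQ T'"
    and "dual_basis sH KH eH \<phi>H" "dual_basis sQ KQ eQ \<phi>Q"
    and ops: "\<And>f. f \<in> Alt2 sH sQ \<Longrightarrow> op_sum T f = op_sum T' f"
  shows "T = T'"
proof -
  interpret T: almost_pre_lie_rinehart_triple sR sH sQ T by fact
  interpret T': almost_pre_lie_rinehart_triple sR sH sQ T' by fact
  note L = dual_basis_scale_prod[OF assms(4,3)]
  have ced: "T.L.ced F = T'.L.ced F" if F: "F \<in> Alt T.sL" for F
    using ops[OF T.uncombine_in_Alt2[OF F]] unfolding T.op_sum_eq[OF F] T'.op_sum_eq[OF F]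
    by (rule T.uncombine_inject[OF T.L.Alt_ced[OF F] T'.L.Alt_ced[OF F]])
  have act: "triple_action T z a = triple_action T' z a" for z a
  proof -
    have "T.L.ced (constant_form a) [z] = T'.L.ced (constant_form a) [z]"
      unfolding ced[OF Alt_constant_form] ..
    then show ?thesis by simp
  qed
  have br: "triple_bracket T z w = triple_bracket T' z w" for z w
  proof (rule dual_basis.eq_if_homs_eq[OF L])
    fix \<psi> assume "module_hom_to_ring T.sL \<psi>"
    then have "T.L.ced (linear_form \<psi>) [z, w] = T'.L.ced (linear_form \<psi>) [z, w]"
      using ced[OF Alt_linear_form] by simp
    then show "\<psi> (triple_bracket T z w) = \<psi> (triple_bracket T' z w)"
      by (simp add: T.L.ced_constant_form T'.L.ced_constant_form act)
  qed
  have "brH T x y = brH T' x y" for x y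
    using br[of "(0, x)" "(0, y)"] by (simp add: triple_bracket_Pair)
  moreover have "brQ T \<xi> \<eta> = brQ T' \<xi> \<eta>" "delta T \<xi> \<eta> = delta T' \<xi> \<eta>" for \<xi> \<eta>
    using br[of "(\<xi>, 0)" "(\<eta>, 0)"] by (simp_all add: triple_bracket_Pair)
  moreover have "dotHQ T x \<xi> = dotHQ T' x \<xi>" "dotQH T \<xi> x = dotQH T' \<xi> x" for x \<xi>
    using br[of "(\<xi>, 0)" "(0, x)"] by (simp_all add: triple_bracket_Pair)
  moreover have "actH T x a = actH T' x a" "actQ T \<xi> a = actQ T' \<xi> a" for x \<xi> a
    using act[of "(0, x)" a] act[of "(\<xi>, 0)" a] by (simp_all add: triple_action_Pair)
  ultimately show ?thesis by (intro triple.equality) (simp_all add: fun_eq_iff)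
qed

theorem theorem2p8p3:
  fixes sR :: "'r::{comm_ring, comm_monoid_mult} \<Rightarrow> 'a::{comm_ring, comm_monoid_mult} \<Rightarrow> 'a"
    and sH :: "'a \<Rightarrow> 'h::ab_group_add \<Rightarrow> 'h"
    and sQ :: "'a \<Rightarrow> 'q::ab_group_add \<Rightarrow> 'q"
  assumes "algebra_over sR"
    and "fg_projective_module sH"
    and "fg_projective_module sQ"
  shows "bij_betw (triple_operators sH sQ)
           (lie_rinehart_triples sR sH sQ) (maurer_cartan_structures sR sH sQ)"
proof -
  obtain KH eH \<phi>H where H: "dual_basis sH KH eH \<phi>H"
    using fg_projective_module.obtain_dual_basis[OF assms(2)] .
  obtain KQ eQ \<phi>Q where Q: "dual_basis sQ KQ eQ \<phi>Q"
    using fg_projective_module.obtain_dual_basis[OF assms(3)] .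
  have almost: "almost_pre_lie_rinehart_triple sR sH sQ T" if "T \<in> lie_rinehart_triples sR sH sQ" for T
    using that by (simp add: lie_rinehart_triples_def lie_rinehart_triple_def)
  have "inj_on (triple_operators sH sQ) (lie_rinehart_triples sR sH sQ)"
  proof (rule inj_onI)
    fix T T' assume T: "T \<in> lie_rinehart_triples sR sH sQ" "T' \<in> lie_rinehart_triples sR sH sQ"
      and eq: "triple_operators sH sQ T = triple_operators sH sQ T'"
    show "T = T'"
    proof (rule triple_eq_if_ops_eq[OF almost[OF T(1)] almost[OF T(2)] H Q])
      fix f assume f: "f \<in> Alt2 sH sQ"
      have "op0 T f = op0 T' f" "op1 T f = op1 T' f" "op2 T f = op2 T' f"
        using eq f unfolding triple_operators_def prod.inject by (metis restrict_apply)+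
      then show "op_sum T f = op_sum T' f" by (simp only: op_sum_def)
    qed
  qed
  moreover have "triple_operators sH sQ T \<in> maurer_cartan_structures sR sH sQ"
    if T: "T \<in> lie_rinehart_triples sR sH sQ" for T
    using almost_pre_lie_rinehart_triple.triple_operators_in_maurer_cartan[OF almost[OF T]] T
    by (simp add: lie_rinehart_triples_def)
  moreover have "ds \<in> triple_operators sH sQ ` lie_rinehart_triples sR sH sQ"
    if "ds \<in> maurer_cartan_structures sR sH sQ" for ds
  proof -
    obtain d0 d1 d2 where ds: "ds = (d0, d1, d2)" by (cases ds)
    note mc = that[unfolded ds maurer_cartan_structures_def Let_def mem_Collect_eq case_prod_conv]
    define d where "d = (\<lambda>j :: nat. if j = 0 then d0 else if j = 1 then d1 else d2)"
    have d: "d 0 = d0" "d 1 = d1" "d 2 = d2" by (simp_all add: d_def)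
    have less3: "j = 0 \<or> j = 1 \<or> j = 2" if "j < 3" for j :: nat using that by auto
    interpret maurer_cartan sR sH sQ KQ eQ \<phi>Q KH eH \<phi>H d
    proof (intro maurer_cartan.intro maurer_cartan_axioms.intro assms H Q two_modules.intro)
      show "module_over sH" "module_over sQ" using H Q by (simp_all add: dual_basis_def)
      show "Alt2_derivation sR sH sQ (d j)" "has_bidegree sH sQ (int j) (d j)" if "j < 3" for j
        using less3[OF that] mc by (auto simp: d_def)
    qed
    have sum3: "(\<Sum>j<3. g j) = g 0 + g 1 + g 2" for g :: "nat \<Rightarrow> ('a, 'h, 'q) form"
      by (simp add: numeral_3_eq_3 numeral_2_eq_2)
    have "lie_rinehart_triple sR sH sQ triple"
      by (rule lie_rinehart_triple) (unfold sum3 d, use mc in blast)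
    \<comment> \<open>Operators are extensional functions, so agreement on \<open>Alt2 sH sQ\<close>
      suffices.\<close>
    moreover have "restrict op (Alt2 sH sQ) = e"
      if "\<And>f. f \<in> Alt2 sH sQ \<Longrightarrow> op f = e f" "Alt2_derivation sR sH sQ e" for op e
    proof (rule extensionalityI[of _ "Alt2 sH sQ"])
      show "e \<in> extensional (Alt2 sH sQ)" using that(2) by (auto simp: Alt2_derivation_def PiE_iff)
    qed (simp_all add: that(1))
    then have "triple_operators sH sQ triple = ds"
      using ops_triple mc unfolding triple_operators_def ds d by blast
    ultimately show ?thesis by (auto simp: lie_rinehart_triples_def image_iff)
  qed
  ultimately show ?thesis unfolding bij_betw_def by blast
qed

end
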